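(* Let $({\rm f},{\rm E},{\rm B})$ be a smooth solution on $[0,T[$ ($T\in\,]0,+\infty]$) of the Cauchy problem for the Relativistic Vlasov-Maxwell system with initial data $({\rm f}_0,{\rm E}_0,{\rm B}_0)$, with ${\rm f}$ compactly supported with respect to $\xi$. For $t\in[0,T[$ and $(y,\eta)\in\mathbb R^3\times\mathbb R^3$, let ${\rm D}={\rm D}(t,y,\eta):=\langle\Xi(t,y,\eta)\rangle-\langle\eta\rangle$ be the momentum increment, and write $X(s)=X(s,y,\eta)$, $\Xi(s)=\Xi(s,y,\eta)$. Then ${\rm D}={\rm D}_0+{\rm D}_h+{\rm D}_l+{\rm D}_n$ with $${\rm D}_0:=\int_0^t\int_{\mathbb S^2}\int_{\mathbb R^3}{\rm W}_0(s,\omega,\xi)\,{\rm f}_0\bigl(X(s)+s\omega,\xi\bigr)\,ds\,d\omega\,d\xi,$$ $${\rm D}_h:=\int_0^t\nu(\Xi(s))\cdot{\rm E}_h\bigl(s,X(s)\bigr)\,ds,$$ $${\rm D}_l:=\int_0^t\Bigl(\int_r^t\int_{\mathbb S^2}\int_{\mathbb R^3}{\rm W}_l(s,\omega,\xi)\,{\rm f}\bigl(r,X(s)+(s-r)\omega,\xi\bigr)\,ds\,d\omega\,d\xi\Bigr)dr,$$ $${\rm D}_n:=\int_0^t\Bigl(\int_r^t\int_{\mathbb S^2}\int_{\mathbb R^3}{\rm W}_n(r,s,\omega,\xi)\cdot{\rm F}\bigl(r,X(s)+(s-r)\omega,\xi\bigr)\,{\rm f}\bigl(r,X(s)+(s-r)\omega,\xi\bigr)\,ds\,d\omega\,d\xi\Bigr)dr,$$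 where the weights are $${\rm W}_0(s,\omega,\xi):=-\frac{s}{4\pi}\,\frac{\nu(\Xi(s))\cdot(\nu(\xi)+\omega)}{1+\omega\cdot\nu(\xi)},\qquad {\rm W}_l(s,\omega,\xi):=-\frac1{4\pi}\,\frac1{\langle\xi\rangle^2}\,\frac{\nu(\Xi(s))\cdot(\omega+\nu(\xi))}{\bigl(1+\omega\cdot\nu(\xi)\bigr)^2},$$ $${\rm W}_n(r,s,\omega,\xi):=-\frac{s-r}{4\pi}\,\nabla_\xi\Bigl(\frac{\nu(\Xi(s))\cdot(\nu(\xi)+\omega)}{1+\omega\cdot\nu(\xi)}\Bigr).$$
   Context: Notation: $\langle\xi\rangle:=\sqrt{1+|\xi|^2}$, $\nu(\xi):=\xi/\langle\xi\rangle$ for $\xi\in\mathbb R^3$; $d\omega$ is the surface measure on the unit sphere $\mathbb S^2\subset\mathbb R^3$. The Relativistic Vlasov-Maxwell system, for ${\rm f}(t,x,\xi)\in\mathbb R_+$, ${\rm E}(t,x),{\rm B}(t,x)\in\mathbb R^3$, $(t,x,\xi)\in\mathbb R\times\mathbb R^3\times\mathbb R^3$, is $$\partial_t{\rm f}+\nu(\xi)\cdot\nabla_x{\rm f}+{\rm F}\cdot\nabla_\xi{\rm f}=0,\qquad{\rm F}(t,x,\xi):={\rm E}(t,x)+\nu(\xi)\times{\rm B}(t,x),$$ $$\partial_t{\rm E}-\nabla_x\times{\rm B}=-\int_{\mathbb R^3}\nu(\xi){\rm f}\,d\xi,\quad\nabla_x\cdot{\rm E}=\int_{\mathbb R^3}{\rm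 f}\,d\xi-\rho,\quad\partial_t{\rm B}+\nabla_x\times{\rm E}=0,\quad\nabla_x\cdot{\rm B}=0,$$ where $\rho\in C^1_c(\mathbb R^3;\mathbb R_+)$ is given, with initial data $({\rm f},{\rm E},{\rm B})_{|t=0}=({\rm f}_0,{\rm E}_0,{\rm B}_0)$ satisfying $\nabla_x\cdot{\rm E}_0=\int{\rm f}_0\,d\xi-\rho$ and $\nabla_x\cdot{\rm B}_0=0$. The characteristics $(X,\Xi)(t,y,\eta)$ solve $$\frac{dX}{dt}=\nu(\Xi),\quad X(0,y,\eta)=y;\qquad\frac{d\Xi}{dt}={\rm F}(t,X,\Xi),\quad\Xi(0,y,\eta)=\eta.$$ The field ${\rm E}_h$ is the solution of the homogeneous wave equation $$\partial^2_{tt}{\rm E}_h-\Delta_x{\rm E}_h=0,\qquad{\rm E}_{h|t=0}={\rm E}_0,\qquad\partial_t{\rm E}_{h|t=0}=\nabla_x\times{\rm B}_0.$$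
   Formalization: The printed identity fails for nonzero ρ (e.g. f=0, B=0, static E with div E=-ρ); the formal identity adds the term ∫_0^t∫_r^t∫_{S²} (s-r)/(4π) ν(Ξ(s))·∇ρ(X(s)+(s-r)ω) dω ds dr, which vanishes when ρ=0. *)

theory Defs
  imports "HOL-Analysis.Analysis"
begin

section \<open>Differential calculus\<close>

text \<open>
  The space-time domain [0,T[ x R^3 x R^3 contains its boundary t = 0, so differentiability is taken
  relative to the domain (one-sided in t at t = 0). The sets used below are convex with nonempty
  interior, so these relative derivatives are unique.
\<close>

primrec Ck_on :: "nat \<Rightarrow> 'a::real_normed_vector set \<Rightarrow> ('a \<Rightarrow> 'b::real_normed_vector) \<Rightarrow> bool" where
  "Ck_on 0 S u \<longleftrightarrow> continuous_on S u"
| "Ck_on (Suc k) S u \<longleftrightarrow>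
     u differentiable_on S \<and> (\<forall>v. Ck_on k S (\<lambda>z. frechet_derivative u (at z within S) v))"

definition smooth_on :: "'a::real_normed_vector set \<Rightarrow> ('a \<Rightarrow> 'b::real_normed_vector) \<Rightarrow> bool" where
  "smooth_on S u \<longleftrightarrow> (\<forall>k. Ck_on k S u)"

definition time_interval :: "ereal \<Rightarrow> real set" where
  "time_interval T = {t. 0 \<le> t \<and> ereal t < T}"

definition time_deriv :: "ereal \<Rightarrow> (real \<Rightarrow> 'a::real_normed_vector) \<Rightarrow> real \<Rightarrow> 'a" where
  "time_deriv T u t = vector_derivative u (at t within time_interval T)"

definition partial :: "3 \<Rightarrow> (real^3 \<Rightarrow> 'a::real_normed_vector) \<Rightarrow> real^3 \<Rightarrow> 'a" where
  "partial i u x = frechet_derivative u (at x) (axis i 1)"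

definition grad :: "(real^3 \<Rightarrow> real) \<Rightarrow> real^3 \<Rightarrow> real^3" where
  "grad u x = (\<chi> i. partial i u x)"

definition divergence :: "(real^3 \<Rightarrow> real^3) \<Rightarrow> real^3 \<Rightarrow> real" where
  "divergence G x = (\<Sum>i\<in>UNIV. partial i G x $ i)"

definition curl :: "(real^3 \<Rightarrow> real^3) \<Rightarrow> real^3 \<Rightarrow> real^3" where
  "curl G x = vector [partial 2 G x $ 3 - partial 3 G x $ 2,
                      partial 3 G x $ 1 - partial 1 G x $ 3,
                      partial 1 G x $ 2 - partial 2 G x $ 1]"

definition laplacian :: "(real^3 \<Rightarrow> 'a::real_normed_vector) \<Rightarrow> real^3 \<Rightarrow> 'a" where
  "laplacian u x = (\<Sum>i\<in>UNIV. partial i (partial i u) x)"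

section \<open>Surface measure on the unit sphere\<close>

text \<open>
  The surface measure of a Borel set A of directions is DIM times the Lebesgue measure of the cone
  \<open>{x. 0 < norm x \<le> 1 \<and> x / norm x \<in> A}\<close>. It is a Borel measure on the whole space that is
  concentrated on the unit sphere.
\<close>

definition sphere_measure :: "'a::euclidean_space measure" where
  "sphere_measure =
     scale_measure (of_nat DIM('a)) (distr (restrict_space lborel (cball 0 1 - {0})) borel sgn)"

lemma emeasure_sphere_measure_UNIV:
  "emeasure (sphere_measure :: (real^3) measure) UNIV = ennreal (4 * pi)"
proof -
  let ?C = "cball 0 1 - {0} :: (real^3) set"
  have meas: "sgn \<in> measurable (restrict_space lborel ?C) (borel :: (real^3) measure)"
    by (rule measurable_restrict_space1) (simp add: sgn_div_norm)
  have eq: "emeasure (distr (restrict_space lborel ?C) borel sgn) (UNIV :: (real^3) set)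
          = emeasure lborel ?C"
    using meas by (subst emeasure_distr) (simp_all add: space_restrict_space emeasure_restrict_space)
  have "emeasure lborel ?C = emeasure lborel (cball 0 1 :: (real^3) set)"
    by (rule emeasure_Diff_null_set) (auto simp: null_sets_def)
  also have "\<dots> = ennreal (4 / 3 * pi)"
    by (subst emeasure_cball) (simp_all add: unit_ball_vol_numeral fact_numeral)
  finally have "emeasure (sphere_measure :: (real^3) measure) UNIV = 3 * ennreal (4 / 3 * pi)"
    using eq by (simp add: sphere_measure_def)
  also have "\<dots> = ennreal (4 * pi)"
    by (subst ennreal_numeral[symmetric], subst ennreal_mult[symmetric]) (auto simp: field_simps)
  finally show ?thesis .
qed

section \<open>The relativistic Vlasov-Maxwell system\<close>

definition jbr :: "real^3 \<Rightarrow> real" where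
  "jbr \<xi> = sqrt (1 + (norm \<xi>)\<^sup>2)"

definition nu :: "real^3 \<Rightarrow> real^3" where
  "nu \<xi> = \<xi> /\<^sub>R jbr \<xi>"

definition lorentz_force ::
  "(real \<Rightarrow> real^3 \<Rightarrow> real^3) \<Rightarrow> (real \<Rightarrow> real^3 \<Rightarrow> real^3) \<Rightarrow> real \<Rightarrow> real^3 \<Rightarrow> real^3 \<Rightarrow> real^3" where
  "lorentz_force E B t x \<xi> = E t x + cross3 (nu \<xi>) (B t x)"

definition rvm_system ::
  "ereal \<Rightarrow> (real^3 \<Rightarrow> real) \<Rightarrow> (real \<Rightarrow> real^3 \<Rightarrow> real^3 \<Rightarrow> real)
    \<Rightarrow> (real \<Rightarrow> real^3 \<Rightarrow> real^3) \<Rightarrow> (real \<Rightarrow> real^3 \<Rightarrow> real^3) \<Rightarrow> bool" where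
  "rvm_system T \<rho> f E B \<longleftrightarrow>
    (\<forall>t\<in>time_interval T. \<forall>x.
      (\<forall>\<xi>. 0 \<le> f t x \<xi>) \<and>
      (\<forall>\<xi>. time_deriv T (\<lambda>s. f s x \<xi>) t + nu \<xi> \<bullet> grad (\<lambda>z. f t z \<xi>) x
             + lorentz_force E B t x \<xi> \<bullet> grad (\<lambda>\<zeta>. f t x \<zeta>) \<xi> = 0) \<and>
      time_deriv T (\<lambda>s. E s x) t - curl (B t) x = - (\<integral>\<xi>. f t x \<xi> *\<^sub>R nu \<xi> \<partial>lborel) \<and>
      divergence (E t) x = (\<integral>\<xi>. f t x \<xi> \<partial>lborel) - \<rho> x \<and>
      time_deriv T (\<lambda>s. B s x) t + curl (E t) x = 0 \<and>
      divergence (B t) x = 0)"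

text \<open>Compact support in \<open>\<xi>\<close>, locally uniformly in (t,x).\<close>

definition momentum_compact_support ::
  "ereal \<Rightarrow> (real \<Rightarrow> real^3 \<Rightarrow> real^3 \<Rightarrow> real) \<Rightarrow> bool" where
  "momentum_compact_support T f \<longleftrightarrow>
    (\<forall>K. compact K \<and> K \<subseteq> time_interval T \<times> UNIV \<longrightarrow>
      (\<exists>P. \<forall>(t, x)\<in>K. \<forall>\<xi>. f t x \<xi> \<noteq> 0 \<longrightarrow> norm \<xi> \<le> P))"

definition characteristics ::
  "ereal \<Rightarrow> (real \<Rightarrow> real^3 \<Rightarrow> real^3) \<Rightarrow> (real \<Rightarrow> real^3 \<Rightarrow> real^3)
    \<Rightarrow> (real \<Rightarrow> real^3 \<Rightarrow> real^3 \<Rightarrow> real^3) \<Rightarrow> (real \<Rightarrow> real^3 \<Rightarrow> real^3 \<Rightarrow> real^3) \<Rightarrow> bool" where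
  "characteristics T E B X \<Xi> \<longleftrightarrow>
    (\<forall>y \<eta>. X 0 y \<eta> = y \<and> \<Xi> 0 y \<eta> = \<eta> \<and>
      (\<forall>t\<in>time_interval T.
        ((\<lambda>s. X s y \<eta>) has_vector_derivative nu (\<Xi> t y \<eta>)) (at t within time_interval T) \<and>
        ((\<lambda>s. \<Xi> s y \<eta>) has_vector_derivative lorentz_force E B t (X t y \<eta>) (\<Xi> t y \<eta>))
          (at t within time_interval T)))"

definition homogeneous_wave ::
  "ereal \<Rightarrow> (real^3 \<Rightarrow> real^3) \<Rightarrow> (real^3 \<Rightarrow> real^3) \<Rightarrow> (real \<Rightarrow> real^3 \<Rightarrow> real^3) \<Rightarrow> bool" where
  "homogeneous_wave T E0 B0 Eh \<longleftrightarrow>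
    Ck_on 2 (time_interval T \<times> UNIV) (\<lambda>(t, x). Eh t x) \<and>
    (\<forall>t\<in>time_interval T. \<forall>x.
      time_deriv T (time_deriv T (\<lambda>s. Eh s x)) t - laplacian (Eh t) x = 0) \<and>
    (\<forall>x. Eh 0 x = E0 x) \<and>
    (\<forall>x. time_deriv T (\<lambda>s. Eh s x) 0 = curl B0 x)"

section \<open>Weights and the terms of the momentum increment\<close>

text \<open>Below, \<open>X\<close> and \<open>\<Xi>\<close> are the two components of one fixed characteristic curve.\<close>

definition W0 :: "(real \<Rightarrow> real^3) \<Rightarrow> real \<Rightarrow> real^3 \<Rightarrow> real^3 \<Rightarrow> real" where
  "W0 \<Xi> s \<omega> \<xi> = - (s / (4 * pi)) * ((nu (\<Xi> s) \<bullet> (nu \<xi> + \<omega>)) / (1 + \<omega> \<bullet> nu \<xi>))"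

definition Wl :: "(real \<Rightarrow> real^3) \<Rightarrow> real \<Rightarrow> real^3 \<Rightarrow> real^3 \<Rightarrow> real" where
  "Wl \<Xi> s \<omega> \<xi> =
     - (1 / (4 * pi)) * (1 / (jbr \<xi>)\<^sup>2) * ((nu (\<Xi> s) \<bullet> (\<omega> + nu \<xi>)) / (1 + \<omega> \<bullet> nu \<xi>)\<^sup>2)"

definition Wn :: "(real \<Rightarrow> real^3) \<Rightarrow> real \<Rightarrow> real \<Rightarrow> real^3 \<Rightarrow> real^3 \<Rightarrow> real^3" where
  "Wn \<Xi> r s \<omega> \<xi> =
     - ((s - r) / (4 * pi)) *\<^sub>R grad (\<lambda>\<zeta>. (nu (\<Xi> s) \<bullet> (nu \<zeta> + \<omega>)) / (1 + \<omega> \<bullet> nu \<zeta>)) \<xi>"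

definition D0 ::
  "(real^3 \<Rightarrow> real^3 \<Rightarrow> real) \<Rightarrow> (real \<Rightarrow> real^3) \<Rightarrow> (real \<Rightarrow> real^3) \<Rightarrow> real \<Rightarrow> real" where
  "D0 f0 X \<Xi> t =
     (LBINT s:{0..t}. \<integral>\<omega>. (\<integral>\<xi>. W0 \<Xi> s \<omega> \<xi> * f0 (X s + s *\<^sub>R \<omega>) \<xi> \<partial>lborel) \<partial>sphere_measure)"

definition Dh ::
  "(real \<Rightarrow> real^3 \<Rightarrow> real^3) \<Rightarrow> (real \<Rightarrow> real^3) \<Rightarrow> (real \<Rightarrow> real^3) \<Rightarrow> real \<Rightarrow> real" where
  "Dh Eh X \<Xi> t = (LBINT s:{0..t}. nu (\<Xi> s) \<bullet> Eh s (X s))"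

definition Dl ::
  "(real \<Rightarrow> real^3 \<Rightarrow> real^3 \<Rightarrow> real) \<Rightarrow> (real \<Rightarrow> real^3) \<Rightarrow> (real \<Rightarrow> real^3) \<Rightarrow> real \<Rightarrow> real" where
  "Dl f X \<Xi> t =
     (LBINT r:{0..t}. (LBINT s:{r..t}. \<integral>\<omega>. (\<integral>\<xi>.
        Wl \<Xi> s \<omega> \<xi> * f r (X s + (s - r) *\<^sub>R \<omega>) \<xi> \<partial>lborel) \<partial>sphere_measure))"

definition Dn ::
  "(real \<Rightarrow> real^3 \<Rightarrow> real^3 \<Rightarrow> real) \<Rightarrow> (real \<Rightarrow> real^3 \<Rightarrow> real^3) \<Rightarrow> (real \<Rightarrow> real^3 \<Rightarrow> real^3)
    \<Rightarrow> (real \<Rightarrow> real^3) \<Rightarrow> (real \<Rightarrow> real^3) \<Rightarrow> real \<Rightarrow> real" where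
  "Dn f E B X \<Xi> t =
     (LBINT r:{0..t}. (LBINT s:{r..t}. \<integral>\<omega>. (\<integral>\<xi>.
        (Wn \<Xi> r s \<omega> \<xi> \<bullet> lorentz_force E B r (X s + (s - r) *\<^sub>R \<omega>) \<xi>)
          * f r (X s + (s - r) *\<^sub>R \<omega>) \<xi> \<partial>lborel) \<partial>sphere_measure))"

text \<open>
  Maxwell's equations give \<open>\<partial>\<^sub>t\<^sub>t E - \<Delta> E = - \<partial>\<^sub>t (\<integral> \<nu> f d\<xi>) - \<nabla> (\<integral> f d\<xi>) + \<nabla> \<rho>\<close>. The terms D0, Dl and Dn
  come from the first two sources and the initial current, and Dh from the data of \<open>Eh\<close>; none of
  them accounts for \<open>\<nabla> \<rho>\<close>. Its retarded potential contributes \<open>D_rho\<close>, which is zero for \<open>\<rho> = 0\<close>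
  but not in general: for a static solution with f = 0 and B = 0 the terms D0, Dl and Dn vanish
  while the momentum increment differs from Dh as soon as \<open>\<nabla> \<rho>\<close> is not identically zero.
\<close>

definition D_rho ::
  "(real^3 \<Rightarrow> real) \<Rightarrow> (real \<Rightarrow> real^3) \<Rightarrow> (real \<Rightarrow> real^3) \<Rightarrow> real \<Rightarrow> real" where
  "D_rho \<rho> X \<Xi> t =
     (LBINT r:{0..t}. (LBINT s:{r..t}. \<integral>\<omega>.
        (s - r) / (4 * pi) * (nu (\<Xi> s) \<bullet> grad \<rho> (X s + (s - r) *\<^sub>R \<omega>)) \<partial>sphere_measure))"

lemma D_rho_zero: "D_rho (\<lambda>_. 0) X \<Xi> t = 0"
proof -
  have "grad (\<lambda>_. 0) = (\<lambda>_. 0)"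
    by (auto simp: fun_eq_iff grad_def partial_def vec_eq_iff)
  then show ?thesis
    by (simp add: D_rho_def set_lebesgue_integral_def)
qed

end

theory Submission
  imports Defs
begin

text \<open>
  Along a characteristic curve the magnetic force does no work, so the energy \<open>jbr (\<Xi> s)\<close> changes at
  the rate \<open>nu (\<Xi> s) \<bullet> E s (X s)\<close> (\<open>energy_identity\<close>). Everything else is a representation of the
  electric field at one point of space-time.

  Maxwell's equations give \<open>\<partial>\<^sub>t\<^sub>t E - \<Delta> E = - \<partial>\<^sub>t j - \<nabla> n + \<nabla> \<rho>\<close>, where \<open>n = \<integral> f d\<xi>\<close> and
  \<open>j = \<integral> nu \<xi> f d\<xi>\<close> (\<open>wave_equation\<close>). The difference \<open>E - Eh\<close> solves the same equation, vanishes at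
  time 0 and has the initial velocity \<open>- j\<close>, so that Kirchhoff's formula writes it as an integral of the
  sources over the backward light cone plus an integral of the initial current over a sphere. The
  sources contain derivatives of \<open>f\<close>. These are removed as by Glassey and Strauss: for a vector \<open>v\<close>, the
  derivative of \<open>f\<close> along \<open>(v \<bullet> nu \<xi>, v)\<close> is a combination of the transport derivative
  \<open>\<partial>\<^sub>t + nu \<xi> \<bullet> \<nabla>\<close> and of a derivative tangent to the cone. The Vlasov equation turns the first one into a
  derivative in \<open>\<xi>\<close>, and an integration by parts in \<open>\<xi>\<close> moves it to the weight, which gives Dn. The second
  one is integrated by parts on the cone itself: the interior contribution is Dl, and the contribution
  of the initial sphere combines with the initial current to D0 (\<open>glassey_strauss\<close>). The source \<open>\<nabla> \<rho>\<close>
  is kept as it is and gives D_rho. Integrating over \<open>s\<close> and exchanging the integrals over the triangle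
  \<open>0 \<le> r \<le> s \<le> t\<close> concludes.

  Neither a divergence theorem on balls nor polar coordinates are involved. Points of the cone are
  written \<open>(r, x + (s - r) \<omega>)\<close>, and a cone integral is an integral in \<open>r\<close> of integrals over the unit
  sphere. A derivative tangent to the cone then splits into a derivative in \<open>r\<close> at fixed \<open>\<omega>\<close>, treated by
  the fundamental theorem of calculus, and an angular derivative, treated by the divergence theorem on
  the unit sphere (\<open>sphere_divergence\<close>). The latter only expresses that the surface measure is invariant
  under rotations. Both Kirchhoff's formula and the Glassey-Strauss identity are obtained by
  differentiating one integral over the sphere in \<open>r\<close>, and the kernels never become singular.

  The momenta that matter fill a compact ball, so all integrals are integrals of continuous functions
  over compact sets. Two points need care. Derivatives at \<open>t = 0\<close> are one-sided, so equations are
  differentiated only at positive times and the values at the ends of the time interval enter through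
  continuity. And \<open>sphere_measure\<close> lives on the whole space, where the weight Wn has singularities away
  from the sphere, so its Borel measurability has to be proved (\<open>borel_measurable_grad_ratio\<close>).
\<close>

section \<open>Integrals of continuous functions over compact sets\<close>

lemma set_integrable_continuous_compact:
  fixes f :: "'a::euclidean_space \<Rightarrow> real"
  assumes [measurable_cong]: "sets M = sets borel" and K: "compact K" "emeasure M K < \<infinity>"
    and f: "continuous_on K f"
  shows "set_integrable M K f"
proof -
  have KM: "K \<in> sets M" using K(1) by (simp add: assms(1) borel_compact)
  obtain C where C: "\<And>x. x \<in> K \<Longrightarrow> norm (f x) \<le> C"
    using compact_imp_bounded[OF compact_continuous_image[OF f K(1)]]
    by (auto simp: bounded_iff)
  have "(\<lambda>x. indicator K x *\<^sub>R f x) \<in> borel_measurable borel"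
    using borel_measurable_continuous_on_indicator[OF _ f] K(1) by (simp add: borel_compact)
  then have "(\<lambda>x. indicator K x *\<^sub>R f x) \<in> borel_measurable M"
    using measurable_cong_sets[OF assms(1) refl] by blast
  then show ?thesis unfolding set_integrable_def
    using KM K C by (intro integrableI_bounded_set[where A=K and B=C]) (auto simp: indicator_def)
qed

lemma continuous_on_section:
  assumes "continuous_on (A \<times> K) (\<lambda>(a, x). f a x)" "a \<in> A"
  shows "continuous_on K (f a)"
proof -
  have "continuous_on K ((\<lambda>(a, x). f a x) \<circ> (\<lambda>x. (a, x)))"
    using assms by (intro continuous_on_compose continuous_intros)
      (auto intro!: continuous_on_subset[OF assms(1)])
  then show ?thesis by (simp add: o_def)
qed

text \<open>
  A derivative is known to be continuous in the base point for each fixed direction. Since directions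
  form a finite-dimensional space, it may also be evaluated in a direction that varies continuously.
\<close>

lemma continuous_on_linear_family:
  fixes L :: "'z::topological_space \<Rightarrow> 'e::euclidean_space \<Rightarrow> real"
  assumes lin: "\<And>p. p \<in> K \<Longrightarrow> linear (L p)" and c: "\<And>v. continuous_on K (\<lambda>p. L p v)"
    and h: "continuous_on K h"
  shows "continuous_on K (\<lambda>p. L p (h p))"
proof -
  have "continuous_on K (\<lambda>p. \<Sum>b\<in>Basis. (h p \<bullet> b) * L p b)"
    by (intro continuous_intros c h)
  then show ?thesis
  proof (rule continuous_on_eq)
    fix p assume "p \<in> K"
    have "L p (h p) = L p (\<Sum>b\<in>Basis. (h p \<bullet> b) *\<^sub>R b)" by (simp add: euclidean_representation)
    also have "\<dots> = (\<Sum>b\<in>Basis. (h p \<bullet> b) * L p b)"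
      by (simp only: linear_sum[OF lin[OF \<open>p \<in> K\<close>]] linear_scale[OF lin[OF \<open>p \<in> K\<close>]] real_scaleR_def)
    finally show "(\<Sum>b\<in>Basis. (h p \<bullet> b) * L p b) = L p (h p)" ..
  qed
qed

lemma continuous_on_set_integral:
  fixes f :: "'b::metric_space \<Rightarrow> 'a::euclidean_space \<Rightarrow> real"
  assumes M: "sets M = sets borel" and K: "compact K" "emeasure M K < \<infinity>" and A: "compact A"
    and f: "continuous_on (A \<times> K) (\<lambda>(a, x). f a x)"
  shows "continuous_on A (\<lambda>a. LINT x:K|M. f a x)"
proof -
  have KM: "K \<in> sets M" using K(1) by (simp add: M borel_compact)
  obtain C where C: "\<And>a x. a \<in> A \<Longrightarrow> x \<in> K \<Longrightarrow> norm (f a x) \<le> C"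
    using compact_imp_bounded[OF compact_continuous_image[OF f compact_Times[OF A K(1)]]]
    by (auto simp: bounded_iff)
  have int: "set_integrable M K (f a)" if "a \<in> A" for a
    by (rule set_integrable_continuous_compact[OF M K continuous_on_section[OF f that]])
  show ?thesis
    unfolding continuous_on_sequentially
  proof (intro allI ballI impI)
    fix u :: "nat \<Rightarrow> 'b" and a assume a: "a \<in> A" and "(\<forall>n. u n \<in> A) \<and> u \<longlonglongrightarrow> a"
    then have u: "\<And>n. u n \<in> A" "u \<longlonglongrightarrow> a" by auto
    have "(\<lambda>n. LINT x:K|M. f (u n) x) \<longlonglongrightarrow> (LINT x:K|M. f a x)"
      unfolding set_lebesgue_integral_def
    proof (rule integral_dominated_convergence[where w="\<lambda>x. C * indicator K x"])
      show "(\<lambda>x. indicator K x *\<^sub>R f a x) \<in> borel_measurable M"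
        using int[OF a] unfolding set_integrable_def by auto
      show "(\<lambda>x. indicator K x *\<^sub>R f (u n) x) \<in> borel_measurable M" for n
        using int[OF u(1)] unfolding set_integrable_def by auto
      show "integrable M (\<lambda>x. C * indicator K x)"
        using KM K(2) by (intro integrable_mult_right integrable_real_indicator) auto
      show "AE x in M. (\<lambda>n. indicator K x *\<^sub>R f (u n) x) \<longlonglongrightarrow> indicator K x *\<^sub>R f a x"
      proof (rule AE_I2)
        fix x
        show "(\<lambda>n. indicator K x *\<^sub>R f (u n) x) \<longlonglongrightarrow> indicator K x *\<^sub>R f a x"
        proof (cases "x \<in> K")
          case True
          have "(\<lambda>n. (u n, x)) \<longlonglongrightarrow> (a, x)" using u(2) by (intro tendsto_intros)
          then have "(\<lambda>n. (\<lambda>(a, x). f a x) (u n, x)) \<longlonglongrightarrow> (\<lambda>(a, x). f a x) (a, x)"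
            using f a u(1) True unfolding continuous_on_sequentially
            by (auto simp: o_def dest!: bspec[where x="(a,x)"] spec[where x="\<lambda>n. (u n, x)"])
          then show ?thesis by (intro tendsto_intros) simp
        qed simp
      qed
      show "AE x in M. norm (indicator K x *\<^sub>R f (u n) x) \<le> C * indicator K x" for n
        using C[OF u(1)] by (auto simp: indicator_def intro!: AE_I2)
    qed
    then show "((\<lambda>a. LINT x:K|M. f a x) \<circ> u) \<longlonglongrightarrow> (LINT x:K|M. f a x)"
      by (simp add: o_def)
  qed
qed

lemma set_integral_swap_continuous:
  fixes f :: "'b::euclidean_space \<Rightarrow> 'a::euclidean_space \<Rightarrow> real"
  assumes M: "sets M = sets borel" "sigma_finite_measure M"
    and N: "sets N = sets borel" "sigma_finite_measure N"
    and C: "compact C" and CAB: "C \<subseteq> A \<times> B"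
    and A: "compact A" "emeasure M A < \<infinity>" and B: "compact B" "emeasure N B < \<infinity>"
    and f: "continuous_on C (\<lambda>(a, b). f a b)"
  shows "(\<integral>a. (\<integral>b. indicator C (a, b) * f a b \<partial>N) \<partial>M) = (\<integral>b. (\<integral>a. indicator C (a, b) * f a b \<partial>M) \<partial>N)"
proof -
  interpret pair_sigma_finite M N using M(2) N(2) by (simp add: pair_sigma_finite_def)
  have MN: "sets (M \<Otimes>\<^sub>M N) = sets borel"
    using M(1) N(1) by (metis borel_prod sets_pair_measure_cong)
  have "emeasure (M \<Otimes>\<^sub>M N) C \<le> emeasure (M \<Otimes>\<^sub>M N) (A \<times> B)"
    using A(1) B(1) CAB M(1) N(1) by (intro emeasure_mono) (auto simp: borel_compact)
  also have "\<dots> = emeasure M A * emeasure N B"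
    using A(1) B(1) M(1) N(1) by (intro M2.emeasure_pair_measure_Times) (auto simp: borel_compact)
  also have "\<dots> < \<infinity>" using A(2) B(2) by (simp add: ennreal_mult_less_top)
  finally have fin: "emeasure (M \<Otimes>\<^sub>M N) C < \<infinity>" .
  have "set_integrable (M \<Otimes>\<^sub>M N) C (\<lambda>(a, b). f a b)"
    by (rule set_integrable_continuous_compact[OF MN C fin f])
  then have "integrable (M \<Otimes>\<^sub>M N) (\<lambda>(a, b). indicator C (a, b) * f a b)"
    unfolding set_integrable_def by (simp add: case_prod_beta')
  from Fubini_integral[OF this] show ?thesis by simp
qed

lemma set_integral_swap_Times:
  fixes f :: "'b::euclidean_space \<Rightarrow> 'a::euclidean_space \<Rightarrow> real"
  assumes M: "sets M = sets borel" "sigma_finite_measure M"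
    and N: "sets N = sets borel" "sigma_finite_measure N"
    and A: "compact A" "emeasure M A < \<infinity>" and B: "compact B" "emeasure N B < \<infinity>"
    and f: "continuous_on (A \<times> B) (\<lambda>(a, b). f a b)"
  shows "(LINT a:A|M. LINT b:B|N. f a b) = (LINT b:B|N. LINT a:A|M. f a b)"
proof -
  have *: "(\<integral>b. indicator (A \<times> B) (a, b) * f a b \<partial>N) = indicator A a * (LINT b:B|N. f a b)" for a
    by (simp add: set_lebesgue_integral_def indicator_times mult.assoc)
  have **: "(\<integral>a. indicator (A \<times> B) (a, b) * f a b \<partial>M) = indicator B b * (LINT a:A|M. f a b)" for b
    by (simp add: set_lebesgue_integral_def indicator_times mult_ac flip: integral_mult_right_zero)
  show ?thesis
    using set_integral_swap_continuous[OF M N compact_Times[OF A(1) B(1)] subset_refl A B f]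
    unfolding * ** by (simp add: set_lebesgue_integral_def)
qed

text \<open>
  Differentiation under the integral sign. The difference quotients are bounded by the supremum of
  \<open>g'\<close>, by the mean value theorem, so dominated convergence applies.
\<close>

lemma has_derivative_set_integral:
  fixes g g' :: "real \<Rightarrow> 'a::euclidean_space \<Rightarrow> real"
  assumes M: "sets M = sets borel" and K: "compact K" "emeasure M K < \<infinity>"
    and cont: "\<And>s. s \<in> {a..b} \<Longrightarrow> continuous_on K (g s)"
    and der: "\<And>s x. s \<in> {a..b} \<Longrightarrow> x \<in> K \<Longrightarrow>
                ((\<lambda>s. g s x) has_real_derivative g' s x) (at s within {a..b})"
    and g': "continuous_on ({a..b} \<times> K) (\<lambda>(s, x). g' s x)"
    and s: "s \<in> {a..b}"
  shows "((\<lambda>s. LINT x:K|M. g s x) has_real_derivative (LINT x:K|M. g' s x)) (at s within {a..b})"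
proof -
  have KM: "K \<in> sets M" using K(1) by (simp add: M borel_compact)
  obtain C where C: "\<And>a' x. a' \<in> {a..b} \<Longrightarrow> x \<in> K \<Longrightarrow> norm (g' a' x) \<le> C"
    using compact_imp_bounded[OF compact_continuous_image[OF g' compact_Times[OF compact_Icc K(1)]]]
    by (force simp: bounded_iff)
  have int: "set_integrable M K (g a')" if "a' \<in> {a..b}" for a'
    by (rule set_integrable_continuous_compact[OF M K cont[OF that]])
  have int': "set_integrable M K (g' a')" if "a' \<in> {a..b}" for a'
    by (rule set_integrable_continuous_compact[OF M K continuous_on_section[OF g' that]])
  have quot: "((\<lambda>t. (g t x - g s x) / (t - s)) \<longlongrightarrow> g' s x) (at s within {a..b})" if "x \<in> K" for x
    using der[OF s that] by (simp add: has_field_derivative_iff)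
  have bound: "\<bar>(g t x - g s x) / (t - s)\<bar> \<le> C" if "x \<in> K" "t \<in> {a..b}" "t \<noteq> s" for t x
  proof -
    have "norm (g t x - g s x) \<le> C * norm (t - s)"
      by (rule field_differentiable_bound[where S="{a..b}" and f'="\<lambda>s. g' s x"])
         (use that s der C in \<open>auto\<close>)
    then show ?thesis using that(3) by (simp add: divide_le_eq)
  qed
  have "((\<lambda>t. ((LINT x:K|M. g t x) - (LINT x:K|M. g s x)) / (t - s)) \<longlongrightarrow> (LINT x:K|M. g' s x))
          (at s within {a..b})"
    unfolding tendsto_at_iff_sequentially o_def
  proof (intro allI impI)
    fix u :: "nat \<Rightarrow> real" assume "\<forall>i. u i \<in> {a..b} - {s}" and lim: "u \<longlonglongrightarrow> s"
    then have u: "\<And>i. u i \<in> {a..b}" "\<And>i. u i \<noteq> s" by auto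
    have "(\<lambda>n. \<integral>x. indicator K x *\<^sub>R ((g (u n) x - g s x) / (u n - s)) \<partial>M)
             \<longlonglongrightarrow> (\<integral>x. indicator K x *\<^sub>R g' s x \<partial>M)"
    proof (rule integral_dominated_convergence[where w="\<lambda>x. C * indicator K x"])
      show "(\<lambda>x. indicator K x *\<^sub>R g' s x) \<in> borel_measurable M"
        using int'[OF s] unfolding set_integrable_def by auto
      show "(\<lambda>x. indicator K x *\<^sub>R ((g (u n) x - g s x) / (u n - s))) \<in> borel_measurable M" for n
        using borel_measurable_divide[OF borel_measurable_integrable[OF set_integral_diff(1)
            [OF int[OF u(1)[of n]] int[OF s], unfolded set_integrable_def]]
            borel_measurable_const[of "u n - s"]]
        by simp
      show "integrable M (\<lambda>x. C * indicator K x)"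
        using KM K(2) by (intro integrable_mult_right integrable_real_indicator) auto
      show "AE x in M. (\<lambda>n. indicator K x *\<^sub>R ((g (u n) x - g s x) / (u n - s)))
               \<longlonglongrightarrow> indicator K x *\<^sub>R g' s x"
      proof (rule AE_I2)
        fix x
        show "(\<lambda>n. indicator K x *\<^sub>R ((g (u n) x - g s x) / (u n - s)))
               \<longlonglongrightarrow> indicator K x *\<^sub>R g' s x"
          using quot[of x] lim u unfolding tendsto_at_iff_sequentially o_def
          by (cases "x \<in> K") (auto intro!: tendsto_intros)
      qed
      show "AE x in M. norm (indicator K x *\<^sub>R ((g (u n) x - g s x) / (u n - s))) \<le> C * indicator K x" for n
        using bound[OF _ u(1) u(2)] by (auto simp: indicator_def intro!: AE_I2)
    qed
    moreover have "(\<integral>x. indicator K x *\<^sub>R ((g (u n) x - g s x) / (u n - s)) \<partial>M) =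
        ((LINT x:K|M. g (u n) x) - (LINT x:K|M. g s x)) / (u n - s)" for n
      using set_integral_diff(2)[OF int[OF u(1)[of n]] int[OF s]]
      by (simp add: set_lebesgue_integral_def)
    ultimately show "(\<lambda>n. ((LINT x:K|M. g (u n) x) - (LINT x:K|M. g s x)) / (u n - s))
        \<longlonglongrightarrow> (LINT x:K|M. g' s x)"
      by (simp only: set_lebesgue_integral_def)
  qed
  then show ?thesis by (simp add: has_field_derivative_iff)
qed

lemma DERIV_set_integral:
  fixes g g' :: "real \<Rightarrow> 'a::euclidean_space \<Rightarrow> real"
  assumes M: "sets M = sets borel" and K: "compact K" "emeasure M K < \<infinity>"
    and der: "\<And>s x. s \<in> {a<..<b} \<Longrightarrow> x \<in> K \<Longrightarrow> ((\<lambda>s. g s x) has_real_derivative g' s x) (at s)"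
    and g: "\<And>s. s \<in> {a<..<b} \<Longrightarrow> continuous_on K (g s)"
    and g': "continuous_on ({a<..<b} \<times> K) (\<lambda>(s, x). g' s x)"
    and s: "s \<in> {a<..<b}"
  shows "((\<lambda>s. LINT x:K|M. g s x) has_real_derivative (LINT x:K|M. g' s x)) (at s)"
proof -
  obtain c d where cd: "a < c" "c < s" "s < d" "d < b"
    using s dense[of a s] dense[of s b] by auto
  have "((\<lambda>s. LINT x:K|M. g s x) has_real_derivative (LINT x:K|M. g' s x)) (at s within {c..d})"
  proof (rule has_derivative_set_integral[OF M K])
    show "continuous_on ({c..d} \<times> K) (\<lambda>(s, x). g' s x)"
      by (rule continuous_on_subset[OF g']) (use cd in auto)
  qed (use cd der g in \<open>auto intro: has_field_derivative_at_within\<close>)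
  then show ?thesis using cd by (simp add: at_within_Icc_at)
qed

text \<open>
  The derivative is only required in the open interval: later \<open>F\<close> is an integral over a sphere of
  the light cone, whose derivative involves equations that hold at interior times.
\<close>

lemma set_integral_FTC_interior:
  fixes F g :: "real \<Rightarrow> real"
  assumes ab: "a \<le> b" and F: "continuous_on {a..b} F" and g: "continuous_on {a..b} g"
    and D: "\<And>r. r \<in> {a<..<b} \<Longrightarrow> (F has_real_derivative g r) (at r)"
  shows "(LINT r:{a..b}|lborel. g r) = F b - F a"
proof -
  have "(g has_integral (F b - F a)) {a..b}"
    by (rule fundamental_theorem_of_calculus_interior[OF ab F])
       (use D in \<open>auto simp: has_real_derivative_iff_has_vector_derivative\<close>)
  moreover have "set_integrable lborel {a..b} g"
    by (rule borel_integrable_atLeastAtMost'[OF g])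
  ultimately show ?thesis
    using set_borel_integral_eq_integral(2) by (metis integral_unique)
qed

section \<open>The surface measure of the sphere\<close>

lemma sets_sphere_measure [measurable_cong, simp]: "sets sphere_measure = sets borel"
  by (simp add: sphere_measure_def)

lemma space_sphere_measure [simp]: "space sphere_measure = UNIV"
  using sets_eq_imp_space_eq[OF sets_sphere_measure] by simp

lemma emeasure_sphere_measure:
  assumes A: "A \<in> sets borel"
  shows "emeasure (sphere_measure :: 'a::euclidean_space measure) A =
           of_nat DIM('a) * emeasure lborel (sgn -` A \<inter> (cball 0 1 - {0}))"
proof -
  let ?C = "cball 0 1 - {0} :: 'a set"
  have sgn: "sgn \<in> borel_measurable (borel :: 'a measure)"
    unfolding sgn_div_norm[abs_def] by measurable
  have m: "sgn \<in> measurable (restrict_space lborel ?C) (borel :: 'a measure)"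
    by (rule measurable_restrict_space1) (use sgn in simp)
  have s: "sgn -` A \<in> sets (borel :: 'a measure)"
    using measurable_sets[OF sgn A] by simp
  have "emeasure (distr (restrict_space lborel ?C) borel sgn) A = emeasure lborel (sgn -` A \<inter> ?C)"
    using m A s by (subst emeasure_distr) (auto simp: space_restrict_space emeasure_restrict_space)
  then show ?thesis by (simp add: sphere_measure_def)
qed

lemma AE_sphere_measure: "AE \<omega> in (sphere_measure :: 'a::euclidean_space measure). \<omega> \<in> sphere 0 1"
proof (rule AE_I)
  show "emeasure (sphere_measure :: 'a measure) (- sphere 0 1) = 0"
  proof -
    have "sgn -` (- sphere 0 1) \<inter> (cball 0 1 - {0}) = ({} :: 'a set)"
      by (auto simp: norm_sgn split: if_splits)
    then show ?thesis by (subst emeasure_sphere_measure) (auto simp: borel_closed)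
  qed
qed (auto simp: borel_closed)

lemma finite_measure_sphere_measure: "finite_measure (sphere_measure :: (real^3) measure)"
  by (rule finite_measureI) (simp add: emeasure_sphere_measure_UNIV)

interpretation sphere_measure: finite_measure "sphere_measure :: (real^3) measure"
  by (rule finite_measure_sphere_measure)

lemma sphere_finite: "emeasure (sphere_measure :: (real^3) measure) A < \<infinity>"
  by (simp add: sphere_measure.emeasure_finite less_top[symmetric])

text \<open>
  The passage from integrals over the whole space to integrals over the sphere requires a Borel
  measurable integrand; otherwise the left-hand side is 0 by convention.
\<close>

lemma integral_sphere_measure:
  fixes g :: "'a::euclidean_space \<Rightarrow> real"
  assumes "g \<in> borel_measurable borel"
  shows "(\<integral>\<omega>. g \<omega> \<partial>sphere_measure) = (LINT \<omega>:sphere 0 1|sphere_measure. g \<omega>)"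
proof -
  have [measurable]: "sphere 0 1 \<in> sets (borel :: 'a measure)"
    by (intro borel_closed closed_sphere)
  note assms[measurable]
  show ?thesis unfolding set_lebesgue_integral_def
    by (rule integral_cong_AE) (use AE_sphere_measure in \<open>auto elim!: eventually_mono\<close>)
qed

text \<open>
  Orthogonal maps preserve the volume of bounded measurable sets, in particular of boxes, and these
  determine Lebesgue measure.
\<close>

lemma lborel_distr_orthogonal:
  fixes R :: "real^3 \<Rightarrow> real^3"
  assumes R: "orthogonal_transformation R"
  shows "distr lborel borel R = lborel"
proof (rule lborel_eqI[symmetric])
  fix l u :: "real^3" assume lu: "\<And>b. b \<in> Basis \<Longrightarrow> l \<bullet> b \<le> u \<bullet> b"
  have lin: "linear R" using R by (simp add: orthogonal_transformation_linear)
  have Rm: "R \<in> borel_measurable borel"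
    by (intro borel_measurable_continuous_onI linear_continuous_on)
       (use lin in \<open>simp add: linear_conv_bounded_linear\<close>)
  let ?S = "R -` box l u"
  have S: "?S \<in> sets borel" using measurable_sets[OF Rm, of "box l u"] by simp
  have im: "R ` ?S = box l u" using orthogonal_transformation_surj[OF R] by auto
  have pre: "?S = inv R ` box l u"
    using orthogonal_transformation_bij[OF R] by (simp add: bij_vimage_eq_inv_image)
  have meas: "?S \<in> lmeasurable"
    unfolding pre by (intro measurable_orthogonal_image orthogonal_transformation_inv R) simp
  have "emeasure (distr lborel borel R) (box l u) = emeasure lborel ?S"
    using Rm by (subst emeasure_distr) auto
  also have "\<dots> = emeasure lebesgue ?S" using S by simp
  also have "\<dots> = ennreal (measure lebesgue ?S)"
    by (rule emeasure_eq_measure2[OF meas])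
  also have "measure lebesgue ?S = measure lebesgue (box l u)"
    using measure_orthogonal_image[OF R meas] im by simp
  also have "ennreal \<dots> = emeasure lebesgue (box l u)"
    by (rule emeasure_eq_measure2[symmetric]) simp
  also have "\<dots> = (\<Prod>b\<in>Basis. (u - l) \<bullet> b)"
    using lu by (simp add: emeasure_lborel_box)
  finally show "emeasure (distr lborel borel R) (box l u) = (\<Prod>b\<in>Basis. (u - l) \<bullet> b)" .
qed simp

text \<open>
  A linear isometry commutes with \<open>sgn\<close>, so it maps the cone over a set of directions to the cone over
  the image of this set, and the volume of the cone defines the surface measure.
\<close>

lemma sphere_measure_distr_orthogonal:
  fixes R :: "real^3 \<Rightarrow> real^3"
  assumes R: "orthogonal_transformation R"
  shows "distr sphere_measure borel R = sphere_measure"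
proof (rule measure_eqI)
  have lin: "linear R" using R by (simp add: orthogonal_transformation_linear)
  have Rm: "R \<in> borel_measurable borel"
    by (intro borel_measurable_continuous_onI linear_continuous_on)
       (use lin in \<open>simp add: linear_conv_bounded_linear\<close>)
  fix A assume "A \<in> sets (distr sphere_measure borel R)"
  then have A: "A \<in> sets borel" by simp
  have sgnR: "sgn (R x) = R (sgn x)" for x
    using R lin by (simp add: sgn_div_norm orthogonal_transformation_norm linear_scale)
  have sgn: "sgn \<in> borel_measurable (borel :: (real^3) measure)"
    unfolding sgn_div_norm[abs_def] by measurable
  let ?C = "sgn -` A \<inter> (cball 0 1 - {0}) :: (real^3) set"
  have C: "?C \<in> sets borel"
    using measurable_sets[OF sgn A] by (auto intro!: sets.Int sets.Diff simp: borel_closed)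
  have pre: "sgn -` (R -` A) \<inter> (cball 0 1 - {0}) = R -` ?C"
    using R lin by (auto simp: sgnR orthogonal_transformation_norm linear_0
       dest!: arg_cong[where f=norm and x="R _"])
  have RA: "R -` A \<in> sets borel" using measurable_sets[OF Rm A] by simp
  have "emeasure (distr sphere_measure borel R) A = emeasure sphere_measure (R -` A)"
    using Rm A by (subst emeasure_distr) (auto simp: measurable_def)
  also have "\<dots> = of_nat DIM(real^3) * emeasure lborel (R -` ?C)"
    by (simp only: emeasure_sphere_measure[OF RA] pre)
  also have "emeasure lborel (R -` ?C) = emeasure (distr lborel borel R) ?C"
    using Rm C by (subst emeasure_distr) auto
  also have "\<dots> = emeasure lborel ?C" by (simp only: lborel_distr_orthogonal[OF R])
  finally show "emeasure (distr sphere_measure borel R) A = emeasure sphere_measure A"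
    by (simp only: emeasure_sphere_measure[OF A])
qed simp

text \<open>
  Rodrigues' formula for the rotation about the axis \<open>k\<close> by the angle \<open>\<theta>\<close>: the flow of the vector field
  \<open>x \<mapsto> cross3 k x\<close>.
\<close>

definition rotation :: "real^3 \<Rightarrow> real \<Rightarrow> real^3 \<Rightarrow> real^3" where
  "rotation k \<theta> x = cos \<theta> *\<^sub>R x + sin \<theta> *\<^sub>R cross3 k x + ((1 - cos \<theta>) * (k \<bullet> x)) *\<^sub>R k"

lemma cross_cross_unit: 
  assumes "norm k = 1"
  shows "cross3 k (cross3 k x) = (k \<bullet> x) *\<^sub>R k - x"
proof -
  have "k \<bullet> k = 1" using assms by (simp add: norm_eq_1)
  have *: "cross3 k (cross3 k x) = (k \<bullet> x) *\<^sub>R k - (k \<bullet> k) *\<^sub>R x"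
    by (simp add: cross3_simps forall_3) 
  then show ?thesis using \<open>k \<bullet> k = 1\<close> by simp
qed

lemma orthogonal_transformation_rotation:
  assumes k: "norm k = 1"
  shows "orthogonal_transformation (rotation k \<theta>)"
  unfolding orthogonal_transformation
proof (intro conjI allI)
  show "linear (rotation k \<theta>)"
    by (rule linearI) (simp_all add: rotation_def cross_add_right cross_mult_right inner_add_right algebra_simps)
  fix x
  have kk: "k \<bullet> k = 1" using assms by (simp add: norm_eq_1)
  have c: "cross3 k x \<bullet> cross3 k x = x \<bullet> x - (k \<bullet> x)\<^sup>2"
    using norm_cross_dot[of k x] k by (simp add: dot_square_norm)
  have "rotation k \<theta> x \<bullet> rotation k \<theta> x =
      (cos \<theta>)\<^sup>2 * (x \<bullet> x) + (sin \<theta>)\<^sup>2 * (x \<bullet> x - (k \<bullet> x)\<^sup>2) + (1 - cos \<theta>)\<^sup>2 * (k \<bullet> x)\<^sup>2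
       + 2 * cos \<theta> * (1 - cos \<theta>) * (k \<bullet> x)\<^sup>2"
    unfolding rotation_def
    by (simp add: inner_add_left inner_add_right c kk dot_cross_self inner_commute power2_eq_square algebra_simps)
  also have "\<dots> = x \<bullet> x"
    unfolding sin_squared_eq by (simp add: power2_eq_square algebra_simps)
  finally show "norm (rotation k \<theta> x) = norm x" by (simp add: norm_eq_sqrt_inner)
qed

lemma rotation_has_vector_derivative:
  assumes "norm k = 1"
  shows "((\<lambda>\<theta>. rotation k \<theta> x) has_vector_derivative cross3 k (rotation k \<theta> x)) (at \<theta> within S)"
proof -
  have "((\<lambda>\<theta>. rotation k \<theta> x) has_vector_derivative
      - sin \<theta> *\<^sub>R x + cos \<theta> *\<^sub>R cross3 k x + (sin \<theta> * (k \<bullet> x)) *\<^sub>R k) (at \<theta> within S)"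
    unfolding rotation_def
    by (auto intro!: derivative_eq_intros simp: has_vector_derivative_def algebra_simps)
  also have "- sin \<theta> *\<^sub>R x + cos \<theta> *\<^sub>R cross3 k x + (sin \<theta> * (k \<bullet> x)) *\<^sub>R k = cross3 k (rotation k \<theta> x)"
    unfolding rotation_def cross_add_right cross_mult_right cross_cross_unit[OF assms] cross_refl
    by (simp add: algebra_simps)
  finally show ?thesis .
qed

lemma continuous_on_rotation: "continuous_on S (\<lambda>(\<theta>, x). rotation k \<theta> x)"
  unfolding rotation_def case_prod_beta by (intro continuous_intros continuous_on_cross)

lemma linear_eq_sum_axis:
  fixes L :: "real^3 \<Rightarrow> 'b::real_vector"
  assumes "linear L"
  shows "L v = (\<Sum>i\<in>UNIV. v $ i *\<^sub>R L (axis i 1))"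
proof -
  have "L v = L (\<Sum>i\<in>UNIV. v $ i *\<^sub>R axis i 1)" by (simp add: basis_expansion scalar_mult_eq_scaleR[symmetric])
  then show ?thesis by (simp add: linear_sum[OF assms] linear_scale[OF assms])
qed

lemma set_integral_sphere_rotate:
  fixes h :: "real^3 \<Rightarrow> real"
  assumes k: "norm k = 1" and h: "continuous_on (sphere 0 1) h"
  shows "(LINT \<omega>:sphere 0 1|sphere_measure. h (rotation k \<theta> \<omega>)) = (LINT \<omega>:sphere 0 1|sphere_measure. h \<omega>)"
proof -
  note orth = orthogonal_transformation_rotation[OF k, of \<theta>]
  have m: "(\<lambda>x. indicator (sphere 0 1) x *\<^sub>R h x) \<in> borel_measurable borel"
    by (rule borel_measurable_continuous_on_indicator[OF _ h]) (simp add: borel_closed)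
  have Rm: "rotation k \<theta> \<in> borel_measurable borel"
    using orthogonal_transformation_linear[OF orth]
    by (intro borel_measurable_continuous_onI linear_continuous_on)
       (simp add: linear_conv_bounded_linear)
  have "(\<integral>\<omega>. indicator (sphere 0 1) \<omega> *\<^sub>R h \<omega> \<partial>sphere_measure) =
      (\<integral>\<omega>. indicator (sphere 0 1) \<omega> *\<^sub>R h \<omega> \<partial>distr sphere_measure borel (rotation k \<theta>))"
    by (simp only: sphere_measure_distr_orthogonal[OF orth])
  also have "\<dots> = (\<integral>\<omega>. indicator (sphere 0 1) (rotation k \<theta> \<omega>) *\<^sub>R h (rotation k \<theta> \<omega>) \<partial>sphere_measure)"
    using Rm m by (intro integral_distr) (auto simp: measurable_def)
  also have "\<dots> = (\<integral>\<omega>. indicator (sphere 0 1) \<omega> *\<^sub>R h (rotation k \<theta> \<omega>) \<partial>sphere_measure)"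
    by (simp add: indicator_def orthogonal_transformation_norm[OF orth])
  finally show ?thesis by (simp add: set_lebesgue_integral_def)
qed

text \<open>
  The integral of \<open>h\<close> over the sphere does not change when \<open>h\<close> is rotated; its derivative in the angle
  of rotation, at angle 0, is the integral of the derivative of \<open>h\<close> along \<open>cross3 k \<omega>\<close>.
\<close>

lemma sphere_integral_angular_derivative:
  fixes h :: "real^3 \<Rightarrow> real"
  assumes k: "norm k = 1"
    and h: "\<And>\<omega>. \<omega> \<in> sphere 0 1 \<Longrightarrow> (h has_derivative h' \<omega>) (at \<omega>)"
    and h': "\<And>v. continuous_on (sphere 0 1) (\<lambda>\<omega>. h' \<omega> v)"
  shows "(LINT \<omega>:sphere 0 1|sphere_measure. h' \<omega> (cross3 k \<omega>)) = 0"
proof -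
  let ?S = "sphere 0 1 :: (real^3) set"
  note orth = orthogonal_transformation_rotation[OF k]
  have RS: "rotation k \<theta> \<omega> \<in> ?S" if "\<omega> \<in> ?S" for \<theta> \<omega>
    using that by (simp add: orthogonal_transformation_norm[OF orth])
  have hc: "continuous_on ?S h"
    using h by (meson continuous_at_imp_continuous_on has_derivative_continuous)
  have lin: "linear (h' \<omega>)" if "\<omega> \<in> ?S" for \<omega>
    using h[OF that] by (rule has_derivative_linear)
  have c': "continuous_on ?S (\<lambda>\<omega>. h' \<omega> (cross3 k \<omega>))"
    by (rule continuous_on_linear_family[OF lin h']) (auto intro!: continuous_on_cross continuous_intros)
  have rotc: "continuous_on ({-1..1} \<times> ?S) (\<lambda>(\<theta>, \<omega>). rotation k \<theta> \<omega>)"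
    by (rule continuous_on_rotation)
  have "((\<lambda>\<theta>. LINT \<omega>:?S|sphere_measure. h (rotation k \<theta> \<omega>)) has_real_derivative
     (LINT \<omega>:?S|sphere_measure. h' (rotation k 0 \<omega>) (cross3 k (rotation k 0 \<omega>)))) (at 0 within {-1..1})"
  proof (rule has_derivative_set_integral)
    fix \<theta> :: real
    show "continuous_on ?S (\<lambda>\<omega>. h (rotation k \<theta> \<omega>))"
      by (rule continuous_on_compose2[OF hc linear_continuous_on])
        (use RS orth in \<open>auto simp: orthogonal_transformation_linear linear_conv_bounded_linear[symmetric]\<close>)
    fix \<omega> assume "\<omega> \<in> ?S"
    have "((\<lambda>\<theta>. h (rotation k \<theta> \<omega>)) has_derivative
        (\<lambda>s. h' (rotation k \<theta> \<omega>) (s *\<^sub>R cross3 k (rotation k \<theta> \<omega>)))) (at \<theta> within {-1..1})"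
      using rotation_has_vector_derivative[OF k, of \<omega> \<theta> "{-1..1}"] h[OF RS[OF \<open>\<omega> \<in> ?S\<close>]]
      unfolding has_vector_derivative_def by (rule has_derivative_compose)
    then show "((\<lambda>\<theta>. h (rotation k \<theta> \<omega>)) has_real_derivative
        h' (rotation k \<theta> \<omega>) (cross3 k (rotation k \<theta> \<omega>))) (at \<theta> within {-1..1})"
      by (simp add: has_field_derivative_def linear_scale[OF lin[OF RS[OF \<open>\<omega> \<in> ?S\<close>]]] mult_commute_abs)
  next
    show "continuous_on ({-1..1} \<times> ?S) (\<lambda>(\<theta>, \<omega>). h' (rotation k \<theta> \<omega>) (cross3 k (rotation k \<theta> \<omega>)))"
      using continuous_on_compose2[OF c' rotc] RS by (force simp: case_prod_beta)
  qed (auto simp: sphere_finite[simplified])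
  moreover have "((\<lambda>\<theta>. LINT \<omega>:?S|sphere_measure. h (rotation k \<theta> \<omega>)) has_real_derivative 0) (at 0 within {-1..1})"
    by (simp add: set_integral_sphere_rotate[OF k hc])
  ultimately have "(LINT \<omega>:?S|sphere_measure. h' (rotation k 0 \<omega>) (cross3 k (rotation k 0 \<omega>))) = 0"
    using at_within_Icc_at[of "-1" 0 "1::real"] by (auto intro: DERIV_unique)
  then show ?thesis by (simp add: rotation_def)
qed

text \<open>
  On the unit sphere the integrand is the surface divergence of the tangential part of \<open>V\<close>: the
  divergence, minus its radial part, minus the curvature term for the normal component. It is also the
  sum over the three axes of the angular derivatives of the components of \<open>cross3 \<omega> (V \<omega>)\<close>, each of which
  has integral 0.
\<close>

lemma sphere_divergence:
  fixes V :: "real^3 \<Rightarrow> real^3"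
  assumes V: "\<And>\<omega>. \<omega> \<in> sphere 0 1 \<Longrightarrow> (V has_derivative V' \<omega>) (at \<omega>)"
    and V': "\<And>v. continuous_on (sphere 0 1) (\<lambda>\<omega>. V' \<omega> v)"
  shows "(LINT \<omega>:sphere 0 1|sphere_measure.
            (\<Sum>i\<in>UNIV. V' \<omega> (axis i 1) $ i) - \<omega> \<bullet> V' \<omega> \<omega> - 2 * (\<omega> \<bullet> V \<omega>)) = 0"
proof -
  let ?S = "sphere 0 1 :: (real^3) set"
  have Vc: "continuous_on ?S V"
    using V by (meson continuous_at_imp_continuous_on has_derivative_continuous)
  have lin: "linear (V' \<omega>)" if "\<omega> \<in> ?S" for \<omega>
    using V[OF that] by (rule has_derivative_linear)
  define h' where "h' i \<omega> v = (cross3 v (V \<omega>) + cross3 \<omega> (V' \<omega> v)) $ i" for i :: 3 and \<omega> v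
  have D: "((\<lambda>\<omega>. cross3 \<omega> (V \<omega>) $ i) has_derivative h' i \<omega>) (at \<omega>)" if "\<omega> \<in> ?S" for i \<omega>
  proof -
    have "((\<lambda>\<omega>. cross3 \<omega> (V \<omega>)) has_derivative (\<lambda>v. cross3 \<omega> (V' \<omega> v) + cross3 v (V \<omega>))) (at \<omega>)"
      using bounded_bilinear.FDERIV[OF _ has_derivative_ident V[OF that]] bilinear_cross
      by (simp add: bilinear_conv_bounded_bilinear)
    from bounded_linear.has_derivative[OF bounded_linear_vec_nth this]
    show ?thesis by (simp add: h'_def[abs_def] add.commute)
  qed
  have c: "continuous_on ?S (\<lambda>\<omega>. h' i \<omega> v)" for i v
    unfolding h'_def by (intro continuous_intros continuous_on_cross Vc V')
  have c2: "continuous_on ?S (\<lambda>\<omega>. h' i \<omega> (cross3 k \<omega>))" for i k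
    by (rule continuous_on_linear_family[OF has_derivative_linear[OF D] c])
       (auto intro!: continuous_on_cross continuous_intros)
  have int: "set_integrable sphere_measure ?S (\<lambda>\<omega>. h' i \<omega> (cross3 k \<omega>))" for i k
    by (rule set_integrable_continuous_compact) (auto simp: sphere_finite[simplified] c2)
  have pt: "(\<Sum>i\<in>UNIV. V' \<omega> (axis i 1) $ i) - \<omega> \<bullet> V' \<omega> \<omega> - 2 * (\<omega> \<bullet> V \<omega>) =
      (\<Sum>i\<in>UNIV. h' i \<omega> (cross3 (axis i 1) \<omega>))" if "\<omega> \<in> ?S" for \<omega>
  proof -
    have "\<omega> \<bullet> \<omega> = 1" using that by (simp add: norm_eq_1)
    then have 1: "\<omega>$1 * \<omega>$1 + \<omega>$2 * \<omega>$2 + \<omega>$3 * \<omega>$3 = 1" by (simp add: inner_vec_def sum_3)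
    have e: "V' \<omega> v $ i = v$1 * V' \<omega> (axis 1 1) $ i + v$2 * V' \<omega> (axis 2 1) $ i + v$3 * V' \<omega> (axis 3 1) $ i" for v i
      by (subst linear_eq_sum_axis[OF lin[OF that]]) (simp add: sum_3)
    define a where "a j i = V' \<omega> (axis j 1) $ i" for i j
    have e': "V' \<omega> v $ i = v$1 * a 1 i + v$2 * a 2 i + v$3 * a 3 i" for v i
      unfolding a_def by (rule e)
    have 2: "\<omega>$1 * \<omega>$1 = 1 - \<omega>$2 * \<omega>$2 - \<omega>$3 * \<omega>$3" using 1 by simp
    have "(a 1 1 + a 2 2 + a 3 3) * (\<omega>$1 * \<omega>$1 + \<omega>$2 * \<omega>$2 + \<omega>$3 * \<omega>$3) - \<omega> \<bullet> V' \<omega> \<omega> - 2 * (\<omega> \<bullet> V \<omega>) =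
       (\<Sum>i\<in>UNIV. h' i \<omega> (cross3 (axis i 1) \<omega>))"
      unfolding h'_def inner_vec_def sum_3 cross_components vector_add_component e'
      by (simp add: axis_def algebra_simps)
    then show ?thesis by (simp add: 1 sum_3 a_def)
  qed
  have "(LINT \<omega>:?S|sphere_measure. (\<Sum>i\<in>UNIV. h' i \<omega> (cross3 (axis i 1) \<omega>))) = 
     (\<Sum>i\<in>UNIV. LINT \<omega>:?S|sphere_measure. h' i \<omega> (cross3 (axis i 1) \<omega>))"
    using int unfolding set_integrable_def set_lebesgue_integral_def sum_3 scaleR_add_right by simp
  also have "\<dots> = 0"
    by (intro sum.neutral ballI sphere_integral_angular_derivative[OF _ D c]) auto
  finally show ?thesis
    by (subst set_lebesgue_integral_cong[where g="\<lambda>\<omega>. \<Sum>i\<in>UNIV. h' i \<omega> (cross3 (axis i 1) \<omega>)"])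
       (auto simp: pt borel_closed)
qed

section \<open>Derivatives with compact support and mixed derivatives\<close>

text \<open>
  The integral of \<open>\<phi>\<close> is invariant under translations along \<open>e\<close>; the claim is the derivative of this
  invariance. The ball of integration is enlarged so that it contains the support of all translates by
  vectors \<open>\<theta> e\<close> with \<open>\<theta>\<close> between -1 and 1.
\<close>

lemma integral_derivative_compact_support:
  fixes \<phi> :: "'a::euclidean_space \<Rightarrow> real"
  assumes D: "\<And>x. (\<phi> has_derivative \<phi>' x) (at x)" and c: "\<And>v. continuous_on UNIV (\<lambda>x. \<phi>' x v)"
    and supp: "\<And>x. norm x > P \<Longrightarrow> \<phi> x = 0"
  shows "(LINT x:cball 0 P|lborel. \<phi>' x e) = 0"
proof -
  let ?K = "cball 0 (P + norm e) :: 'a set"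
  have K: "compact ?K" "emeasure lborel ?K < \<infinity>"
    using emeasure_bounded_finite[OF bounded_cball] by auto
  have \<phi>c: "continuous_on UNIV \<phi>"
    using D by (meson continuous_at_imp_continuous_on has_derivative_continuous)
  have out: "\<phi>' x v = 0" if "norm x > P" for x v
  proof -
    have "open {x :: 'a. norm x > P}" by (intro open_Collect_less continuous_intros)
    then have "(\<phi> has_derivative (\<lambda>_. 0)) (at x)"
      by (rule has_derivative_transform_within_open[OF has_derivative_const, where s="{x. norm x > P}"])
         (use that supp in auto)
    then show ?thesis using has_derivative_unique[OF D] by metis
  qed
  have "((\<lambda>\<theta>. LINT x:?K|lborel. \<phi> (x + \<theta> *\<^sub>R e)) has_real_derivative
           (LINT x:?K|lborel. \<phi>' (x + 0 *\<^sub>R e) e)) (at 0)"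
  proof (rule DERIV_set_integral[OF _ K, where a="-1" and b=1])
    fix \<theta> :: real and x
    show "continuous_on ?K (\<lambda>x. \<phi> (x + \<theta> *\<^sub>R e))"
      by (rule continuous_on_compose2[OF \<phi>c]) (auto intro!: continuous_intros)
    have "((\<lambda>\<theta>. \<phi> (x + \<theta> *\<^sub>R e)) has_derivative (\<lambda>t. \<phi>' (x + \<theta> *\<^sub>R e) (t *\<^sub>R e))) (at \<theta>)"
      by (rule has_derivative_compose[OF _ D]) (auto intro!: derivative_eq_intros)
    then show "((\<lambda>\<theta>. \<phi> (x + \<theta> *\<^sub>R e)) has_real_derivative \<phi>' (x + \<theta> *\<^sub>R e) e) (at \<theta>)"
      by (simp add: has_field_derivative_def linear_scale[OF has_derivative_linear[OF D]] mult_commute_abs)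
    show "continuous_on ({- 1<..<1} \<times> ?K) (\<lambda>(\<theta>, x). \<phi>' (x + \<theta> *\<^sub>R e) e)"
      unfolding case_prod_beta
      by (rule continuous_on_compose2[OF c]) (auto intro!: continuous_intros)
  qed auto
  moreover have "(LINT x:?K|lborel. \<phi> (x + \<theta> *\<^sub>R e)) = (\<integral>x. \<phi> x \<partial>lborel)" if "\<theta> \<in> {-1<..<1}" for \<theta>
  proof -
    have "\<phi> (x + \<theta> *\<^sub>R e) = 0" if "x \<notin> ?K" for x
    proof -
      have "\<bar>\<theta>\<bar> * norm e \<le> norm e" using \<open>\<theta> \<in> _\<close> by (intro mult_left_le_one_le) auto
      moreover have "norm x \<le> norm (x + \<theta> *\<^sub>R e) + \<bar>\<theta>\<bar> * norm e"
        using norm_triangle_ineq4[of "x + \<theta> *\<^sub>R e" "\<theta> *\<^sub>R e"] by simp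
      ultimately show ?thesis using that by (intro supp) auto
    qed
    then have "(LINT x:?K|lborel. \<phi> (x + \<theta> *\<^sub>R e)) = (\<integral>x. \<phi> (\<theta> *\<^sub>R e + x) \<partial>lborel)"
      unfolding set_lebesgue_integral_def
      by (intro Bochner_Integration.integral_cong) (auto simp: indicator_def add.commute)
    also have "\<dots> = (\<integral>x. \<phi> x \<partial>distr lborel borel ((+) (\<theta> *\<^sub>R e)))"
      by (subst integral_distr) (auto intro!: borel_measurable_continuous_onI[OF \<phi>c])
    finally show ?thesis by (simp only: lborel_distr_plus)
  qed
  then have "((\<lambda>\<theta>. LINT x:?K|lborel. \<phi> (x + \<theta> *\<^sub>R e)) has_real_derivative 0) (at 0)"
    by (intro has_field_derivative_transform_within_open[OF DERIV_const, where S="{-1<..<1}"]) auto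
  ultimately have "(LINT x:?K|lborel. \<phi>' (x + 0 *\<^sub>R e) e) = 0" by (rule DERIV_unique)
  moreover have "(LINT x:?K|lborel. \<phi>' (x + 0 *\<^sub>R e) e) = (LINT x:cball 0 P|lborel. \<phi>' x e)"
  proof -
    have "indicator ?K x *\<^sub>R \<phi>' (x + 0 *\<^sub>R e) e = indicator (cball 0 P) x *\<^sub>R \<phi>' x e" for x
      using out[of x e] norm_ge_zero[of e]
      by (cases "norm x \<le> P") (auto simp: indicator_def simp del: norm_ge_zero)
    then show ?thesis unfolding set_lebesgue_integral_def by presburger
  qed
  ultimately show ?thesis by simp
qed

text \<open>
  Symmetry of mixed derivatives. The increment of \<open>w\<close> along \<open>h\<close> is the integral of its derivative
  along \<open>h\<close>. Differentiating this along \<open>k\<close>, under the integral, and then along \<open>h\<close> by the fundamental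
  theorem of calculus exchanges the order of the two derivatives.
\<close>

lemma second_derivative_symmetric:
  fixes w :: "'a::real_normed_vector \<Rightarrow> real"
  assumes U: "open U" "z \<in> U"
    and w: "\<And>z. z \<in> U \<Longrightarrow> (w has_derivative dw z) (at z)"
    and h: "\<And>z. z \<in> U \<Longrightarrow> ((\<lambda>z. dw z h) has_derivative d2 z h) (at z)"
    and k: "\<And>z. z \<in> U \<Longrightarrow> ((\<lambda>z. dw z k) has_derivative d2 z k) (at z)"
    and c: "continuous_on U (\<lambda>z. d2 z h k)"
  shows "d2 z h k = d2 z k h"
proof -
  obtain e where e: "e > 0" "ball z e \<subseteq> U" using U openE by blast
  define \<delta> where "\<delta> = e / (2 * (norm h + norm k + 1))"
  have \<delta>: "\<delta> > 0" using e unfolding \<delta>_def by (intro divide_pos_pos) (auto intro: add_nonneg_pos)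
  define p where "p a b = z + a *\<^sub>R h + b *\<^sub>R k" for a b
  have pU: "p a b \<in> U" if "\<bar>a\<bar> \<le> \<delta>" "\<bar>b\<bar> \<le> \<delta>" for a b
  proof -
    have "norm (a *\<^sub>R h + b *\<^sub>R k) \<le> \<bar>a\<bar> * norm h + \<bar>b\<bar> * norm k"
      by (rule order_trans[OF norm_triangle_ineq]) simp
    also have "\<dots> \<le> \<delta> * norm h + \<delta> * norm k"
      using that by (intro add_mono mult_right_mono) auto
    also have "\<dots> < \<delta> * (norm h + norm k + 1)" using \<delta> by (simp add: algebra_simps)
    also have "\<dots> \<le> e"
    proof -
      have "norm h + norm k + 1 > 0" by (intro add_nonneg_pos) auto
      then have "\<delta> * (norm h + norm k + 1) = e / 2" by (simp add: \<delta>_def field_simps)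
      then show ?thesis using e by simp
    qed
    finally have "dist z (p a b) < e" by (simp add: p_def dist_norm norm_minus_commute algebra_simps)
    then show ?thesis using e by auto
  qed
  have pa: "((\<lambda>a. F (p a b)) has_real_derivative F' h) (at a within S)"
    if "(F has_derivative F') (at (p a b))" for F :: "'a \<Rightarrow> real" and F' a b S
  proof -
    have "((\<lambda>a. p a b) has_derivative (\<lambda>t. t *\<^sub>R h)) (at a within S)"
      unfolding p_def by (auto intro!: derivative_eq_intros)
    from has_derivative_compose[OF this that] show ?thesis
      by (simp add: has_field_derivative_def linear_scale[OF has_derivative_linear[OF that]] mult_commute_abs)
  qed
  have pb: "((\<lambda>b. F (p a b)) has_real_derivative F' k) (at b within S)"
    if "(F has_derivative F') (at (p a b))" for F :: "'a \<Rightarrow> real" and F' a b S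
  proof -
    have "((\<lambda>b. p a b) has_derivative (\<lambda>t. t *\<^sub>R k)) (at b within S)"
      unfolding p_def by (auto intro!: derivative_eq_intros)
    from has_derivative_compose[OF this that] show ?thesis
      by (simp add: has_field_derivative_def linear_scale[OF has_derivative_linear[OF that]] mult_commute_abs)
  qed
  have ch: "continuous_on U (\<lambda>z. dw z h)"
    using h U(1) by (meson continuous_at_imp_continuous_on has_derivative_continuous)
  have pc: "continuous_on S (\<lambda>x. p (f x) (g x))"
    if "continuous_on S f" "continuous_on S g" for f g :: "'c::topological_space \<Rightarrow> real" and S
    unfolding p_def by (intro continuous_intros that)
  \<comment> \<open>Differentiate \<open>w (z + \<alpha> h + b k) - w (z + b k) = \<integral>\<^sub>0\<^sup>\<alpha> dw (z + a h + b k) h da\<close> in \<open>b\<close>.\<close>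
  have G: "(LINT a:{0..\<alpha>}|lborel. d2 (p a 0) h k) = dw (p \<alpha> 0) k - dw (p 0 0) k"
    if \<alpha>: "0 \<le> \<alpha>" "\<alpha> \<le> \<delta>" for \<alpha>
  proof -
    have "((\<lambda>b. LINT a:{0..\<alpha>}|lborel. dw (p a b) h) has_real_derivative
       (LINT a:{0..\<alpha>}|lborel. d2 (p a 0) h k)) (at 0)"
    proof (rule DERIV_set_integral[where a="-\<delta>" and b=\<delta>])
      fix b assume b: "b \<in> {-\<delta><..<\<delta>}"
      show "continuous_on {0..\<alpha>} (\<lambda>a. dw (p a b) h)"
        by (rule continuous_on_compose2[OF ch])
           (use b \<alpha> in \<open>auto intro!: pc pU continuous_intros\<close>)
      fix a assume "a \<in> {0..\<alpha>}"
      then show "((\<lambda>b. dw (p a b) h) has_real_derivative d2 (p a b) h k) (at b)"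
        using b \<alpha> by (intro pb h pU) auto
    next
      show "continuous_on ({-\<delta><..<\<delta>} \<times> {0..\<alpha>}) (\<lambda>(b, a). d2 (p a b) h k)"
        unfolding case_prod_beta using \<alpha>
        by (intro continuous_on_compose2[OF c] pc continuous_intros) (auto intro!: pU)
    qed (use \<delta> emeasure_bounded_finite[OF bounded_closed_interval] in auto)
    moreover have "(LINT a:{0..\<alpha>}|lborel. dw (p a b) h) = w (p \<alpha> b) - w (p 0 b)" if "b \<in> {-\<delta><..<\<delta>}" for b
    proof (rule set_integral_FTC_interior)
      have *: "((\<lambda>a. w (p a b)) has_real_derivative dw (p a b) h) (at a)" if "a \<in> {0..\<alpha>}" for a
        using that \<open>b \<in> _\<close> \<alpha> by (intro pa w pU) auto
      then show "continuous_on {0..\<alpha>} (\<lambda>a. w (p a b))"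
        by (meson DERIV_isCont continuous_at_imp_continuous_on)
      show "continuous_on {0..\<alpha>} (\<lambda>a. dw (p a b) h)"
        by (rule continuous_on_compose2[OF ch])
           (use that \<alpha> in \<open>auto intro!: pc pU continuous_intros\<close>)
    qed (use that \<alpha> in \<open>auto intro!: pa w pU\<close>)
    moreover have "((\<lambda>b. w (p \<alpha> b) - w (p 0 b)) has_real_derivative dw (p \<alpha> 0) k - dw (p 0 0) k) (at 0)"
      by (intro derivative_intros pb w pU) (use \<alpha> \<delta> in auto)
    then have "((\<lambda>b. LINT a:{0..\<alpha>}|lborel. dw (p a b) h) has_real_derivative dw (p \<alpha> 0) k - dw (p 0 0) k) (at 0)"
      by (rule has_field_derivative_transform_within_open[where S="{-\<delta><..<\<delta>}"])
         (use calculation \<delta> in auto)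
    ultimately show ?thesis by (metis DERIV_unique)
  qed
  have gc: "continuous_on {0..\<delta>} (\<lambda>a. d2 (p a 0) h k)"
    by (rule continuous_on_compose2[OF c]) (use \<delta> in \<open>auto intro!: pc pU continuous_intros\<close>)
  have G': "integral {0..\<alpha>} (\<lambda>a. d2 (p a 0) h k) = dw (p \<alpha> 0) k - dw (p 0 0) k" if "\<alpha> \<in> {0..\<delta>}" for \<alpha>
  proof -
    have "set_integrable lborel {0..\<alpha>} (\<lambda>a. d2 (p a 0) h k)"
      by (rule borel_integrable_atLeastAtMost', rule continuous_on_subset[OF gc]) (use that in auto)
    then show ?thesis using G[of \<alpha>] that by (simp add: set_borel_integral_eq_integral(2))
  qed
  have "((\<lambda>\<alpha>. integral {0..\<alpha>} (\<lambda>a. d2 (p a 0) h k)) has_real_derivative d2 (p 0 0) h k) (at 0 within {0..\<delta>})"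
    by (rule integral_has_real_derivative[OF gc]) (use \<delta> in auto)
  then have "((\<lambda>\<alpha>. dw (p \<alpha> 0) k - dw (p 0 0) k) has_real_derivative d2 (p 0 0) h k) (at 0 within {0..\<delta>})"
    by (rule has_field_derivative_transform_within[where d=1]) (use \<delta> G' in auto)
  moreover have "((\<lambda>\<alpha>. dw (p \<alpha> 0) k - dw (p 0 0) k) has_real_derivative d2 (p 0 0) k h) (at 0 within {0..\<delta>})"
    using \<delta> by (auto intro!: derivative_eq_intros pa k pU)
  moreover have "at 0 within {0..\<delta>} \<noteq> bot"
    using \<delta> by (simp add: trivial_limit_within islimpt_Icc)
  ultimately have "d2 (p 0 0) h k = d2 (p 0 0) k h"
    unfolding has_real_derivative_iff_has_vector_derivative
    by (meson vector_derivative_unique_within)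
  then show ?thesis by (simp add: p_def)
qed

section \<open>Kirchhoff's formula\<close>

lemma linear_time_space:
  fixes L :: "real \<times> (real^3) \<Rightarrow> real"
  assumes "linear L"
  shows "L (a, v) = a * L (1, 0) + (\<Sum>i\<in>UNIV. v $ i * L (0, axis i 1))"
proof -
  have "L (a, v) = L (a *\<^sub>R (1, 0) + (0, v))" by simp
  also have "\<dots> = a * L (1, 0) + L (0, v)"
    unfolding linear_add[OF assms] linear_scale[OF assms] by simp
  also have "L (0, v) = (\<Sum>i\<in>UNIV. v $ i *\<^sub>R L (0, axis i 1))"
    by (rule linear_eq_sum_axis[where L="\<lambda>v. L (0, v)"], rule linearI)
       (use linear_add[OF assms, of "(0, _)" "(0, _)"] linear_scale[OF assms, of _ "(0, _)"] in simp_all)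
  finally show ?thesis by simp
qed

lemma has_derivative_vec_lambda:
  fixes f :: "'a::real_normed_vector \<Rightarrow> 'n::finite \<Rightarrow> real"
  assumes "\<And>i. ((\<lambda>x. f x i) has_derivative (\<lambda>v. f' v i)) (at x within S)"
  shows "((\<lambda>x. \<chi> i. f x i) has_derivative (\<lambda>v. \<chi> i. f' v i)) (at x within S)"
  unfolding has_derivative_componentwise_within[where f="\<lambda>x. \<chi> i. f x i"]
  using assms by (auto simp: Basis_vec_def inner_axis)

lemma continuous_on_cone:
  fixes F :: "real \<times> (real^3) \<Rightarrow> 'b::topological_space"
  assumes "continuous_on ({0..s} \<times> UNIV) F"
  shows "continuous_on ({0..s} \<times> K) (\<lambda>(r, \<omega>). F (r, x + (s - r) *\<^sub>R \<omega>))"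
  unfolding case_prod_beta
  by (rule continuous_on_compose2[OF assms]) (auto intro!: continuous_intros)

lemma DERIV_along_cone:
  fixes F :: "real \<times> (real^3) \<Rightarrow> real"
  assumes "(F has_derivative F') (at (r, x + (s - r) *\<^sub>R \<omega>))"
  shows "((\<lambda>r. F (r, x + (s - r) *\<^sub>R \<omega>)) has_real_derivative F' (1, - \<omega>)) (at r)"
proof -
  have "((\<lambda>r. (r, x + (s - r) *\<^sub>R \<omega>)) has_derivative (\<lambda>t. t *\<^sub>R (1, - \<omega>))) (at r)"
    by (auto intro!: derivative_eq_intros simp: algebra_simps)
  from has_derivative_compose[OF this assms] show ?thesis
    by (simp only: has_field_derivative_def linear_scale[OF has_derivative_linear[OF assms]]
        real_scaleR_def mult.commute[of _ "F' _"])
qed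

text \<open>
  Let \<open>m r \<omega>\<close> be \<open>u + (s - r) (\<partial>\<^sub>t u + \<omega> \<bullet> \<nabla> u)\<close> at the point \<open>(r, x + (s - r) \<omega>)\<close> of the cone. Differentiating
  in \<open>r\<close>, the mixed derivatives cancel and \<open>(s - r) (\<partial>\<^sub>t\<^sub>t u - \<omega> \<bullet> D\<^sup>2u \<omega>) - 2 \<omega> \<bullet> \<nabla> u\<close> remains. By the divergence
  theorem on the sphere, applied to \<open>\<omega> \<mapsto> \<nabla> u\<close>, it has the same integral as
  \<open>(s - r) (\<partial>\<^sub>t\<^sub>t u - \<Delta> u)\<close>. At the vertex \<open>r = s\<close> the integral of \<open>m\<close> is \<open>4 \<pi> u (s, x)\<close>.
\<close>

lemma kirchhoff:
  fixes u :: "real \<times> (real^3) \<Rightarrow> real"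
  assumes s: "0 \<le> s"
    and uc: "continuous_on ({0..s} \<times> UNIV) u"
    and duc: "\<And>v. continuous_on ({0..s} \<times> UNIV) (\<lambda>z. du z v)"
    and d2c: "\<And>v v'. continuous_on ({0..s} \<times> UNIV) (\<lambda>z. d2 z v v')"
    and u: "\<And>z. z \<in> {0<..<s} \<times> UNIV \<Longrightarrow> (u has_derivative du z) (at z)"
    and du: "\<And>z v. z \<in> {0<..<s} \<times> UNIV \<Longrightarrow> ((\<lambda>z. du z v) has_derivative d2 z v) (at z)"
  shows "4 * pi * u (s, x) =
      (LINT \<omega>:sphere 0 1|sphere_measure. u (0, x + s *\<^sub>R \<omega>) +
          s * (du (0, x + s *\<^sub>R \<omega>) (1, 0) + (\<Sum>i\<in>UNIV. \<omega> $ i * du (0, x + s *\<^sub>R \<omega>) (0, axis i 1))))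
    + (LINT r:{0..s}|lborel. LINT \<omega>:sphere 0 1|sphere_measure. (s - r) *
          (d2 (r, x + (s - r) *\<^sub>R \<omega>) (1, 0) (1, 0)
            - (\<Sum>i\<in>UNIV. d2 (r, x + (s - r) *\<^sub>R \<omega>) (0, axis i 1) (0, axis i 1))))"
proof -
  let ?S = "sphere 0 1 :: (real^3) set"
  let ?z = "\<lambda>r \<omega>. (r, x + (s - r) *\<^sub>R \<omega>)"
  define m where "m r \<omega> = u (?z r \<omega>) + (s - r) * (du (?z r \<omega>) (1, 0)
      + (\<Sum>i\<in>UNIV. \<omega> $ i * du (?z r \<omega>) (0, axis i 1)))" for r \<omega>
  define m' where "m' r \<omega> = (s - r) * (d2 (?z r \<omega>) (1, 0) (1, 0)
      - (\<Sum>i\<in>UNIV. \<Sum>j\<in>UNIV. \<omega> $ i * \<omega> $ j * d2 (?z r \<omega>) (0, axis i 1) (0, axis j 1)))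
      - 2 * (\<Sum>i\<in>UNIV. \<omega> $ i * du (?z r \<omega>) (0, axis i 1))" for r \<omega>
  define g where "g r \<omega> = (s - r) * (d2 (?z r \<omega>) (1, 0) (1, 0)
            - (\<Sum>i\<in>UNIV. d2 (?z r \<omega>) (0, axis i 1) (0, axis i 1)))" for r \<omega>
  note cone = continuous_on_cone[where x=x and K="?S", unfolded case_prod_beta]
  have mc: "continuous_on ({0..s} \<times> ?S) (\<lambda>(r, \<omega>). m r \<omega>)"
    unfolding m_def case_prod_beta
    by (intro continuous_intros cone uc duc)
  have m'c: "continuous_on ({0..s} \<times> ?S) (\<lambda>(r, \<omega>). m' r \<omega>)"
    unfolding m'_def case_prod_beta
    by (intro continuous_intros cone uc duc d2c)
  have gc: "continuous_on ({0..s} \<times> ?S) (\<lambda>(r, \<omega>). g r \<omega>)"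
    unfolding g_def case_prod_beta
    by (intro continuous_intros cone uc duc d2c)
  have sph: "compact ?S" "emeasure sphere_measure ?S < \<infinity>" by (auto simp: sphere_finite[simplified])
  have zin: "?z r \<omega> \<in> {0<..<s} \<times> UNIV" if "r \<in> {0<..<s}" for r \<omega> using that by simp
  have sym: "d2 z v v' = d2 z v' v" if "z \<in> {0<..<s} \<times> UNIV" for z v v'
    by (rule second_derivative_symmetric[where U="{0<..<s} \<times> UNIV" and w=u and dw=du])
       (use that u du in \<open>auto intro!: open_Times continuous_on_subset[OF d2c]\<close>)
  have lin2: "linear (d2 z v)" if "z \<in> {0<..<s} \<times> UNIV" for z v
    using du[OF that] by (rule has_derivative_linear)
  have lin1: "linear (du z)" if "z \<in> {0<..<s} \<times> UNIV" for z
    using u[OF that] by (rule has_derivative_linear)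
  have Dm: "((\<lambda>r. m r \<omega>) has_real_derivative m' r \<omega>) (at r)" if r: "r \<in> {0<..<s}" for r \<omega>
  proof -
    note D0 = DERIV_along_cone[OF u[OF zin[OF r]]]
    note D1 = DERIV_along_cone[OF du[OF zin[OF r]]]
    have "((\<lambda>r. m r \<omega>) has_real_derivative du (?z r \<omega>) (1, - \<omega>) +
       ((s - r) * (d2 (?z r \<omega>) (1, 0) (1, - \<omega>)
         + (\<Sum>i\<in>UNIV. \<omega> $ i * d2 (?z r \<omega>) (0, axis i 1) (1, - \<omega>)))
       - (du (?z r \<omega>) (1, 0) + (\<Sum>i\<in>UNIV. \<omega> $ i * du (?z r \<omega>) (0, axis i 1))))) (at r)"
      unfolding m_def
      by (rule derivative_eq_intros D0 D1 refl | simp add: sum_distrib_left sum_negf algebra_simps)+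
    also have "du (?z r \<omega>) (1, - \<omega>) +
       ((s - r) * (d2 (?z r \<omega>) (1, 0) (1, - \<omega>)
         + (\<Sum>i\<in>UNIV. \<omega> $ i * d2 (?z r \<omega>) (0, axis i 1) (1, - \<omega>)))
       - (du (?z r \<omega>) (1, 0) + (\<Sum>i\<in>UNIV. \<omega> $ i * du (?z r \<omega>) (0, axis i 1)))) = m' r \<omega>"
      unfolding m'_def linear_time_space[OF lin1[OF zin[OF r]], where a=1 and v="-\<omega>"]
        linear_time_space[OF lin2[OF zin[OF r]], where a=1 and v="-\<omega>"] sum_3
        sym[OF zin[OF r], where v="(1,0)" and v'="(0, axis j 1)" for j]
      by (simp add: algebra_simps)
    finally show ?thesis .
  qed
  \<comment> \<open>\<open>m'\<close> and \<open>g\<close> differ by the surface divergence of \<open>V \<omega> = \<nabla> u (r, x + (s - r) \<omega>)\<close>.\<close>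
  have int_eq: "(LINT \<omega>:?S|sphere_measure. m' r \<omega>) = (LINT \<omega>:?S|sphere_measure. g r \<omega>)"
    if r: "r \<in> {0<..<s}" for r
  proof -
    define V where "V \<omega> = (\<chi> i. du (r, x + (s - r) *\<^sub>R \<omega>) (0, axis i 1))" for \<omega>
    define V' where "V' \<omega> v = (\<chi> i. d2 (r, x + (s - r) *\<^sub>R \<omega>) (0, axis i 1) (0, (s - r) *\<^sub>R v))" for \<omega> v
    have rs: "r \<in> {0..s}" using r by auto
    have DV: "(V has_derivative V' \<omega>) (at \<omega>)" for \<omega>
    proof -
      have *: "((\<lambda>\<omega>. (r, x + (s - r) *\<^sub>R \<omega>)) has_derivative (\<lambda>v. (0, (s - r) *\<^sub>R v))) (at \<omega>)"
        by (auto intro!: derivative_eq_intros)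
      show ?thesis unfolding V_def V'_def
        by (rule has_derivative_vec_lambda, rule has_derivative_compose[OF * du[OF zin[OF r]]])
    qed
    have "(LINT \<omega>:?S|sphere_measure.
            (\<Sum>i\<in>UNIV. V' \<omega> (axis i 1) $ i) - \<omega> \<bullet> V' \<omega> \<omega> - 2 * (\<omega> \<bullet> V \<omega>)) = 0"
    proof (rule sphere_divergence[OF DV])
      fix v
      have "continuous_on ?S (\<lambda>\<omega>. d2 (r, x + (s - r) *\<^sub>R \<omega>) w v)" for w v
        by (rule continuous_on_compose2[OF d2c]) (use rs in \<open>auto intro!: continuous_intros\<close>)
      then show "continuous_on ?S (\<lambda>\<omega>. V' \<omega> v)"
        unfolding V'_def by (intro continuous_on_vec_lambda)
    qed
    moreover have "m' r \<omega> = g r \<omega> + ((\<Sum>i\<in>UNIV. V' \<omega> (axis i 1) $ i) - \<omega> \<bullet> V' \<omega> \<omega> - 2 * (\<omega> \<bullet> V \<omega>))" for \<omega>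
    proof -
      have sc: "d2 (?z r \<omega>) w (0, (s - r) *\<^sub>R v) = (s - r) * (\<Sum>j\<in>UNIV. v $ j * d2 (?z r \<omega>) w (0, axis j 1))" for w v
        unfolding linear_time_space[OF lin2[OF zin[OF r]], where a=0 and v="(s - r) *\<^sub>R v"]
        by (simp add: sum_distrib_left mult.assoc)
      show ?thesis
        unfolding V'_def V_def inner_vec_def vec_lambda_beta sc
        unfolding m'_def g_def sum_3 by (simp add: axis_def algebra_simps)
    qed
    moreover have "set_integrable sphere_measure ?S (g r)" "set_integrable sphere_measure ?S (m' r)"
      using continuous_on_section[OF gc rs] continuous_on_section[OF m'c rs] sph
      by (auto intro!: set_integrable_continuous_compact)
    ultimately show ?thesis
      using set_integral_diff(2)[of sphere_measure ?S "m' r" "g r"] by simp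
  qed
  have "(LINT r:{0..s}|lborel. LINT \<omega>:?S|sphere_measure. g r \<omega>) =
     (LINT \<omega>:?S|sphere_measure. m s \<omega>) - (LINT \<omega>:?S|sphere_measure. m 0 \<omega>)"
  proof (rule set_integral_FTC_interior[OF s])
    show "continuous_on {0..s} (\<lambda>r. LINT \<omega>:?S|sphere_measure. m r \<omega>)"
      by (rule continuous_on_set_integral[OF _ sph compact_Icc mc]) simp
    show "continuous_on {0..s} (\<lambda>r. LINT \<omega>:?S|sphere_measure. g r \<omega>)"
      by (rule continuous_on_set_integral[OF _ sph compact_Icc gc]) simp
    fix r assume r: "r \<in> {0<..<s}"
    have "((\<lambda>r. LINT \<omega>:?S|sphere_measure. m r \<omega>) has_real_derivative (LINT \<omega>:?S|sphere_measure. m' r \<omega>)) (at r)"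
    proof (rule DERIV_set_integral[OF _ sph Dm _ _ r])
      show "continuous_on ?S (m r)" if "r \<in> {0<..<s}" for r
        using that by (intro continuous_on_section[OF mc]) auto
      show "continuous_on ({0<..<s} \<times> ?S) (\<lambda>(r, \<omega>). m' r \<omega>)"
        by (rule continuous_on_subset[OF m'c]) auto
    qed auto
    then show "((\<lambda>r. LINT \<omega>:?S|sphere_measure. m r \<omega>) has_real_derivative (LINT \<omega>:?S|sphere_measure. g r \<omega>)) (at r)"
      by (simp only: int_eq[OF r])
  qed
  moreover have "(LINT \<omega>:?S|sphere_measure. m s \<omega>) = 4 * pi * u (s, x)"
  proof -
    have "(LINT \<omega>:?S|sphere_measure. m s \<omega>) = (\<integral>\<omega>. u (s, x) \<partial>(sphere_measure :: (real^3) measure))"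
      by (subst integral_sphere_measure) (auto simp: m_def[abs_def])
    then show ?thesis by (simp add: measure_def emeasure_sphere_measure_UNIV)
  qed
  ultimately show ?thesis by (simp add: m_def[abs_def] g_def[abs_def])
qed

section \<open>Velocities\<close>

lemma jbr_pos: "jbr \<xi> > 0"
  by (simp add: jbr_def add_pos_nonneg)

lemma jbr_power2: "(jbr \<xi>)\<^sup>2 = 1 + \<xi> \<bullet> \<xi>"
  by (simp add: jbr_def power2_norm_eq_inner)

lemma norm_nu: "(norm (nu \<xi>))\<^sup>2 = 1 - 1 / (jbr \<xi>)\<^sup>2"
proof -
  have "1 + \<xi> \<bullet> \<xi> > 0" by (simp add: add_pos_nonneg)
  moreover have "(norm (nu \<xi>))\<^sup>2 = (\<xi> \<bullet> \<xi>) / (jbr \<xi>)\<^sup>2"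
    unfolding power2_norm_eq_inner nu_def by (simp add: power2_eq_square divide_inverse)
  ultimately show ?thesis unfolding jbr_power2 by (simp add: field_simps)
qed

lemma norm_nu_less: "norm (nu \<xi>) < 1"
proof -
  have "(norm (nu \<xi>))\<^sup>2 < 1\<^sup>2"
    using jbr_pos[of \<xi>] by (simp add: norm_nu)
  then show ?thesis by (rule power2_less_imp_less) simp
qed

lemma cone_denominator_pos:
  assumes "norm \<omega> \<le> 1" "norm p < 1"
  shows "1 + \<omega> \<bullet> p > 0"
proof -
  have "\<bar>\<omega> \<bullet> p\<bar> \<le> norm \<omega> * norm p" by (rule Cauchy_Schwarz_ineq2)
  also have "\<dots> \<le> norm p" using assms(1) by (simp add: mult_left_le_one_le)
  finally show ?thesis using assms(2) by simp
qed

lemma cone_denominator_nonzero: "\<omega> \<in> sphere 0 1 \<Longrightarrow> 1 + \<omega> \<bullet> nu \<xi> \<noteq> 0"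
  using cone_denominator_pos[OF _ norm_nu_less, of \<omega> \<xi>] by simp

definition nu_deriv :: "real^3 \<Rightarrow> real^3 \<Rightarrow> real^3" where
  "nu_deriv \<xi> h = (1 / jbr \<xi>) *\<^sub>R h - ((\<xi> \<bullet> h) / jbr \<xi> ^ 3) *\<^sub>R \<xi>"

lemma jbr_has_derivative: "(jbr has_derivative (\<lambda>h. (\<xi> \<bullet> h) / jbr \<xi>)) (at \<xi>)"
proof -
  have "((\<lambda>\<xi>. sqrt (1 + \<xi> \<bullet> \<xi>)) has_derivative (\<lambda>h. (\<xi> \<bullet> h) / sqrt (1 + \<xi> \<bullet> \<xi>))) (at \<xi>)"
    by (auto intro!: derivative_eq_intros simp: add_pos_nonneg inner_commute field_simps)
  then show ?thesis by (simp add: jbr_def[abs_def] power2_norm_eq_inner)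
qed

lemma nu_has_derivative: "(nu has_derivative nu_deriv \<xi>) (at \<xi>)"
proof -
  have "((\<lambda>\<xi>. inverse (jbr \<xi>) *\<^sub>R \<xi>) has_derivative nu_deriv \<xi>) (at \<xi>)"
    using jbr_pos[of \<xi>]
    by (auto intro!: derivative_eq_intros jbr_has_derivative
        simp: nu_deriv_def fun_eq_iff field_simps power3_eq_cube)
  then show ?thesis by (simp add: nu_def[abs_def])
qed

lemma continuous_on_jbr [continuous_intros]:
  "continuous_on S g \<Longrightarrow> continuous_on S (\<lambda>x. jbr (g x))"
  unfolding jbr_def by (intro continuous_intros)

lemma continuous_on_nu [continuous_intros]:
  "continuous_on S g \<Longrightarrow> continuous_on S (\<lambda>x. nu (g x))"
  unfolding nu_def using jbr_pos by (intro continuous_intros) (auto simp: less_imp_neq[THEN not_sym])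

lemma continuous_on_nu_deriv [continuous_intros]:
  "continuous_on S g \<Longrightarrow> continuous_on S h \<Longrightarrow> continuous_on S (\<lambda>x. nu_deriv (g x) (h x))"
  unfolding nu_deriv_def using jbr_pos by (intro continuous_intros) (auto simp: less_imp_neq[THEN not_sym])

section \<open>The kernels on the light cone\<close>

text \<open>
  The quotient that occurs in all weights, as a function of the velocity \<open>p\<close>, which later is \<open>nu \<xi>\<close>.
  It is symmetric in \<open>\<omega>\<close> and \<open>p\<close>, so \<open>ratio_deriv\<close>, its derivative in \<open>p\<close> in the direction \<open>k\<close>, also
  gives the derivative in \<open>\<omega>\<close>.
\<close>

definition ratio :: "real^3 \<Rightarrow> real^3 \<Rightarrow> real^3 \<Rightarrow> real" where
  "ratio v \<omega> p = (v \<bullet> (p + \<omega>)) / (1 + \<omega> \<bullet> p)"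

definition ratio_deriv :: "real^3 \<Rightarrow> real^3 \<Rightarrow> real^3 \<Rightarrow> real^3 \<Rightarrow> real" where
  "ratio_deriv v \<omega> p k = (v \<bullet> k) / (1 + \<omega> \<bullet> p) - (v \<bullet> (p + \<omega>)) * (\<omega> \<bullet> k) / (1 + \<omega> \<bullet> p)\<^sup>2"

lemma ratio_has_derivative:
  assumes "1 + \<omega> \<bullet> p \<noteq> 0"
  shows "(ratio v \<omega> has_derivative ratio_deriv v \<omega> p) (at p)"
proof -
  have "((\<lambda>p. (v \<bullet> (p + \<omega>)) / (1 + \<omega> \<bullet> p)) has_derivative ratio_deriv v \<omega> p) (at p)"
    using assms by (auto intro!: derivative_eq_intros
        simp: ratio_deriv_def fun_eq_iff divide_inverse power2_eq_square)
  then show ?thesis by (simp add: ratio_def[abs_def])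
qed

lemma ratio_sym: "ratio v \<omega> p = ratio v p \<omega>"
  by (simp add: ratio_def add.commute inner_commute)

lemma continuous_on_ratio:
  assumes "continuous_on S v" "continuous_on S w" "continuous_on S p" "\<And>x. x \<in> S \<Longrightarrow> 1 + w x \<bullet> p x \<noteq> 0"
  shows "continuous_on S (\<lambda>x. ratio (v x) (w x) (p x))"
  unfolding ratio_def using assms by (intro continuous_intros) auto

lemma continuous_on_ratio_deriv:
  assumes "continuous_on S v" "continuous_on S w" "continuous_on S p" "continuous_on S k"
    "\<And>x. x \<in> S \<Longrightarrow> 1 + w x \<bullet> p x \<noteq> 0"
  shows "continuous_on S (\<lambda>x. ratio_deriv (v x) (w x) (p x) (k x))"
  unfolding ratio_deriv_def using assms by (intro continuous_intros) auto

lemma ratio_nu_has_derivative: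
  assumes "1 + \<omega> \<bullet> nu \<xi> \<noteq> 0"
  shows "((\<lambda>\<xi>. ratio v \<omega> (nu \<xi>)) has_derivative (\<lambda>h. ratio_deriv v \<omega> (nu \<xi>) (nu_deriv \<xi> h))) (at \<xi>)"
  by (rule has_derivative_compose[OF nu_has_derivative ratio_has_derivative[OF assms]])

text \<open>
  The spatial part of \<open>(v \<bullet> p, v) - ratio v \<omega> p (1, p)\<close>. The factor \<open>ratio\<close> is the one for which this difference
  of \<open>(v \<bullet> p, v)\<close> and a multiple of the transport direction is tangent to the cone: by \<open>wave_vector_inner\<close>
  its time component is minus the \<open>\<omega>\<close>-component of the wave vector.
\<close>

definition wave_vector :: "real^3 \<Rightarrow> real^3 \<Rightarrow> real^3 \<Rightarrow> real^3" where
  "wave_vector v \<omega> p = v - ratio v \<omega> p *\<^sub>R p"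

text \<open>
  For \<open>p = nu \<xi>\<close> this is the weight Wl up to the factor \<open>- 1 / (4 pi)\<close>, since \<open>1 - nu \<xi> \<bullet> nu \<xi> = 1 / (jbr \<xi>)\<^sup>2\<close>.
\<close>

definition tangential_kernel :: "real^3 \<Rightarrow> real^3 \<Rightarrow> real^3 \<Rightarrow> real" where
  "tangential_kernel v \<omega> p = (1 - p \<bullet> p) * (v \<bullet> (p + \<omega>)) / (1 + \<omega> \<bullet> p)\<^sup>2"

lemma wave_vector_inner:
  assumes "1 + \<omega> \<bullet> p \<noteq> 0" "norm \<omega> = 1"
  shows "wave_vector v \<omega> p \<bullet> \<omega> = ratio v \<omega> p - v \<bullet> p"
  using assms by (simp add: wave_vector_def ratio_def inner_diff_left inner_diff_right
      inner_add_right inner_commute field_simps)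

lemma wave_vector_has_derivative:
  assumes "1 + \<omega> \<bullet> p \<noteq> 0"
  shows "((\<lambda>\<omega>. wave_vector v \<omega> p) has_derivative (\<lambda>h. - ratio_deriv v p \<omega> h *\<^sub>R p)) (at \<omega>)"
proof -
  have "((\<lambda>\<omega>. ratio v p \<omega>) has_derivative ratio_deriv v p \<omega>) (at \<omega>)"
    using assms by (intro ratio_has_derivative) (simp add: inner_commute)
  then show ?thesis unfolding wave_vector_def ratio_sym[of v _ p]
    by (auto intro!: derivative_eq_intros)
qed

lemma linear_ratio_deriv: "linear (ratio_deriv v \<omega> p)"
  by (rule linearI) (simp_all add: ratio_deriv_def inner_add_right algebra_simps add_divide_distrib)

text \<open>
  The left-hand side is the surface divergence, in the form of \<open>sphere_divergence\<close>, of the wave vector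
  as a function of \<open>\<omega>\<close>. This computation is the origin of the kernel Wl.
\<close>

lemma wave_vector_divergence:
  assumes b: "1 + \<omega> \<bullet> p \<noteq> 0" and \<omega>: "norm \<omega> = 1"
  shows "(\<Sum>i\<in>UNIV. (- ratio_deriv v p \<omega> (axis i 1) *\<^sub>R p) $ i) - \<omega> \<bullet> (- ratio_deriv v p \<omega> \<omega> *\<^sub>R p)
           - 2 * (\<omega> \<bullet> wave_vector v \<omega> p)
         = - (tangential_kernel v \<omega> p + wave_vector v \<omega> p \<bullet> \<omega>)"
proof -
  have "(\<Sum>i\<in>UNIV. (- ratio_deriv v p \<omega> (axis i 1) *\<^sub>R p) $ i) = - ratio_deriv v p \<omega> p"
    by (subst (2) linear_eq_sum_axis[OF linear_ratio_deriv]) (simp add: sum_negf mult.commute)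
  moreover define \<beta> where "\<beta> = 1 + \<omega> \<bullet> p"
  then have c: "\<omega> \<bullet> p = \<beta> - 1" "p \<bullet> \<omega> = \<beta> - 1" by (auto simp: inner_commute)
  moreover have "\<omega> \<bullet> \<omega> = 1" using \<omega> by (simp add: norm_eq_1)
  moreover have "\<beta> \<noteq> 0" using b by (simp add: \<beta>_def)
  ultimately show ?thesis
    unfolding ratio_deriv_def tangential_kernel_def wave_vector_inner[OF b \<omega>] inner_commute[of \<omega> "wave_vector v \<omega> p"]
      ratio_def
    by (simp add: c inner_add_right inner_add_left inner_diff_right inner_commute[of \<omega> v] divide_simps power2_eq_square)
       (simp add: algebra_simps)
qed

section \<open>Double integrals of continuous functions\<close>

text \<open>
  Iterated integrals of continuous functions over a product of compact sets; below these sets are the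
  unit sphere of directions and a ball of momenta.
\<close>

locale compact_pair =
  fixes M :: "'a::euclidean_space measure" and N :: "'b::euclidean_space measure" and S C
  assumes M: "sets M = sets borel" "sigma_finite_measure M" and S: "compact S" "emeasure M S < \<infinity>"
    and N: "sets N = sets borel" "sigma_finite_measure N" and C: "compact C" "emeasure N C < \<infinity>"
begin

definition dint :: "('a \<Rightarrow> 'b \<Rightarrow> real) \<Rightarrow> real" where
  "dint h = (LINT x:S|M. LINT y:C|N. h x y)"

lemma dint_cong: "(\<And>x y. x \<in> S \<Longrightarrow> y \<in> C \<Longrightarrow> h x y = h' x y) \<Longrightarrow> dint h = dint h'"
  unfolding dint_def using M N S C
  by (intro set_lebesgue_integral_cong) (auto intro!: set_lebesgue_integral_cong simp: borel_compact)

lemma continuous_on_inner: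
  fixes h :: "'r::metric_space \<Rightarrow> 'a \<Rightarrow> 'b \<Rightarrow> real"
  assumes R: "compact R" and h: "continuous_on (R \<times> S \<times> C) (\<lambda>(r, x, y). h r x y)"
  shows "continuous_on (R \<times> S) (\<lambda>(r, x). LINT y:C|N. h r x y)"
proof -
  have "continuous_on ((R \<times> S) \<times> C) (\<lambda>p. (\<lambda>(r, x, y). h r x y) (fst (fst p), snd (fst p), snd p))"
    by (rule continuous_on_compose2[OF h]) (auto intro!: continuous_intros)
  then show ?thesis
    unfolding case_prod_beta
    by (intro continuous_on_set_integral[OF N(1) C compact_Times[OF R S(1)], where f="\<lambda>p. h (fst p) (snd p)"])
       (simp add: case_prod_beta)
qed

lemma continuous_on_dint:
  fixes h :: "'r::metric_space \<Rightarrow> 'a \<Rightarrow> 'b \<Rightarrow> real"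
  assumes "compact R" "continuous_on (R \<times> S \<times> C) (\<lambda>(r, x, y). h r x y)"
  shows "continuous_on R (\<lambda>r. dint (h r))"
  unfolding dint_def
  by (rule continuous_on_set_integral[OF M(1) S assms(1) continuous_on_inner[OF assms]])

lemma continuous_on_inner1:
  fixes h :: "'a \<Rightarrow> 'b \<Rightarrow> real"
  assumes h: "continuous_on (S \<times> C) (\<lambda>(x, y). h x y)"
  shows "continuous_on S (\<lambda>x. LINT y:C|N. h x y)"
  by (rule continuous_on_set_integral[OF N(1) C S(1) h])

lemma continuous_on_time_section:
  fixes k :: "real \<Rightarrow> 'a \<Rightarrow> 'b \<Rightarrow> real"
  assumes "continuous_on (R \<times> S \<times> C) (\<lambda>(r, x, y). k r x y)" "r \<in> R"
  shows "continuous_on (S \<times> C) (\<lambda>(x, y). k r x y)"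
  using continuous_on_section[of R "S \<times> C" "\<lambda>r (x, y). k r x y" r] assms by (simp add: case_prod_beta)

lemma dint_linear:
  fixes h k :: "'a \<Rightarrow> 'b \<Rightarrow> real"
  assumes h: "continuous_on (S \<times> C) (\<lambda>(x, y). h x y)" and k: "continuous_on (S \<times> C) (\<lambda>(x, y). k x y)"
  shows "dint (\<lambda>x y. h x y + k x y) = dint h + dint k"
    "dint (\<lambda>x y. h x y - k x y) = dint h - dint k"
proof -
  have i: "set_integrable N C (h x)" "set_integrable N C (k x)" if "x \<in> S" for x
    using that by (auto intro!: set_integrable_continuous_compact N C continuous_on_section[OF h] continuous_on_section[OF k])
  have o: "set_integrable M S (\<lambda>x. LINT y:C|N. h x y)" "set_integrable M S (\<lambda>x. LINT y:C|N. k x y)"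
    by (auto intro!: set_integrable_continuous_compact M S continuous_on_inner1 h k)
  have "dint (\<lambda>x y. h x y + k x y) = (LINT x:S|M. (LINT y:C|N. h x y) + (LINT y:C|N. k x y))"
    unfolding dint_def using M S i by (intro set_lebesgue_integral_cong) (auto simp: borel_compact set_integral_add(2))
  also have "\<dots> = dint h + dint k" unfolding dint_def by (rule set_integral_add(2)[OF o])
  finally show "dint (\<lambda>x y. h x y + k x y) = dint h + dint k" .
  have "dint (\<lambda>x y. h x y - k x y) = (LINT x:S|M. (LINT y:C|N. h x y) - (LINT y:C|N. k x y))"
    unfolding dint_def using M S i by (intro set_lebesgue_integral_cong) (auto simp: borel_compact set_integral_diff(2))
  also have "\<dots> = dint h - dint k" unfolding dint_def by (rule set_integral_diff(2)[OF o])
  finally show "dint (\<lambda>x y. h x y - k x y) = dint h - dint k" .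
qed

lemma dint_mult: "dint (\<lambda>x y. c * h x y) = c * dint h"
  by (simp add: dint_def)

lemma dint_zero_inner:
  fixes h :: "'a \<Rightarrow> 'b \<Rightarrow> real"
  assumes "\<And>x. x \<in> S \<Longrightarrow> (LINT y:C|N. h x y) = 0"
  shows "dint h = 0"
proof -
  have "dint h = (LINT x:S|M. 0)"
    unfolding dint_def using M S assms by (intro set_lebesgue_integral_cong) (auto simp: borel_compact)
  then show ?thesis by (simp add: set_lebesgue_integral_def)
qed

lemma dint_zero_outer:
  fixes h :: "'a \<Rightarrow> 'b \<Rightarrow> real"
  assumes h: "continuous_on (S \<times> C) (\<lambda>(x, y). h x y)"
    and "\<And>y. y \<in> C \<Longrightarrow> (LINT x:S|M. h x y) = 0"
  shows "dint h = 0"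
proof -
  have "dint h = (LINT y:C|N. LINT x:S|M. h x y)"
    unfolding dint_def by (rule set_integral_swap_Times[OF M N S C h])
  also have "\<dots> = (LINT y:C|N. 0)"
    using N C assms by (intro set_lebesgue_integral_cong) (auto simp: borel_compact)
  finally show ?thesis by (simp add: set_lebesgue_integral_def)
qed

lemma DERIV_dint:
  assumes D: "\<And>r x y. r \<in> {a<..<b} \<Longrightarrow> x \<in> S \<Longrightarrow> y \<in> C \<Longrightarrow>
        ((\<lambda>r. h r x y) has_real_derivative h' r x y) (at r)"
    and h: "continuous_on ({a..b} \<times> S \<times> C) (\<lambda>(r, x, y). h r x y)"
    and h': "continuous_on ({a..b} \<times> S \<times> C) (\<lambda>(r, x, y). h' r x y)"
    and r: "r \<in> {a<..<b}"
  shows "((\<lambda>r. dint (h r)) has_real_derivative dint (h' r)) (at r)"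
  unfolding dint_def
proof (rule DERIV_set_integral[OF M(1) S _ _ _ r])
  fix r assume r: "r \<in> {a<..<b}"
  show "continuous_on S (\<lambda>x. LINT y:C|N. h r x y)"
    using r by (intro continuous_on_inner1 continuous_on_time_section[OF h]) auto
  fix x assume x: "x \<in> S"
  show "((\<lambda>r. LINT y:C|N. h r x y) has_real_derivative (LINT y:C|N. h' r x y)) (at r)"
  proof (rule DERIV_set_integral[OF N(1) C D[OF _ x] _ _ r])
    show "continuous_on C (h r x)" if "r \<in> {a<..<b}" for r
      using that x by (intro continuous_on_section[OF continuous_on_time_section[OF h]]) auto
    show "continuous_on ({a<..<b} \<times> C) (\<lambda>(r, y). h' r x y)"
      using x by (auto intro!: continuous_on_compose2[OF h', of _ "\<lambda>(r, y). (r, x, y)", simplified case_prod_beta fst_conv snd_conv]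
        continuous_intros simp: case_prod_beta)
  qed auto
next
  show "continuous_on ({a<..<b} \<times> S) (\<lambda>(r, x). LINT y:C|N. h' r x y)"
    by (rule continuous_on_subset[OF continuous_on_inner[OF compact_Icc h']]) auto
qed

end

section \<open>The transport equation on the light cone\<close>

lemma compact_pair_sphere_cball:
  "compact_pair (sphere_measure :: (real^3) measure) (lborel :: (real^3) measure) (sphere 0 1) (cball 0 P)"
proof (rule compact_pair.intro)
  show "sigma_finite_measure (sphere_measure :: (real^3) measure)"
    by (rule sphere_measure.sigma_finite_measure_axioms)
  show "sigma_finite_measure (lborel :: (real^3) measure)"
    by (rule sigma_finite_lborel)
  show "emeasure lborel (cball 0 P :: (real^3) set) < \<infinity>"
    using emeasure_bounded_finite[OF bounded_cball] by auto
qed (use sphere_finite in auto)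

lemma lorentz_force_has_derivative:
  "(lorentz_force E B r y has_derivative (\<lambda>h. cross3 (nu_deriv \<xi> h) (B r y))) (at \<xi>)"
proof -
  have bb: "bounded_bilinear cross3" using bilinear_cross by (simp add: bilinear_conv_bounded_bilinear)
  have "((\<lambda>\<xi>. E r y + cross3 (nu \<xi>) (B r y)) has_derivative (\<lambda>h. 0 + (cross3 (nu \<xi>) 0 + cross3 (nu_deriv \<xi> h) (B r y)))) (at \<xi>)"
    by (intro derivative_intros bounded_bilinear.FDERIV[OF bb] nu_has_derivative)
  then show ?thesis by (simp add: lorentz_force_def[abs_def])
qed

text \<open>
  The derivative of \<open>nu\<close> is a symmetric matrix and the cross product with \<open>b\<close> is an antisymmetric one, so
  the trace of their product is 0.
\<close>

lemma lorentz_force_divergence_free: "(\<Sum>i\<in>UNIV. cross3 (nu_deriv \<xi> (axis i 1)) b $ i) = 0"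
  by (simp add: nu_deriv_def cross3_def vector_def sum_3 inner_vec_def axis_def algebra_simps)

text \<open>
  The integrand is the divergence in \<open>\<xi>\<close> of \<open>ratio v \<omega> (nu \<xi>) \<phi>(\<xi>) F(\<xi>)\<close>, since the force is divergence free
  in \<open>\<xi>\<close>.
\<close>

lemma integral_force_by_parts:
  fixes \<phi> :: "real^3 \<Rightarrow> real"
  assumes \<phi>: "\<And>\<xi>. (\<phi> has_derivative \<phi>' \<xi>) (at \<xi>)" and \<phi>'c: "\<And>h. continuous_on UNIV (\<lambda>\<xi>. \<phi>' \<xi> h)"
    and supp: "\<And>\<xi>. norm \<xi> > P \<Longrightarrow> \<phi> \<xi> = 0"
    and \<omega>: "norm \<omega> = 1"
  shows "(LINT \<xi>:cball 0 P|lborel. ratio_deriv v \<omega> (nu \<xi>) (nu_deriv \<xi> (lorentz_force E B r y \<xi>)) * \<phi> \<xi>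
            + ratio v \<omega> (nu \<xi>) * \<phi>' \<xi> (lorentz_force E B r y \<xi>)) = 0"
proof -
  let ?F = "lorentz_force E B r y"
  have b: "1 + \<omega> \<bullet> nu \<xi> \<noteq> 0" for \<xi>
    using \<omega> by (intro cone_denominator_nonzero) simp
  have Fc: "continuous_on UNIV (\<lambda>\<xi>. ?F \<xi>)"
    unfolding lorentz_force_def by (intro continuous_intros continuous_on_cross)
  have \<phi>c: "continuous_on UNIV \<phi>"
    using \<phi> by (meson continuous_at_imp_continuous_on has_derivative_continuous)
  define D where "D i \<xi> h = ratio v \<omega> (nu \<xi>) * \<phi> \<xi> * cross3 (nu_deriv \<xi> h) (B r y) $ i
      + (ratio v \<omega> (nu \<xi>) * \<phi>' \<xi> h + ratio_deriv v \<omega> (nu \<xi>) (nu_deriv \<xi> h) * \<phi> \<xi>) * ?F \<xi> $ i" for i \<xi> h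
  have FD: "((\<lambda>\<xi>. ?F \<xi> $ i) has_derivative (\<lambda>h. cross3 (nu_deriv \<xi> h) (B r y) $ i)) (at \<xi>)" for i \<xi>
    by (rule bounded_linear.has_derivative[OF bounded_linear_vec_nth lorentz_force_has_derivative])
  have D: "((\<lambda>\<xi>. ratio v \<omega> (nu \<xi>) * \<phi> \<xi> * ?F \<xi> $ i) has_derivative D i \<xi>) (at \<xi>)" for i \<xi>
    unfolding D_def by (intro has_derivative_mult ratio_nu_has_derivative b \<phi> FD)
  have Dc: "continuous_on UNIV (\<lambda>\<xi>. D i \<xi> h)" for i h
    unfolding D_def
    by (intro continuous_intros continuous_on_cross Fc \<phi>c \<phi>'c continuous_on_ratio continuous_on_ratio_deriv) (use b in auto)
  have z: "(LINT \<xi>:cball 0 P|lborel. D i \<xi> h) = 0" for i h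
    by (rule integral_derivative_compact_support[OF D Dc]) (simp add: supp)
  have int: "set_integrable lborel (cball 0 P) (\<lambda>\<xi>. D i \<xi> h)" for i h
    using emeasure_bounded_finite[OF bounded_cball]
    by (intro set_integrable_continuous_compact continuous_on_subset[OF Dc]) auto
  have pt: "ratio_deriv v \<omega> (nu \<xi>) (nu_deriv \<xi> (?F \<xi>)) * \<phi> \<xi> + ratio v \<omega> (nu \<xi>) * \<phi>' \<xi> (?F \<xi>)
      = D 1 \<xi> (axis 1 1) + D 2 \<xi> (axis 2 1) + D 3 \<xi> (axis 3 1)" for \<xi>
  proof -
    have lin: "linear (\<lambda>h. ratio_deriv v \<omega> (nu \<xi>) (nu_deriv \<xi> h))"
      using ratio_nu_has_derivative[OF b] by (rule has_derivative_linear)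
    have "D 1 \<xi> (axis 1 1) + D 2 \<xi> (axis 2 1) + D 3 \<xi> (axis 3 1) =
        ratio v \<omega> (nu \<xi>) * \<phi> \<xi> * (\<Sum>i\<in>UNIV. cross3 (nu_deriv \<xi> (axis i 1)) (B r y) $ i)
        + ratio v \<omega> (nu \<xi>) * (\<Sum>i\<in>UNIV. ?F \<xi> $ i *\<^sub>R \<phi>' \<xi> (axis i 1))
        + \<phi> \<xi> * (\<Sum>i\<in>UNIV. ?F \<xi> $ i *\<^sub>R ratio_deriv v \<omega> (nu \<xi>) (nu_deriv \<xi> (axis i 1)))"
      by (simp add: D_def sum_3 algebra_simps)
    also have "\<dots> = ratio v \<omega> (nu \<xi>) * \<phi>' \<xi> (?F \<xi>) + \<phi> \<xi> * ratio_deriv v \<omega> (nu \<xi>) (nu_deriv \<xi> (?F \<xi>))"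
      unfolding lorentz_force_divergence_free linear_eq_sum_axis[OF has_derivative_linear[OF \<phi>], symmetric]
        linear_eq_sum_axis[OF lin, symmetric] by simp
    finally show ?thesis by (simp add: mult.commute)
  qed
  show ?thesis unfolding pt
    by (simp add: set_integral_add int z)
qed

text \<open>
  The divergence theorem on the sphere for the wave vector multiplied by \<open>\<phi> (x + c \<omega>)\<close>.
\<close>

lemma sphere_integral_by_parts:
  fixes \<phi> :: "real^3 \<Rightarrow> real"
  assumes \<phi>: "\<And>y. (\<phi> has_derivative \<phi>' y) (at y)" and \<phi>'c: "\<And>h. continuous_on UNIV (\<lambda>y. \<phi>' y h)"
    and p: "norm p < 1"
  shows "(LINT \<omega>:sphere 0 1|sphere_measure.
      (tangential_kernel v \<omega> p + wave_vector v \<omega> p \<bullet> \<omega>) * \<phi> (x + c *\<^sub>R \<omega>)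
       - c * \<phi>' (x + c *\<^sub>R \<omega>) (wave_vector v \<omega> p - (wave_vector v \<omega> p \<bullet> \<omega>) *\<^sub>R \<omega>)) = 0"
proof -
  let ?S = "sphere 0 1 :: (real^3) set"
  have b: "1 + \<omega> \<bullet> p \<noteq> 0" if "\<omega> \<in> ?S" for \<omega>
    using cone_denominator_pos[OF _ p, of \<omega>] that by simp
  have \<phi>c: "continuous_on UNIV \<phi>"
    using \<phi> by (meson continuous_at_imp_continuous_on has_derivative_continuous)
  define V where "V \<omega> = \<phi> (x + c *\<^sub>R \<omega>) *\<^sub>R wave_vector v \<omega> p" for \<omega>
  define V' where "V' \<omega> h = \<phi> (x + c *\<^sub>R \<omega>) *\<^sub>R (- ratio_deriv v p \<omega> h *\<^sub>R p)
       + \<phi>' (x + c *\<^sub>R \<omega>) (c *\<^sub>R h) *\<^sub>R wave_vector v \<omega> p" for \<omega> h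
  have \<phi>D: "((\<lambda>\<omega>. \<phi> (x + c *\<^sub>R \<omega>)) has_derivative (\<lambda>h. \<phi>' (x + c *\<^sub>R \<omega>) (c *\<^sub>R h))) (at \<omega>)" for \<omega>
    by (rule has_derivative_compose[OF _ \<phi>]) (auto intro!: derivative_eq_intros)
  have D: "(V has_derivative V' \<omega>) (at \<omega>)" if "\<omega> \<in> ?S" for \<omega>
    unfolding V_def V'_def
    by (intro has_derivative_scaleR \<phi>D wave_vector_has_derivative b that)
  have V'c: "continuous_on ?S (\<lambda>\<omega>. V' \<omega> h)" for h
    unfolding V'_def wave_vector_def
    by (intro continuous_intros continuous_on_ratio continuous_on_ratio_deriv
        continuous_on_compose2[OF \<phi>c] continuous_on_compose2[OF \<phi>'c])
       (use b in \<open>auto simp: inner_commute\<close>)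
  have pt: "(\<Sum>i\<in>UNIV. V' \<omega> (axis i 1) $ i) - \<omega> \<bullet> V' \<omega> \<omega> - 2 * (\<omega> \<bullet> V \<omega>) =
      - ((tangential_kernel v \<omega> p + wave_vector v \<omega> p \<bullet> \<omega>) * \<phi> (x + c *\<^sub>R \<omega>)
       - c * \<phi>' (x + c *\<^sub>R \<omega>) (wave_vector v \<omega> p - (wave_vector v \<omega> p \<bullet> \<omega>) *\<^sub>R \<omega>))"
    if \<omega>: "\<omega> \<in> ?S" for \<omega>
  proof -
    let ?A = "wave_vector v \<omega> p" and ?d = "\<phi>' (x + c *\<^sub>R \<omega>)"
    have n: "norm \<omega> = 1" using \<omega> by simp
    have lin: "linear ?d" using \<phi> by (rule has_derivative_linear)
    have "(\<Sum>i\<in>UNIV. V' \<omega> (axis i 1) $ i) - \<omega> \<bullet> V' \<omega> \<omega> - 2 * (\<omega> \<bullet> V \<omega>) =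
       \<phi> (x + c *\<^sub>R \<omega>) * ((\<Sum>i\<in>UNIV. (- ratio_deriv v p \<omega> (axis i 1) *\<^sub>R p) $ i)
          - \<omega> \<bullet> (- ratio_deriv v p \<omega> \<omega> *\<^sub>R p) - 2 * (\<omega> \<bullet> ?A))
       + c * ((\<Sum>i\<in>UNIV. ?A $ i *\<^sub>R ?d (axis i 1)) - (?A \<bullet> \<omega>) * ?d \<omega>)"
      unfolding V'_def V_def
      by (simp add: sum_3 linear_scale[OF lin] inner_commute[of _ \<omega>] inner_add_right algebra_simps)
    also have "\<dots> = \<phi> (x + c *\<^sub>R \<omega>) * - (tangential_kernel v \<omega> p + ?A \<bullet> \<omega>)
       + c * ?d (?A - (?A \<bullet> \<omega>) *\<^sub>R \<omega>)"
      unfolding wave_vector_divergence[OF b[OF \<omega>] n] linear_eq_sum_axis[OF lin, symmetric]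
      by (simp add: linear_diff[OF lin] linear_scale[OF lin])
    finally show ?thesis by (simp add: algebra_simps)
  qed
  have "(LINT \<omega>:?S|sphere_measure. (\<Sum>i\<in>UNIV. V' \<omega> (axis i 1) $ i) - \<omega> \<bullet> V' \<omega> \<omega> - 2 * (\<omega> \<bullet> V \<omega>)) = 0"
    by (rule sphere_divergence[OF D V'c])
  then have "(LINT \<omega>:?S|sphere_measure. - ((tangential_kernel v \<omega> p + wave_vector v \<omega> p \<bullet> \<omega>) * \<phi> (x + c *\<^sub>R \<omega>)
       - c * \<phi>' (x + c *\<^sub>R \<omega>) (wave_vector v \<omega> p - (wave_vector v \<omega> p \<bullet> \<omega>) *\<^sub>R \<omega>))) = 0"
    by (subst (asm) set_lebesgue_integral_cong) (auto simp: pt borel_closed)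
  then show ?thesis by (simp only: set_integral_uminus[symmetric] set_lebesgue_integral_def scaleR_minus_right integral_minus neg_equal_0_iff_equal)
qed

text \<open>
  A solution of the transport equation near the backward light cone with vertex \<open>(s, x)\<close>, given with its
  derivative \<open>df\<close>. The equation is stated as the vanishing of \<open>df\<close> in the direction \<open>(1, nu \<xi>, F)\<close>. The
  support condition concerns the ball that contains all time slices of the cone.
\<close>

locale vlasov_cone =
  fixes s P :: real and x :: "real^3" and f :: "real \<times> (real^3) \<times> (real^3) \<Rightarrow> real"
    and df :: "real \<times> (real^3) \<times> (real^3) \<Rightarrow> real \<times> (real^3) \<times> (real^3) \<Rightarrow> real"
    and E B :: "real \<Rightarrow> real^3 \<Rightarrow> real^3"
  assumes s: "0 \<le> s"
    and f_cont: "continuous_on ({0..s} \<times> UNIV \<times> UNIV) f"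
    and df_cont: "\<And>h. continuous_on ({0..s} \<times> UNIV \<times> UNIV) (\<lambda>z. df z h)"
    and df_linear: "\<And>z. z \<in> {0..s} \<times> UNIV \<times> UNIV \<Longrightarrow> linear (df z)"
    and f_deriv: "\<And>z. z \<in> {0<..<s} \<times> UNIV \<times> UNIV \<Longrightarrow> (f has_derivative df z) (at z)"
    and E_cont: "continuous_on ({0..s} \<times> UNIV) (\<lambda>(r, y). E r y)"
    and B_cont: "continuous_on ({0..s} \<times> UNIV) (\<lambda>(r, y). B r y)"
    and vlasov: "\<And>r y \<xi>. r \<in> {0<..<s} \<Longrightarrow> df (r, y, \<xi>) (1, nu \<xi>, lorentz_force E B r y \<xi>) = 0"
    and support: "\<And>r y \<xi>. r \<in> {0..s} \<Longrightarrow> dist x y \<le> s \<Longrightarrow> norm \<xi> > P \<Longrightarrow> f (r, y, \<xi>) = 0"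
begin

sublocale compact_pair sphere_measure lborel "sphere 0 1 :: (real^3) set" "cball 0 P :: (real^3) set"
  by (rule compact_pair_sphere_cball)

definition cone_point :: "real \<Rightarrow> real^3 \<Rightarrow> real^3 \<Rightarrow> real \<times> (real^3) \<times> (real^3)" where
  "cone_point r \<omega> \<xi> = (r, x + (s - r) *\<^sub>R \<omega>, \<xi>)"

text \<open>
  The factor of \<open>f\<close> in Dn, up to \<open>- 1 / (4 pi)\<close>: \<open>s - r\<close> times the derivative of
  \<open>ratio v \<omega> (nu \<xi>)\<close> in \<open>\<xi>\<close> along the force.
\<close>

definition force_kernel :: "real^3 \<Rightarrow> real \<Rightarrow> real^3 \<Rightarrow> real^3 \<Rightarrow> real" where
  "force_kernel v r \<omega> \<xi> =
     (s - r) * ratio_deriv v \<omega> (nu \<xi>) (nu_deriv \<xi> (lorentz_force E B r (x + (s - r) *\<^sub>R \<omega>) \<xi>))"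

lemma continuous_on_cone_point:
  assumes "continuous_on ({0..s} \<times> UNIV \<times> UNIV) F" and K: "K \<subseteq> {0..s} \<times> UNIV \<times> UNIV"
  shows "continuous_on K (\<lambda>p. F (cone_point (fst p) (fst (snd p)) (snd (snd p))))"
  unfolding cone_point_def
  by (rule continuous_on_compose2[OF assms(1)]) (use K in \<open>force intro!: continuous_intros\<close>)+

lemma continuous_on_df_cone:
  assumes K: "K \<subseteq> {0..s} \<times> UNIV \<times> UNIV" and h: "continuous_on K h"
  shows "continuous_on K (\<lambda>p. df (cone_point (fst p) (fst (snd p)) (snd (snd p))) (h p))"
proof (rule continuous_on_linear_family[OF _ _ h])
  fix p assume "p \<in> K"
  then show "linear (df (cone_point (fst p) (fst (snd p)) (snd (snd p))))"
    using K by (intro df_linear) (auto simp: cone_point_def)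
next
  fix v show "continuous_on K (\<lambda>p. df (cone_point (fst p) (fst (snd p)) (snd (snd p))) v)"
    by (rule continuous_on_cone_point[OF df_cont K])
qed

lemma continuous_on_lorentz_cone:
  assumes K: "K \<subseteq> {0..s} \<times> UNIV \<times> UNIV"
  shows "continuous_on K (\<lambda>p. lorentz_force E B (fst p) (x + (s - fst p) *\<^sub>R fst (snd p)) (snd (snd p)))"
proof -
  have pt: "continuous_on K (\<lambda>p. (\<lambda>(r, y). F r y) (fst p, x + (s - fst p) *\<^sub>R fst (snd p)))"
    if "continuous_on ({0..s} \<times> UNIV) (\<lambda>(r, y). F r y)" for F :: "real \<Rightarrow> real^3 \<Rightarrow> real^3"
    by (rule continuous_on_compose2[OF that]) (use K in \<open>force intro!: continuous_intros\<close>)+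
  show ?thesis
    unfolding lorentz_force_def using pt[OF E_cont] pt[OF B_cont]
    by (intro continuous_intros continuous_on_cross) simp_all
qed

lemma continuous_on_force_kernel:
  "continuous_on ({0..s} \<times> sphere 0 1 \<times> cball 0 P) (\<lambda>(r, \<omega>, \<xi>). force_kernel v r \<omega> \<xi>)"
  unfolding force_kernel_def case_prod_beta
  by (intro continuous_intros continuous_on_ratio_deriv continuous_on_lorentz_cone)
     (auto dest: cone_denominator_nonzero)

lemma continuous_on_tangential_kernel:
  "continuous_on (R \<times> sphere 0 1 \<times> cball 0 P) (\<lambda>(r, \<omega>, \<xi>). tangential_kernel v \<omega> (nu \<xi>))"
  unfolding tangential_kernel_def case_prod_beta
  by (intro continuous_intros) (auto dest: cone_denominator_nonzero)

text \<open>
  Let \<open>a\<close> be the \<open>\<omega>\<close>-component of the wave vector \<open>A\<close>. Then \<open>(v \<bullet> nu \<xi>, v) = q (1, nu \<xi>) + (0, A - a \<omega>) - a (1, - \<omega>)\<close>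
  with \<open>q = ratio v \<omega> (nu \<xi>)\<close>. The derivative of \<open>f\<close> along the first vector is an integral of \<open>f\<close> against the
  force kernel, after integration by parts in \<open>\<xi>\<close> (\<open>b2_zero\<close>). The second vector is tangent to the sphere
  and is integrated by parts there (\<open>b3_zero\<close>). The third one is the direction of the cone at fixed \<open>\<omega>\<close>,
  so its contribution is an \<open>r\<close>-derivative, namely that of \<open>m\<close>; this accounts for the values at \<open>r = 0\<close>.
\<close>

lemma glassey_strauss:
  "(LINT r:{0..s}|lborel. dint (\<lambda>\<omega> \<xi>.
       (s - r) * df (cone_point r \<omega> \<xi>) (v \<bullet> nu \<xi>, v, 0)
       - (tangential_kernel v \<omega> (nu \<xi>) + force_kernel v r \<omega> \<xi>) * f (cone_point r \<omega> \<xi>)))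
   = s * dint (\<lambda>\<omega> \<xi>. (ratio v \<omega> (nu \<xi>) - v \<bullet> nu \<xi>) * f (0, x + s *\<^sub>R \<omega>, \<xi>))"
proof -
  let ?S = "sphere 0 1 :: (real^3) set" and ?C = "cball 0 P :: (real^3) set"
  let ?K = "{0..s} \<times> ?S \<times> ?C"
  let ?z = cone_point
  define a where "a \<omega> \<xi> = wave_vector v \<omega> (nu \<xi>) \<bullet> \<omega>" for \<omega> \<xi>
  define g where "g r \<omega> \<xi> = (s - r) * df (?z r \<omega> \<xi>) (v \<bullet> nu \<xi>, v, 0)
       - (tangential_kernel v \<omega> (nu \<xi>) + force_kernel v r \<omega> \<xi>) * f (?z r \<omega> \<xi>)" for r \<omega> \<xi>
  define m where "m r \<omega> \<xi> = - (s - r) * (a \<omega> \<xi> * f (?z r \<omega> \<xi>))" for r \<omega> \<xi>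
  define m' where "m' r \<omega> \<xi> = a \<omega> \<xi> * f (?z r \<omega> \<xi>) - (s - r) * (a \<omega> \<xi> * df (?z r \<omega> \<xi>) (1, -\<omega>, 0))" for r \<omega> \<xi>
  define b2 where "b2 r \<omega> \<xi> = force_kernel v r \<omega> \<xi> * f (?z r \<omega> \<xi>)
      - (s - r) * (ratio v \<omega> (nu \<xi>) * df (?z r \<omega> \<xi>) (1, nu \<xi>, 0))" for r \<omega> \<xi>
  define b3 where "b3 r \<omega> \<xi> = (tangential_kernel v \<omega> (nu \<xi>) + a \<omega> \<xi>) * f (?z r \<omega> \<xi>)
      - (s - r) * df (?z r \<omega> \<xi>) (0, wave_vector v \<omega> (nu \<xi>) - a \<omega> \<xi> *\<^sub>R \<omega>, 0)" for r \<omega> \<xi>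
  have zK: "?z r \<omega> \<xi> \<in> {0..s} \<times> UNIV \<times> UNIV" if "r \<in> {0..s}" for r \<omega> \<xi>
    using that by (simp add: cone_point_def)
  have fc: "continuous_on ?K (\<lambda>p. f (?z (fst p) (fst (snd p)) (snd (snd p))))"
    by (rule continuous_on_cone_point[OF f_cont]) auto
  have dfc: "continuous_on ?K (\<lambda>p. df (?z (fst p) (fst (snd p)) (snd (snd p))) (h p))"
    if "continuous_on ?K h" for h
    by (rule continuous_on_df_cone[OF _ that]) auto
  have rc: "continuous_on ?K (\<lambda>p. ratio v (fst (snd p)) (nu (snd (snd p))))"
    by (intro continuous_intros continuous_on_ratio) (auto dest: cone_denominator_nonzero)
  have wc: "continuous_on ?K (\<lambda>p. wave_vector v (fst (snd p)) (nu (snd (snd p))))"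
    unfolding wave_vector_def by (intro continuous_intros rc)
  have ac: "continuous_on ?K (\<lambda>p. a (fst (snd p)) (snd (snd p)))"
    unfolding a_def by (intro continuous_intros wc)
  note tc = continuous_on_tangential_kernel[of "{0..s}" v, unfolded case_prod_beta]
  note kc = continuous_on_force_kernel[of v, unfolded case_prod_beta]
  have gc: "continuous_on ?K (\<lambda>(r, \<omega>, \<xi>). g r \<omega> \<xi>)"
    unfolding g_def case_prod_beta by (intro continuous_intros dfc fc tc kc)
  have mc: "continuous_on ?K (\<lambda>(r, \<omega>, \<xi>). m r \<omega> \<xi>)"
    unfolding m_def case_prod_beta by (intro continuous_intros dfc fc ac)
  have m'c: "continuous_on ?K (\<lambda>(r, \<omega>, \<xi>). m' r \<omega> \<xi>)"
    unfolding m'_def case_prod_beta by (intro continuous_intros dfc fc ac)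
  have b2c: "continuous_on ?K (\<lambda>(r, \<omega>, \<xi>). b2 r \<omega> \<xi>)"
    unfolding b2_def case_prod_beta by (intro continuous_intros dfc fc rc kc)
  have b3c: "continuous_on ?K (\<lambda>(r, \<omega>, \<xi>). b3 r \<omega> \<xi>)"
    unfolding b3_def case_prod_beta by (intro continuous_intros dfc fc ac tc wc)
  have Dm: "((\<lambda>r. m r \<omega> \<xi>) has_real_derivative m' r \<omega> \<xi>) (at r)" if r: "r \<in> {0<..<s}" for r \<omega> \<xi>
  proof -
    have zin: "?z r \<omega> \<xi> \<in> {0<..<s} \<times> UNIV \<times> UNIV" using r by (simp add: cone_point_def)
    have "((\<lambda>r. ?z r \<omega> \<xi>) has_derivative (\<lambda>t. t *\<^sub>R (1, - \<omega>, 0))) (at r)"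
      unfolding cone_point_def by (auto intro!: derivative_eq_intros simp: algebra_simps)
    from has_derivative_compose[OF this f_deriv[OF zin]]
    have "((\<lambda>r. f (?z r \<omega> \<xi>)) has_real_derivative df (?z r \<omega> \<xi>) (1, - \<omega>, 0)) (at r)"
      by (simp only: has_field_derivative_def linear_scale[OF has_derivative_linear[OF f_deriv[OF zin]]]
        real_scaleR_def mult.commute[of _ "df _ _"])
    then show ?thesis unfolding m_def m'_def
      by (auto intro!: derivative_eq_intros simp: algebra_simps)
  qed
  have m'_eq: "m' r \<omega> \<xi> = g r \<omega> \<xi> + (b2 r \<omega> \<xi> + b3 r \<omega> \<xi>)"
    if r: "r \<in> {0<..<s}" and \<omega>: "\<omega> \<in> ?S" for r \<omega> \<xi>
  proof -
    let ?L = "df (?z r \<omega> \<xi>)" and ?q = "ratio v \<omega> (nu \<xi>)"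
    have lin: "linear ?L" using r by (intro df_linear zK) auto
    have a: "a \<omega> \<xi> = ?q - v \<bullet> nu \<xi>"
      unfolding a_def by (rule wave_vector_inner) (use \<omega> cone_denominator_nonzero in auto)
    have "?L (v \<bullet> nu \<xi>, v, 0) =
        ?L (?q *\<^sub>R (1, nu \<xi>, 0) + (0, wave_vector v \<omega> (nu \<xi>) - a \<omega> \<xi> *\<^sub>R \<omega>, 0) + (- a \<omega> \<xi>) *\<^sub>R (1, - \<omega>, 0))"
      by (rule arg_cong[where f="?L"]) (simp add: a wave_vector_def algebra_simps)
    also have "\<dots> = ?q * ?L (1, nu \<xi>, 0) + ?L (0, wave_vector v \<omega> (nu \<xi>) - a \<omega> \<xi> *\<^sub>R \<omega>, 0) - a \<omega> \<xi> * ?L (1, - \<omega>, 0)"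
      unfolding linear_add[OF lin] linear_scale[OF lin] by simp
    finally have *: "?L (v \<bullet> nu \<xi>, v, 0) = ?q * ?L (1, nu \<xi>, 0)
       + ?L (0, wave_vector v \<omega> (nu \<xi>) - a \<omega> \<xi> *\<^sub>R \<omega>, 0) - a \<omega> \<xi> * ?L (1, - \<omega>, 0)" .
    show ?thesis unfolding m'_def g_def b2_def b3_def * by (simp add: algebra_simps)
  qed
  have b2_zero: "dint (b2 r) = 0" if r: "r \<in> {0<..<s}" for r
  proof (rule dint_zero_inner)
    fix \<omega> assume \<omega>: "\<omega> \<in> ?S"
    let ?y = "x + (s - r) *\<^sub>R \<omega>"
    have D: "((\<lambda>\<xi>. f (r, ?y, \<xi>)) has_derivative (\<lambda>h. df (r, ?y, \<xi>) (0, 0, h))) (at \<xi>)" for \<xi>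
      by (rule has_derivative_compose[OF _ f_deriv]) (use r in \<open>auto intro!: derivative_eq_intros\<close>)
    have "(LINT \<xi>:?C|lborel. ratio_deriv v \<omega> (nu \<xi>) (nu_deriv \<xi> (lorentz_force E B r ?y \<xi>)) * f (r, ?y, \<xi>)
            + ratio v \<omega> (nu \<xi>) * df (r, ?y, \<xi>) (0, 0, lorentz_force E B r ?y \<xi>)) = 0"
    proof (rule integral_force_by_parts[OF D])
      fix h show "continuous_on UNIV (\<lambda>\<xi>. df (r, ?y, \<xi>) (0, 0, h))"
        by (rule continuous_on_compose2[OF df_cont]) (use r in \<open>auto intro!: continuous_intros\<close>)
      show "norm \<omega> = 1" using \<omega> by simp
      fix \<xi> :: "real^3" assume "norm \<xi> > P"
      then show "f (r, ?y, \<xi>) = 0"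
        using r \<omega> by (intro support) (auto simp: dist_norm)
    qed
    moreover have "b2 r \<omega> \<xi> = (s - r) * (ratio_deriv v \<omega> (nu \<xi>) (nu_deriv \<xi> (lorentz_force E B r ?y \<xi>)) * f (r, ?y, \<xi>)
            + ratio v \<omega> (nu \<xi>) * df (r, ?y, \<xi>) (0, 0, lorentz_force E B r ?y \<xi>))" for \<xi>
    proof -
      let ?L = "df (r, ?y, \<xi>)"
      have lin: "linear ?L" using r by (intro df_linear) auto
      have "0 = ?L ((1, nu \<xi>, 0) + (0, 0, lorentz_force E B r ?y \<xi>))"
        using vlasov[OF r, of ?y \<xi>] by simp
      then have "?L (1, nu \<xi>, 0) = - ?L (0, 0, lorentz_force E B r ?y \<xi>)"
        unfolding linear_add[OF lin] by simp
      then show ?thesis by (simp add: b2_def force_kernel_def cone_point_def algebra_simps)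
    qed
    ultimately show "(LINT \<xi>:?C|lborel. b2 r \<omega> \<xi>) = 0" by simp
  qed
  have b3_zero: "dint (b3 r) = 0" if r: "r \<in> {0<..<s}" for r
  proof (rule dint_zero_outer[OF continuous_on_time_section[OF b3c]])
    show "r \<in> {0..s}" using r by auto
    fix \<xi> :: "real^3"
    have D: "((\<lambda>y. f (r, y, \<xi>)) has_derivative (\<lambda>h. df (r, y, \<xi>) (0, h, 0))) (at y)" for y
      by (rule has_derivative_compose[OF _ f_deriv]) (use r in \<open>auto intro!: derivative_eq_intros\<close>)
    have "continuous_on UNIV (\<lambda>y. df (r, y, \<xi>) (0, h, 0))" for h
      by (rule continuous_on_compose2[OF df_cont]) (use r in \<open>auto intro!: continuous_intros\<close>)
    from sphere_integral_by_parts[OF D this norm_nu_less[of \<xi>], of v x "s - r"]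
    show "(LINT \<omega>:?S|sphere_measure. b3 r \<omega> \<xi>) = 0"
      by (simp only: b3_def a_def cone_point_def)
  qed
  have "(LINT r:{0..s}|lborel. dint (g r)) = dint (m s) - dint (m 0)"
  proof (rule set_integral_FTC_interior[OF s])
    show "continuous_on {0..s} (\<lambda>r. dint (m r))" by (rule continuous_on_dint[OF compact_Icc mc])
    show "continuous_on {0..s} (\<lambda>r. dint (g r))" by (rule continuous_on_dint[OF compact_Icc gc])
    fix r assume r: "r \<in> {0<..<s}"
    have "dint (m' r) = dint (\<lambda>\<omega> \<xi>. g r \<omega> \<xi> + (b2 r \<omega> \<xi> + b3 r \<omega> \<xi>))"
      by (rule dint_cong) (rule m'_eq[OF r])
    also have "\<dots> = dint (g r) + (dint (b2 r) + dint (b3 r))"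
      using continuous_on_time_section[OF gc, of r] continuous_on_time_section[OF b2c, of r]
        continuous_on_time_section[OF b3c, of r] r
      by (simp add: dint_linear continuous_on_add case_prod_beta)
    finally have "dint (m' r) = dint (g r)" by (simp add: b2_zero[OF r] b3_zero[OF r])
    then show "((\<lambda>r. dint (m r)) has_real_derivative dint (g r)) (at r)"
      using DERIV_dint[OF Dm mc m'c r] by simp
  qed
  also have "dint (m s) = 0" by (simp add: m_def[abs_def] dint_def set_lebesgue_integral_def)
  also have "dint (m 0) = dint (\<lambda>\<omega> \<xi>. - s * ((ratio v \<omega> (nu \<xi>) - v \<bullet> nu \<xi>) * f (0, x + s *\<^sub>R \<omega>, \<xi>)))"
    by (rule dint_cong) (simp add: m_def a_def cone_point_def wave_vector_inner cone_denominator_nonzero)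
  also have "\<dots> = - s * dint (\<lambda>\<omega> \<xi>. (ratio v \<omega> (nu \<xi>) - v \<bullet> nu \<xi>) * f (0, x + s *\<^sub>R \<omega>, \<xi>))"
    by (rule dint_mult)
  finally show ?thesis by (simp add: g_def[abs_def])
qed

lemma continuous_on_source:
  "continuous_on ({0..s} \<times> sphere 0 1 \<times> cball 0 P)
     (\<lambda>(r, \<omega>, \<xi>). (s - r) * df (cone_point r \<omega> \<xi>) (v \<bullet> nu \<xi>, v, 0))"
  unfolding case_prod_beta by (intro continuous_intros continuous_on_df_cone) auto

lemma continuous_on_kernels:
  "continuous_on ({0..s} \<times> sphere 0 1 \<times> cball 0 P)
     (\<lambda>(r, \<omega>, \<xi>). (tangential_kernel v \<omega> (nu \<xi>) + force_kernel v r \<omega> \<xi>) * f (cone_point r \<omega> \<xi>))"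
  using continuous_on_force_kernel[of v] continuous_on_tangential_kernel[of _ v]
  unfolding case_prod_beta by (intro continuous_intros continuous_on_cone_point[OF f_cont]) auto

lemma integral_source:
  "(LINT r:{0..s}|lborel. dint (\<lambda>\<omega> \<xi>. (s - r) * df (cone_point r \<omega> \<xi>) (v \<bullet> nu \<xi>, v, 0)))
   = s * dint (\<lambda>\<omega> \<xi>. (ratio v \<omega> (nu \<xi>) - v \<bullet> nu \<xi>) * f (0, x + s *\<^sub>R \<omega>, \<xi>))
   + (LINT r:{0..s}|lborel. dint (\<lambda>\<omega> \<xi>.
        (tangential_kernel v \<omega> (nu \<xi>) + force_kernel v r \<omega> \<xi>) * f (cone_point r \<omega> \<xi>)))"
proof -
  have "(LINT r:{0..s}|lborel. dint (\<lambda>\<omega> \<xi>. (s - r) * df (cone_point r \<omega> \<xi>) (v \<bullet> nu \<xi>, v, 0)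
       - (tangential_kernel v \<omega> (nu \<xi>) + force_kernel v r \<omega> \<xi>) * f (cone_point r \<omega> \<xi>)))
     = (LINT r:{0..s}|lborel. dint (\<lambda>\<omega> \<xi>. (s - r) * df (cone_point r \<omega> \<xi>) (v \<bullet> nu \<xi>, v, 0))
         - dint (\<lambda>\<omega> \<xi>. (tangential_kernel v \<omega> (nu \<xi>) + force_kernel v r \<omega> \<xi>) * f (cone_point r \<omega> \<xi>)))"
    by (intro set_lebesgue_integral_cong)
       (auto intro!: dint_linear(2) continuous_on_time_section[OF continuous_on_source]
         continuous_on_time_section[OF continuous_on_kernels])
  also have "\<dots> = (LINT r:{0..s}|lborel. dint (\<lambda>\<omega> \<xi>. (s - r) * df (cone_point r \<omega> \<xi>) (v \<bullet> nu \<xi>, v, 0)))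
         - (LINT r:{0..s}|lborel. dint (\<lambda>\<omega> \<xi>. (tangential_kernel v \<omega> (nu \<xi>) + force_kernel v r \<omega> \<xi>) * f (cone_point r \<omega> \<xi>)))"
    by (intro set_integral_diff(2) borel_integrable_atLeastAtMost' continuous_on_dint compact_Icc
        continuous_on_source continuous_on_kernels)
  finally show ?thesis using glassey_strauss[of v] by simp
qed

end

section \<open>Derivatives relative to the space-time domain\<close>

lemma Ck_on_SucD:
  assumes "Ck_on (Suc k) S u"
  shows "continuous_on S u"
    and "z \<in> S \<Longrightarrow> (u has_derivative frechet_derivative u (at z within S)) (at z within S)"
    and "Ck_on k S (\<lambda>z. frechet_derivative u (at z within S) v)"
  using assms by (auto simp: differentiable_on_def frechet_derivative_works
      intro: differentiable_imp_continuous_on)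

lemma Ck_on_1D:
  assumes "Ck_on 1 S u"
  shows "continuous_on S (\<lambda>z. frechet_derivative u (at z within S) v)"
  using assms by simp

text \<open>
  This makes one-sided time derivatives unique, also at \<open>t = 0\<close>.
\<close>

lemma time_interval_at_neq_bot:
  assumes "t \<in> time_interval T"
  shows "at t within time_interval T \<noteq> bot"
proof -
  obtain t' where t': "t < t'" "ereal t' < T"
  proof -
    have "ereal t < T" using assms by (simp add: time_interval_def)
    then obtain q where "ereal t < q" "q < T" using dense by blast
    then show thesis by (cases q) (auto intro: that)
  qed
  have "{t..t'} \<subseteq> time_interval T"
  proof
    fix q assume q: "q \<in> {t..t'}"
    then have "ereal q \<le> ereal t'" by simp
    then have "ereal q < T" using t'(2) by (rule le_less_trans)
    then show "q \<in> time_interval T" using q assms by (simp add: time_interval_def)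
  qed
  moreover have "t islimpt {t..t'}" using t' by (simp add: islimpt_Icc)
  ultimately have "t islimpt time_interval T" by (meson islimpt_subset)
  then show ?thesis by (simp add: trivial_limit_within)
qed

lemma time_deriv_eq:
  assumes "(u has_vector_derivative d) (at t within time_interval T)" "t \<in> time_interval T"
  shows "time_deriv T u t = d"
  unfolding time_deriv_def by (rule vector_derivative_within[OF time_interval_at_neq_bot assms(1)]) fact

lemma time_slice_has_vector_derivative:
  assumes "(w has_derivative L) (at (t, x) within time_interval T \<times> UNIV)"
  shows "((\<lambda>s. w (s, x)) has_vector_derivative L (1, 0)) (at t within time_interval T)"
proof -
  have "((\<lambda>s. (s, x)) has_derivative (\<lambda>h. (h, 0))) (at t within time_interval T)"
    by (auto intro!: derivative_eq_intros)
  from has_derivative_in_compose[OF this has_derivative_subset[OF assms, of "(\<lambda>s. (s, x)) ` time_interval T"]]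
  have D: "((\<lambda>s. w (s, x)) has_derivative (\<lambda>h. L (h, 0))) (at t within time_interval T)"
    by auto
  have "L (h, 0) = h *\<^sub>R L (1, 0)" for h
    using linear_scale[OF has_derivative_linear[OF assms], of h "(1, 0)"]
    by (simp only: scaleR_Pair real_scaleR_def mult_1_right scaleR_zero_right)
  then show ?thesis
    unfolding has_vector_derivative_def by (intro has_derivative_eq_rhs[OF D] ext)
qed

lemma time_deriv_slice:
  assumes "(w has_derivative L) (at (t, x) within time_interval T \<times> UNIV)" "t \<in> time_interval T"
  shows "time_deriv T (\<lambda>s. w (s, x)) t = L (1, 0)"
  by (rule time_deriv_eq[OF time_slice_has_vector_derivative]) fact+

lemma partial_eq:
  assumes "(u has_derivative L) (at x)"
  shows "partial i u x = L (axis i 1)"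
  using frechet_derivative_at[OF assms] by (simp add: partial_def)

lemma grad_inner:
  assumes "(u has_derivative L) (at x)"
  shows "v \<bullet> grad u x = L v"
  using linear_eq_sum_axis[OF has_derivative_linear[OF assms], of v]
  by (simp add: inner_vec_def grad_def partial_eq[OF assms])

lemma space_slice_has_derivative:
  assumes "(w has_derivative L) (at (t, x) within time_interval T \<times> UNIV)" "t \<in> time_interval T"
  shows "((\<lambda>y. w (t, y)) has_derivative (\<lambda>h. L (0, h))) (at x)"
proof -
  have "((\<lambda>y. (t, y)) has_derivative (\<lambda>h. (0, h))) (at x within UNIV)"
    by (auto intro!: derivative_eq_intros)
  from has_derivative_in_compose[OF this has_derivative_subset[OF assms(1), of "(\<lambda>y. (t, y)) ` UNIV"]]
  show ?thesis using assms(2) by auto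
qed

lemma partial_slice:
  assumes "(w has_derivative L) (at (t, x) within time_interval T \<times> UNIV)" "t \<in> time_interval T"
  shows "partial i (\<lambda>y. w (t, y)) x = L (0, axis i 1)"
  by (rule partial_eq[OF space_slice_has_derivative]) fact+

lemma at_within_time_interval:
  assumes "0 < t" "t \<in> time_interval T"
  shows "at (t, x) within time_interval T \<times> UNIV = at (t, x)"
proof (rule at_within_open_subset)
  show "open ({t. 0 < t \<and> ereal t < T} \<times> UNIV)"
    by (intro open_Times open_Collect_conj open_Collect_less continuous_intros open_UNIV)
qed (use assms in \<open>auto simp: time_interval_def\<close>)

text \<open>
  First and second derivatives of a function on space-time, in given directions. They are relative to
  the domain, so that they are continuous up to \<open>t = 0\<close>; at positive times they are ordinary derivatives.
\<close>

definition deriv1 :: "ereal \<Rightarrow> (real \<times> 'a::real_normed_vector \<Rightarrow> 'b::real_normed_vector) \<Rightarrow> real \<times> 'a \<Rightarrow> real \<times> 'a \<Rightarrow> 'b"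
  where "deriv1 T w z = frechet_derivative w (at z within time_interval T \<times> UNIV)"

definition deriv2 :: "ereal \<Rightarrow> (real \<times> 'a::real_normed_vector \<Rightarrow> 'b::real_normed_vector) \<Rightarrow> real \<times> 'a \<Rightarrow> real \<times> 'a \<Rightarrow> real \<times> 'a \<Rightarrow> 'b"
  where "deriv2 T w z h = deriv1 T (\<lambda>z. deriv1 T w z h) z"

lemma deriv1:
  assumes "Ck_on (Suc k) (time_interval T \<times> UNIV) w"
  shows "t \<in> time_interval T \<Longrightarrow> (w has_derivative deriv1 T w (t, x)) (at (t, x) within time_interval T \<times> UNIV)"
    and "Ck_on k (time_interval T \<times> UNIV) (\<lambda>z. deriv1 T w z h)"
  using Ck_on_SucD(2,3)[OF assms] by (auto simp: deriv1_def)

lemma deriv2: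
  assumes "Ck_on 2 (time_interval T \<times> UNIV) w"
  shows "continuous_on (time_interval T \<times> UNIV) w"
    "continuous_on (time_interval T \<times> UNIV) (\<lambda>z. deriv1 T w z h)"
    "continuous_on (time_interval T \<times> UNIV) (\<lambda>z. deriv2 T w z h h')"
    "t \<in> time_interval T \<Longrightarrow> (w has_derivative deriv1 T w (t, x)) (at (t, x) within time_interval T \<times> UNIV)"
    "t \<in> time_interval T \<Longrightarrow>
      ((\<lambda>z. deriv1 T w z h) has_derivative deriv2 T w (t, x) h) (at (t, x) within time_interval T \<times> UNIV)"
proof -
  have 2: "Ck_on (Suc (Suc 0)) (time_interval T \<times> UNIV) w" using assms by (simp add: numeral_2_eq_2)
  note 1 = deriv1(2)[OF 2]
  show "continuous_on (time_interval T \<times> UNIV) w" by (rule Ck_on_SucD(1)[OF 2])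
  show "continuous_on (time_interval T \<times> UNIV) (\<lambda>z. deriv1 T w z h)" by (rule Ck_on_SucD(1)[OF 1])
  show "continuous_on (time_interval T \<times> UNIV) (\<lambda>z. deriv2 T w z h h')"
    using deriv1(2)[OF 1, of h h'] by (simp add: deriv2_def)
  show "t \<in> time_interval T \<Longrightarrow> (w has_derivative deriv1 T w (t, x)) (at (t, x) within time_interval T \<times> UNIV)"
    by (rule deriv1(1)[OF 2])
  show "t \<in> time_interval T \<Longrightarrow>
      ((\<lambda>z. deriv1 T w z h) has_derivative deriv2 T w (t, x) h) (at (t, x) within time_interval T \<times> UNIV)"
    using deriv1(1)[OF 1] by (simp add: deriv2_def)
qed

lemma deriv2_at:
  assumes C: "Ck_on 2 (time_interval T \<times> UNIV) w" and t: "0 < t" "t \<in> time_interval T"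
  shows "(w has_derivative deriv1 T w (t, x)) (at (t, x))"
    and "((\<lambda>z. deriv1 T w z h) has_derivative deriv2 T w (t, x) h) (at (t, x))"
  using deriv2(4,5)[OF C t(2)] unfolding at_within_time_interval[OF t] by blast+

lemma wave_operator_slice:
  fixes w :: "real \<Rightarrow> real^3 \<Rightarrow> 'b::real_normed_vector"
  assumes C: "Ck_on 2 (time_interval T \<times> UNIV) (\<lambda>(t, x). w t x)" and t: "t \<in> time_interval T"
  defines "d2 \<equiv> deriv2 T (\<lambda>(t, x). w t x)"
  shows "time_deriv T (time_deriv T (\<lambda>s. w s x)) t = d2 (t, x) (1, 0) (1, 0)"
    and "laplacian (w t) x = (\<Sum>i\<in>UNIV. d2 (t, x) (0, axis i 1) (0, axis i 1))"
proof -
  let ?w = "\<lambda>(t, x). w t x"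
  have 1: "time_deriv T (\<lambda>s. w s x) q = deriv1 T ?w (q, x) (1, 0)" if "q \<in> time_interval T" for q
    using time_deriv_slice[OF deriv2(4)[OF C that] that] by simp
  have "((\<lambda>q. deriv1 T ?w (q, x) (1, 0)) has_vector_derivative d2 (t, x) (1, 0) (1, 0)) (at t within time_interval T)"
    unfolding d2_def by (rule time_slice_has_vector_derivative[OF deriv2(5)[OF C t]])
  then have "(time_deriv T (\<lambda>s. w s x) has_vector_derivative d2 (t, x) (1, 0) (1, 0)) (at t within time_interval T)"
    by (rule has_vector_derivative_transform_within[where d=1]) (use t 1 in auto)
  then show "time_deriv T (time_deriv T (\<lambda>s. w s x)) t = d2 (t, x) (1, 0) (1, 0)"
    by (rule time_deriv_eq[OF _ t])
  have 2: "partial i (w t) = (\<lambda>y. deriv1 T ?w (t, y) (0, axis i 1))" for i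
    using partial_slice[OF deriv2(4)[OF C t] t] by (auto simp: fun_eq_iff)
  show "laplacian (w t) x = (\<Sum>i\<in>UNIV. d2 (t, x) (0, axis i 1) (0, axis i 1))"
    unfolding laplacian_def 2 d2_def
    by (intro sum.cong refl partial_slice[OF deriv2(5)[OF C t] t])
qed

lemma deriv2_symmetric:
  fixes w :: "real \<times> (real^3) \<Rightarrow> real^3"
  assumes C: "Ck_on 2 (time_interval T \<times> UNIV) w" and t: "0 < t" "t \<in> time_interval T"
  shows "deriv2 T w (t, x) h k = deriv2 T w (t, x) k h"
proof -
  let ?U = "{t. 0 < t \<and> ereal t < T} \<times> (UNIV :: (real^3) set)"
  have U: "open ?U"
    by (intro open_Times open_Collect_conj open_Collect_less continuous_intros open_UNIV)
  have D: "(w has_derivative deriv1 T w z) (at z)"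
    "((\<lambda>z. deriv1 T w z h) has_derivative deriv2 T w z h) (at z)" if "z \<in> ?U" for z h
    using that deriv2_at(1)[OF C, where t="fst z" and x="snd z"] deriv2_at(2)[OF C, where t="fst z" and x="snd z" and h=h]
    unfolding prod.collapse by (simp_all add: mem_Times_iff time_interval_def less_imp_le del: split_paired_All)
  have "deriv2 T w (t, x) h k $ i = deriv2 T w (t, x) k h $ i" for i
  proof (rule second_derivative_symmetric[OF U, where w="\<lambda>z. w z $ i" and dw="\<lambda>z h. deriv1 T w z h $ i"
        and ?d2.0="\<lambda>z h k. deriv2 T w z h k $ i"])
    show "(t, x) \<in> ?U" using t by (simp add: time_interval_def)
    show "continuous_on ?U (\<lambda>z. deriv2 T w z h k $ i)"
      by (intro continuous_intros continuous_on_subset[OF deriv2(3)[OF C]]) (auto simp: time_interval_def)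
  qed (auto intro!: bounded_linear.has_derivative[OF bounded_linear_vec_nth] D)
  then show ?thesis by (simp add: vec_eq_iff)
qed

section \<open>The wave equation for the electric field\<close>

locale rvm_solution =
  fixes T :: ereal and \<rho> :: "real^3 \<Rightarrow> real"
    and f :: "real \<Rightarrow> real^3 \<Rightarrow> real^3 \<Rightarrow> real" and E B :: "real \<Rightarrow> real^3 \<Rightarrow> real^3"
  assumes \<rho>: "Ck_on 1 UNIV \<rho>"
    and f: "Ck_on 1 (time_interval T \<times> UNIV) (\<lambda>(t, x, \<xi>). f t x \<xi>)"
    and E: "Ck_on 2 (time_interval T \<times> UNIV) (\<lambda>(t, x). E t x)"
    and B: "Ck_on 2 (time_interval T \<times> UNIV) (\<lambda>(t, x). B t x)"
    and rvm: "rvm_system T \<rho> f E B"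
begin

abbreviation "f_st \<equiv> (\<lambda>(t, x, \<xi>). f t x \<xi>)"
abbreviation "E_st \<equiv> (\<lambda>(t, x). E t x)"
abbreviation "B_st \<equiv> (\<lambda>(t, x). B t x)"
abbreviation "df \<equiv> deriv1 T f_st"
abbreviation "dE \<equiv> deriv1 T E_st"
abbreviation "d2E \<equiv> deriv2 T E_st"
abbreviation "d2B \<equiv> deriv2 T B_st"

lemma f_cont: "continuous_on (time_interval T \<times> UNIV) f_st"
  by (rule Ck_on_SucD(1)[OF f[unfolded One_nat_def]])

lemma df_cont: "continuous_on (time_interval T \<times> UNIV) (\<lambda>z. df z h)"
  using deriv1(2)[OF f[unfolded One_nat_def], of h] by (simp only: Ck_on.simps)

lemma df: "t \<in> time_interval T \<Longrightarrow> (f_st has_derivative df (t, z)) (at (t, z) within time_interval T \<times> UNIV)"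
  by (rule deriv1(1)[OF f[unfolded One_nat_def]])

lemma grad_rho: "(\<rho> has_derivative (\<lambda>h. h \<bullet> grad \<rho> x)) (at x)"
proof -
  have D: "(\<rho> has_derivative frechet_derivative \<rho> (at x)) (at x)"
    using Ck_on_SucD(2)[OF \<rho>[unfolded One_nat_def], of x] by simp
  then show ?thesis by (simp add: grad_inner[OF D])
qed

lemma continuous_on_grad_rho: "continuous_on UNIV (grad \<rho>)"
proof -
  have "continuous_on UNIV (\<lambda>x. frechet_derivative \<rho> (at x) h)" for h
    using Ck_on_1D[OF \<rho>, of h] by simp
  then show ?thesis unfolding grad_def partial_def by (intro continuous_on_vec_lambda)
qed

text \<open>
  The three terms of the Vlasov equation are the derivatives of \<open>f\<close> along three vectors whose sum is
  \<open>(1, nu \<xi>, F)\<close>.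
\<close>

lemma vlasov_eq:
  assumes t: "t \<in> time_interval T"
  shows "df (t, x, \<xi>) (1, nu \<xi>, lorentz_force E B t x \<xi>) = 0"
proof -
  let ?L = "df (t, x, \<xi>)"
  have lin: "linear ?L" using df[OF t] by (rule has_derivative_linear)
  have 1: "time_deriv T (\<lambda>s. f s x \<xi>) t = ?L (1, 0, 0)"
    using time_deriv_slice[OF df[OF t] t, where x="(x, \<xi>)"] by (simp add: zero_prod_def)
  have D: "((\<lambda>(x, \<xi>). f t x \<xi>) has_derivative (\<lambda>h. ?L (0, h))) (at (x, \<xi>))"
    using space_slice_has_derivative[OF df[OF t] t] by simp
  have 2: "v \<bullet> grad (\<lambda>z. f t z \<xi>) x = ?L (0, v, 0)" for v
    by (rule grad_inner, rule has_derivative_compose[of "\<lambda>y. (y, \<xi>)" "\<lambda>h. (h, 0)", OF _ D, simplified case_prod_conv])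
       (auto intro!: derivative_eq_intros)
  have 3: "v \<bullet> grad (\<lambda>\<zeta>. f t x \<zeta>) \<xi> = ?L (0, 0, v)" for v
    by (rule grad_inner, rule has_derivative_compose[of "\<lambda>y. (x, y)" "\<lambda>h. (0, h)", OF _ D, simplified case_prod_conv])
       (auto intro!: derivative_eq_intros)
  have "?L (1, nu \<xi>, lorentz_force E B t x \<xi>) =
      ?L ((1, 0, 0) + (0, nu \<xi>, 0) + (0, 0, lorentz_force E B t x \<xi>))" by simp
  also have "\<dots> = time_deriv T (\<lambda>s. f s x \<xi>) t + nu \<xi> \<bullet> grad (\<lambda>z. f t z \<xi>) x
             + lorentz_force E B t x \<xi> \<bullet> grad (\<lambda>\<zeta>. f t x \<zeta>) \<xi>"
    unfolding linear_add[OF lin] 1 2 3 ..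
  also have "\<dots> = 0" using rvm t by (simp add: rvm_system_def)
  finally show ?thesis .
qed

lemma maxwell:
  assumes t: "t \<in> time_interval T"
  shows "dE (t, x) (1, 0) = curl (B t) x - (\<integral>\<xi>. f t x \<xi> *\<^sub>R nu \<xi> \<partial>lborel)"
    and "deriv1 T B_st (t, x) (1, 0) = - curl (E t) x"
    and "(\<Sum>i\<in>UNIV. dE (t, x) (0, axis i 1) $ i) = (\<integral>\<xi>. f t x \<xi> \<partial>lborel) - \<rho> x"
proof -
  have "time_deriv T (\<lambda>s. E s x) t = dE (t, x) (1, 0)"
    "time_deriv T (\<lambda>s. B s x) t = deriv1 T B_st (t, x) (1, 0)"
    using time_deriv_slice[OF deriv2(4)[OF E t] t] time_deriv_slice[OF deriv2(4)[OF B t] t] by simp_all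
  moreover have "time_deriv T (\<lambda>s. E s x) t - curl (B t) x = - (\<integral>\<xi>. f t x \<xi> *\<^sub>R nu \<xi> \<partial>lborel)"
    "time_deriv T (\<lambda>s. B s x) t + curl (E t) x = 0"
    "divergence (E t) x = (\<integral>\<xi>. f t x \<xi> \<partial>lborel) - \<rho> x"
    using rvm t by (simp_all add: rvm_system_def)
  moreover have "divergence (E t) x = (\<Sum>i\<in>UNIV. dE (t, x) (0, axis i 1) $ i)"
    using partial_slice[OF deriv2(4)[OF E t] t] by (simp add: divergence_def)
  ultimately show "dE (t, x) (1, 0) = curl (B t) x - (\<integral>\<xi>. f t x \<xi> *\<^sub>R nu \<xi> \<partial>lborel)"
    "deriv1 T B_st (t, x) (1, 0) = - curl (E t) x"
    "(\<Sum>i\<in>UNIV. dE (t, x) (0, axis i 1) $ i) = (\<integral>\<xi>. f t x \<xi> \<partial>lborel) - \<rho> x"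
    by (simp_all add: algebra_simps eq_neg_iff_add_eq_0)
qed

lemma curl_slice:
  assumes C: "Ck_on 2 (time_interval T \<times> UNIV) (\<lambda>(t, x). G t x)" and t: "t \<in> time_interval T"
  shows "curl (G t) x $ 1 = deriv1 T (\<lambda>(t, x). G t x) (t, x) (0, axis 2 1) $ 3 - deriv1 T (\<lambda>(t, x). G t x) (t, x) (0, axis 3 1) $ 2"
    "curl (G t) x $ 2 = deriv1 T (\<lambda>(t, x). G t x) (t, x) (0, axis 3 1) $ 1 - deriv1 T (\<lambda>(t, x). G t x) (t, x) (0, axis 1 1) $ 3"
    "curl (G t) x $ 3 = deriv1 T (\<lambda>(t, x). G t x) (t, x) (0, axis 1 1) $ 2 - deriv1 T (\<lambda>(t, x). G t x) (t, x) (0, axis 2 1) $ 1"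
  using partial_slice[OF deriv2(4)[OF C t] t] by (simp_all add: curl_def)

end

lemma DERIV_unique_on_open:
  assumes "(F has_real_derivative a) (at (r::real))" "(G has_real_derivative b) (at r)"
    "open S" "r \<in> S" "\<And>q. q \<in> S \<Longrightarrow> F q = G q"
  shows "a = b"
  using DERIV_unique[OF has_field_derivative_transform_within_open[OF assms(1,3,4,5)] assms(2)] by blast

lemma DERIV_deriv1_time:
  fixes G :: "real \<times> (real^3) \<Rightarrow> real^3"
  assumes G: "Ck_on 2 (time_interval T \<times> UNIV) G" and r: "0 < r" "r \<in> time_interval T"
  shows "((\<lambda>q. deriv1 T G (q, y) h $ i) has_real_derivative deriv2 T G (r, y) h (1, 0) $ i) (at r)"
proof -
  have "((\<lambda>q. (q, y)) has_derivative (\<lambda>t. t *\<^sub>R (1, 0))) (at r)"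
    by (auto intro!: derivative_eq_intros)
  note D = has_derivative_compose[OF this deriv2_at(2)[OF G r]]
  show ?thesis
    using bounded_linear.has_derivative[OF bounded_linear_vec_nth D]
    by (simp only: has_field_derivative_def linear_scale[OF has_derivative_linear[OF deriv2_at(2)[OF G r]]]
        vector_scaleR_component real_scaleR_def mult.commute[of _ "deriv2 _ _ _ _ _ $ _"])
qed

lemma DERIV_deriv1_space:
  fixes G :: "real \<times> (real^3) \<Rightarrow> real^3"
  assumes G: "Ck_on 2 (time_interval T \<times> UNIV) G" and r: "0 < r" "r \<in> time_interval T"
  shows "((\<lambda>q. deriv1 T G (r, y + q *\<^sub>R e) h $ i) has_real_derivative deriv2 T G (r, y) h (0, e) $ i) (at 0)"
proof -
  have L: "((\<lambda>q. (r, y + q *\<^sub>R e)) has_derivative (\<lambda>t. t *\<^sub>R (0, e))) (at 0)"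
    by (auto intro!: derivative_eq_intros)
  have "((\<lambda>z. deriv1 T G z h) has_derivative deriv2 T G (r, y) h) (at (r, y + 0 *\<^sub>R e))"
    using deriv2_at(2)[OF G r] by simp
  note D = has_derivative_compose[OF L this]
  show ?thesis
    using bounded_linear.has_derivative[OF bounded_linear_vec_nth D]
    by (simp only: has_field_derivative_def linear_scale[OF has_derivative_linear[OF deriv2_at(2)[OF G r]]]
        vector_scaleR_component real_scaleR_def mult.commute[of _ "deriv2 _ _ _ _ _ $ _"])
qed

text \<open>
  Up to the time \<open>t1\<close> and in the ball of radius \<open>R\<close>, all momenta in the support of \<open>f\<close> have norm at most \<open>P\<close>.
  The bound has to hold in a neighbourhood of the points considered, because the density and the current
  are differentiated in time and space.
\<close>

locale rvm_region = rvm_solution +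
  fixes t1 R P :: real
  assumes t1: "ereal t1 < T"
    and support: "\<And>r y \<xi>. r \<in> {0..t1} \<Longrightarrow> norm y \<le> R \<Longrightarrow> norm \<xi> > P \<Longrightarrow> f r y \<xi> = 0"
begin

lemma in_time_interval: "0 \<le> r \<Longrightarrow> r \<le> t1 \<Longrightarrow> r \<in> time_interval T"
  using t1 by (auto simp: time_interval_def intro: le_less_trans[of "ereal r" "ereal t1"])

lemma df_at:
  assumes "0 < r" "r \<le> t1"
  shows "(f_st has_derivative df (r, z)) (at (r, z))"
  using df[OF in_time_interval, of r z] at_within_time_interval[OF _ in_time_interval, of r z] assms by simp

lemma momentum_ball: "compact (cball 0 P :: (real^3) set)" "emeasure lborel (cball 0 P :: (real^3) set) < \<infinity>"
  using emeasure_bounded_finite[OF bounded_cball] by auto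

lemma continuous_on_f_slice:
  assumes "r \<in> {0..t1}"
  shows "continuous_on S (f r y)"
proof -
  have "continuous_on S (\<lambda>\<xi>. f_st (r, y, \<xi>))"
    by (rule continuous_on_compose2[OF f_cont])
       (use in_time_interval assms in \<open>auto intro!: continuous_intros\<close>)
  then show ?thesis by simp
qed

lemma density_integral:
  assumes "r \<in> {0..t1}" "norm y \<le> R"
  shows "(\<integral>\<xi>. f r y \<xi> \<partial>lborel) = (LINT \<xi>:cball 0 P|lborel. f r y \<xi>)"
  unfolding set_lebesgue_integral_def
  by (rule Bochner_Integration.integral_cong) (use support[OF assms] in \<open>auto simp: indicator_def not_le\<close>)

lemma current_integral:
  assumes "r \<in> {0..t1}" "norm y \<le> R"
  shows "(\<integral>\<xi>. f r y \<xi> *\<^sub>R nu \<xi> \<partial>lborel) \<bullet> v = (LINT \<xi>:cball 0 P|lborel. (v \<bullet> nu \<xi>) * f r y \<xi>)"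
proof -
  have eq: "f r y \<xi> *\<^sub>R nu \<xi> = indicator (cball 0 P) \<xi> *\<^sub>R (f r y \<xi> *\<^sub>R nu \<xi>)" for \<xi>
    using support[OF assms, of \<xi>] by (cases "norm \<xi> \<le> P") auto
  have "integrable lborel (\<lambda>\<xi>. indicator (cball 0 P) \<xi> *\<^sub>R (f r y \<xi> *\<^sub>R nu \<xi>))"
    by (intro borel_integrable_compact continuous_intros continuous_on_f_slice assms) auto
  then have "integrable lborel (\<lambda>\<xi>. f r y \<xi> *\<^sub>R nu \<xi>)" by (simp only: eq[symmetric])
  then have "(\<integral>\<xi>. f r y \<xi> *\<^sub>R nu \<xi> \<partial>lborel) \<bullet> v = (\<integral>\<xi>. (f r y \<xi> *\<^sub>R nu \<xi>) \<bullet> v \<partial>lborel)"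
    by (intro integral_inner_left[symmetric])
  also have "\<dots> = (LINT \<xi>:cball 0 P|lborel. (v \<bullet> nu \<xi>) * f r y \<xi>)"
    unfolding set_lebesgue_integral_def
  proof (rule Bochner_Integration.integral_cong)
    fix \<xi>
    show "(f r y \<xi> *\<^sub>R nu \<xi>) \<bullet> v = indicator (cball 0 P) \<xi> *\<^sub>R ((v \<bullet> nu \<xi>) * f r y \<xi>)"
      using support[OF assms, of \<xi>] by (cases "norm \<xi> \<le> P") (auto simp: inner_commute)
  qed simp
  finally show ?thesis .
qed

lemma DERIV_current:
  assumes r: "0 < r" "r < t1"
  shows "((\<lambda>q. LINT \<xi>:cball 0 P|lborel. (v \<bullet> nu \<xi>) * f q y \<xi>) has_real_derivative
     (LINT \<xi>:cball 0 P|lborel. (v \<bullet> nu \<xi>) * df (r, y, \<xi>) (1, 0, 0))) (at r)"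
proof (rule DERIV_set_integral[OF _ momentum_ball])
  fix q and \<xi> :: "real^3" assume q: "q \<in> {0<..<t1}"
  have "((\<lambda>q. (q, y, \<xi>)) has_derivative (\<lambda>t. t *\<^sub>R (1, 0, 0))) (at q)"
    by (auto intro!: derivative_eq_intros simp: zero_prod_def)
  from has_derivative_compose[OF this df_at[of q "(y, \<xi>)"]]
  have "((\<lambda>q. f q y \<xi>) has_real_derivative df (q, y, \<xi>) (1, 0, 0)) (at q)"
    using linear_scale[OF has_derivative_linear[OF df_at[of q "(y, \<xi>)"]]] q
    by (simp only: has_field_derivative_def real_scaleR_def mult.commute[of _ "df _ _"]
        greaterThanLessThan_iff prod.case less_imp_le)
  then show "((\<lambda>q. (v \<bullet> nu \<xi>) * f q y \<xi>) has_real_derivative (v \<bullet> nu \<xi>) * df (q, y, \<xi>) (1, 0, 0)) (at q)"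
    by (rule DERIV_cmult)
  show "continuous_on (cball 0 P) (\<lambda>\<xi>. (v \<bullet> nu \<xi>) * f q y \<xi>)"
    using q by (intro continuous_intros continuous_on_f_slice) auto
next
  show "continuous_on ({0<..<t1} \<times> cball 0 P) (\<lambda>(q, \<xi>). (v \<bullet> nu \<xi>) * df (q, y, \<xi>) (1, 0, 0))"
  proof -
    have "continuous_on ({0<..<t1} \<times> cball 0 P) (\<lambda>p. (v \<bullet> nu (snd p)) * df (fst p, y, snd p) (1, 0, 0))"
      by (intro continuous_intros continuous_on_compose2[OF df_cont])
         (auto intro!: in_time_interval continuous_intros)
    then show ?thesis unfolding case_prod_beta .
  qed
qed (use r in auto)

lemma DERIV_density:
  assumes r: "0 < r" "r \<le> t1"
  shows "((\<lambda>q. LINT \<xi>:cball 0 P|lborel. f r (y + q *\<^sub>R e) \<xi>) has_real_derivative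
     (LINT \<xi>:cball 0 P|lborel. df (r, y + 0 *\<^sub>R e, \<xi>) (0, e, 0))) (at 0)"
proof (rule DERIV_set_integral[OF _ momentum_ball, where a="-1" and b=1
      and g'="\<lambda>q \<xi>. df (r, y + q *\<^sub>R e, \<xi>) (0, e, 0)"])
  fix q and \<xi> :: "real^3"
  have "((\<lambda>q. (r, y + q *\<^sub>R e, \<xi>)) has_derivative (\<lambda>t. t *\<^sub>R (0, e, 0))) (at q)"
    by (auto intro!: derivative_eq_intros)
  from has_derivative_compose[OF this df_at[of r "(y + q *\<^sub>R e, \<xi>)"]]
  show "((\<lambda>q. f r (y + q *\<^sub>R e) \<xi>) has_real_derivative df (r, y + q *\<^sub>R e, \<xi>) (0, e, 0)) (at q)"
    using linear_scale[OF has_derivative_linear[OF df_at[of r "(y + q *\<^sub>R e, \<xi>)"]]] r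
    by (simp only: has_field_derivative_def real_scaleR_def mult.commute[of _ "df _ _"] prod.case)
  show "continuous_on (cball 0 P) (\<lambda>\<xi>. f r (y + q *\<^sub>R e) \<xi>)"
    using r by (intro continuous_on_f_slice) auto
next
  show "continuous_on ({-1<..<1} \<times> cball 0 P) (\<lambda>(q, \<xi>). df (r, y + q *\<^sub>R e, \<xi>) (0, e, 0))"
  proof -
    have "continuous_on ({-1<..<1} \<times> cball 0 P) (\<lambda>p. df (r, y + fst p *\<^sub>R e, snd p) (0, e, 0))"
      by (intro continuous_on_compose2[OF df_cont])
         (use r in \<open>auto intro!: continuous_intros in_time_interval\<close>)
    then show ?thesis unfolding case_prod_beta .
  qed
qed auto

lemma ampere_derivative:
  assumes r: "0 < r" "r < t1" and y: "norm y \<le> R"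
  shows "d2E (r, y) (1, 0) (1, 0) $ 1 = d2B (r, y) (0, axis 2 1) (1, 0) $ 3
      - d2B (r, y) (0, axis 3 1) (1, 0) $ 2
      - (LINT \<xi>:cball 0 P|lborel. (axis 1 1 \<bullet> nu \<xi>) * df (r, y, \<xi>) (1, 0, 0))" (is ?P1)
    "d2E (r, y) (1, 0) (1, 0) $ 2 = d2B (r, y) (0, axis 3 1) (1, 0) $ 1
      - d2B (r, y) (0, axis 1 1) (1, 0) $ 3
      - (LINT \<xi>:cball 0 P|lborel. (axis 2 1 \<bullet> nu \<xi>) * df (r, y, \<xi>) (1, 0, 0))" (is ?P2)
    "d2E (r, y) (1, 0) (1, 0) $ 3 = d2B (r, y) (0, axis 1 1) (1, 0) $ 2
      - d2B (r, y) (0, axis 2 1) (1, 0) $ 1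
      - (LINT \<xi>:cball 0 P|lborel. (axis 3 1 \<bullet> nu \<xi>) * df (r, y, \<xi>) (1, 0, 0))" (is ?P3)
proof -
  have r': "r \<in> time_interval T" using r by (intro in_time_interval) auto
  note D = DERIV_deriv1_time[OF _ r(1) r']
  have M: "dE (q, y) (1, 0) $ i = curl (B q) y $ i - (LINT \<xi>:cball 0 P|lborel. (axis i 1 \<bullet> nu \<xi>) * f q y \<xi>)"
    "curl (B q) y $ 1 = deriv1 T B_st (q, y) (0, axis 2 1) $ 3 - deriv1 T B_st (q, y) (0, axis 3 1) $ 2"
    "curl (B q) y $ 2 = deriv1 T B_st (q, y) (0, axis 3 1) $ 1 - deriv1 T B_st (q, y) (0, axis 1 1) $ 3"
    "curl (B q) y $ 3 = deriv1 T B_st (q, y) (0, axis 1 1) $ 2 - deriv1 T B_st (q, y) (0, axis 2 1) $ 1"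
    if "q \<in> {0<..<t1}" for q i
  proof -
    have q: "q \<in> time_interval T" using that by (intro in_time_interval) auto
    show "dE (q, y) (1, 0) $ i = curl (B q) y $ i - (LINT \<xi>:cball 0 P|lborel. (axis i 1 \<bullet> nu \<xi>) * f q y \<xi>)"
      using current_integral[of q y "axis i 1"] that y
      by (simp add: maxwell(1)[OF q] inner_axis)
  qed (use that in \<open>auto intro!: curl_slice[OF B] in_time_interval\<close>)
  show ?P1 ?P2 ?P3
    by (rule DERIV_unique_on_open[OF D[OF E] DERIV_diff[OF DERIV_diff[OF D[OF B] D[OF B]] DERIV_current[OF r]],
          of "{0<..<t1}"]; use r M in auto)+
qed

lemma faraday_derivative:
  assumes r: "0 < r" "r \<le> t1"
  shows "d2B (r, y) (1, 0) (0, e) $ 1 =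
           d2E (r, y) (0, axis 3 1) (0, e) $ 2 - d2E (r, y) (0, axis 2 1) (0, e) $ 3" (is ?P1)
    "d2B (r, y) (1, 0) (0, e) $ 2 =
           d2E (r, y) (0, axis 1 1) (0, e) $ 3 - d2E (r, y) (0, axis 3 1) (0, e) $ 1" (is ?P2)
    "d2B (r, y) (1, 0) (0, e) $ 3 =
           d2E (r, y) (0, axis 2 1) (0, e) $ 1 - d2E (r, y) (0, axis 1 1) (0, e) $ 2" (is ?P3)
proof -
  have r': "r \<in> time_interval T" using r by (intro in_time_interval) auto
  note D = DERIV_deriv1_space[OF _ r(1) r']
  note M = maxwell(2)[OF r'] curl_slice[OF E r']
  show ?P1 ?P2 ?P3
    by (rule DERIV_unique_on_open[OF D[OF B] DERIV_diff[OF D[OF E] D[OF E]], of UNIV]; simp add: M)+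
qed

lemma gauss_derivative:
  assumes r: "0 < r" "r \<le> t1" and y: "norm y < R"
  shows "d2E (r, y) (0, axis 1 1) (0, e) $ 1 + d2E (r, y) (0, axis 2 1) (0, e) $ 2
      + d2E (r, y) (0, axis 3 1) (0, e) $ 3
     = (LINT \<xi>:cball 0 P|lborel. df (r, y, \<xi>) (0, e, 0)) - e \<bullet> grad \<rho> y"
proof -
  have r': "r \<in> time_interval T" using r by (intro in_time_interval) auto
  note D = DERIV_deriv1_space[OF E r(1) r']
  have D\<rho>: "((\<lambda>q. \<rho> (y + q *\<^sub>R e)) has_real_derivative e \<bullet> grad \<rho> y) (at 0)"
  proof -
    have "((\<lambda>q. y + q *\<^sub>R e) has_derivative (\<lambda>t. t *\<^sub>R e)) (at 0)"
      by (auto intro!: derivative_eq_intros)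
    from has_derivative_compose[OF this, of \<rho> "\<lambda>h. h \<bullet> grad \<rho> y"] grad_rho[of "y + 0 *\<^sub>R e"]
    show ?thesis by (simp add: has_field_derivative_def mult_commute_abs)
  qed
  have S: "open {q. norm (y + q *\<^sub>R e) < R}" by (intro open_Collect_less continuous_intros)
  have "d2E (r, y) (0, axis 1 1) (0, e) $ 1 + d2E (r, y) (0, axis 2 1) (0, e) $ 2
      + d2E (r, y) (0, axis 3 1) (0, e) $ 3
     = (LINT \<xi>:cball 0 P|lborel. df (r, y + 0 *\<^sub>R e, \<xi>) (0, e, 0)) - e \<bullet> grad \<rho> y"
  proof (rule DERIV_unique_on_open[OF DERIV_add[OF DERIV_add[OF D D] D] DERIV_diff[OF DERIV_density[OF r] D\<rho>] S])
    show "0 \<in> {q. norm (y + q *\<^sub>R e) < R}" using y by simp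
    fix q assume q: "q \<in> {q. norm (y + q *\<^sub>R e) < R}"
    show "dE (r, y + q *\<^sub>R e) (0, axis 1 1) $ 1 + dE (r, y + q *\<^sub>R e) (0, axis 2 1) $ 2
        + dE (r, y + q *\<^sub>R e) (0, axis 3 1) $ 3
      = (LINT \<xi>:cball 0 P|lborel. f r (y + q *\<^sub>R e) \<xi>) - \<rho> (y + q *\<^sub>R e)"
      using maxwell(3)[OF r', of "y + q *\<^sub>R e"] density_integral[of r "y + q *\<^sub>R e"] q r
      by (simp add: sum_3)
  qed
  then show ?thesis by simp
qed

text \<open>
  In components, \<open>curl (curl E) = \<nabla> (div E) - \<Delta> E\<close>, where the derivatives of the Maxwell equations are
  rearranged by symmetry of second derivatives. The two moments of \<open>f\<close> combine to the integral of a single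
  directional derivative of \<open>f\<close>.
\<close>

lemma wave_equation:
  assumes r: "0 < r" "r < t1" and y: "norm y < R"
  shows "v \<bullet> d2E (r, y) (1, 0) (1, 0)
      - (\<Sum>i\<in>UNIV. v \<bullet> d2E (r, y) (0, axis i 1) (0, axis i 1))
    = v \<bullet> grad \<rho> y - (LINT \<xi>:cball 0 P|lborel. df (r, y, \<xi>) (v \<bullet> nu \<xi>, v, 0))"
proof -
  have r': "r \<in> time_interval T" "r \<le> t1" using r by (auto intro: in_time_interval)
  define J where "J i = (LINT \<xi>:cball 0 P|lborel. (axis i 1 \<bullet> nu \<xi>) * df (r, y, \<xi>) (1, 0, 0))" for i :: 3
  define N where "N i = (LINT \<xi>:cball 0 P|lborel. df (r, y, \<xi>) (0, axis i 1, 0))" for i :: 3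
  have c: "continuous_on (cball 0 P) (\<lambda>\<xi>. df (r, y, \<xi>) h)" for h
    by (rule continuous_on_compose2[OF df_cont]) (use r'(1) in \<open>auto intro!: continuous_intros\<close>)
  have iJ: "set_integrable lborel (cball 0 P) (\<lambda>\<xi>. (axis i 1 \<bullet> nu \<xi>) * df (r, y, \<xi>) (1, 0, 0))" for i :: 3
    by (intro set_integrable_continuous_compact momentum_ball continuous_intros c) auto
  have iN: "set_integrable lborel (cball 0 P) (\<lambda>\<xi>. df (r, y, \<xi>) (0, axis i 1, 0))" for i :: 3
    by (intro set_integrable_continuous_compact momentum_ball c) auto
  have "df (r, y, \<xi>) (v \<bullet> nu \<xi>, v, 0) =
      v $ 1 * ((axis 1 1 \<bullet> nu \<xi>) * df (r, y, \<xi>) (1, 0, 0) + df (r, y, \<xi>) (0, axis 1 1, 0))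
    + v $ 2 * ((axis 2 1 \<bullet> nu \<xi>) * df (r, y, \<xi>) (1, 0, 0) + df (r, y, \<xi>) (0, axis 2 1, 0))
    + v $ 3 * ((axis 3 1 \<bullet> nu \<xi>) * df (r, y, \<xi>) (1, 0, 0) + df (r, y, \<xi>) (0, axis 3 1, 0))" for \<xi>
  proof -
    let ?L = "df (r, y, \<xi>)"
    have lin: "linear ?L" using df[OF r'(1)] by (rule has_derivative_linear)
    have l2: "linear (\<lambda>h. ?L (0, h, 0))"
      using linear_add[OF lin, of "(0, _, 0)" "(0, _, 0)"] linear_scale[OF lin, of _ "(0, _, 0)"]
      by (intro linearI) simp_all
    have "?L (v \<bullet> nu \<xi>, v, 0) = ?L ((v \<bullet> nu \<xi>) *\<^sub>R (1, 0, 0) + (0, v, 0))" by simp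
    also have "\<dots> = (v \<bullet> nu \<xi>) * ?L (1, 0, 0) + ?L (0, v, 0)"
      unfolding linear_add[OF lin] linear_scale[OF lin] by simp
    finally have 1: "?L (v \<bullet> nu \<xi>, v, 0) = (v \<bullet> nu \<xi>) * ?L (1, 0, 0) + ?L (0, v, 0)" .
    have 2: "v \<bullet> nu \<xi> = v $ 1 * (axis 1 1 \<bullet> nu \<xi>) + v $ 2 * (axis 2 1 \<bullet> nu \<xi>) + v $ 3 * (axis 3 1 \<bullet> nu \<xi>)"
      by (simp add: inner_vec_def[of v] sum_3 inner_axis')
    have 3: "?L (0, v, 0) = v $ 1 * ?L (0, axis 1 1, 0) + v $ 2 * ?L (0, axis 2 1, 0) + v $ 3 * ?L (0, axis 3 1, 0)"
      by (subst linear_eq_sum_axis[OF l2]) (simp add: sum_3)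
    show ?thesis unfolding 1 3 by (simp add: 2 algebra_simps)
  qed
  then have S: "(LINT \<xi>:cball 0 P|lborel. df (r, y, \<xi>) (v \<bullet> nu \<xi>, v, 0)) =
      v $ 1 * (J 1 + N 1) + v $ 2 * (J 2 + N 2) + v $ 3 * (J 3 + N 3)"
    unfolding J_def N_def by (simp add: set_integral_add iJ iN)
  have symE: "d2E (r, y) h k = d2E (r, y) k h" for h k
    by (rule deriv2_symmetric[OF E r(1) r'(1)])
  have symB: "d2B (r, y) (0, h) (1, 0) = d2B (r, y) (1, 0) (0, h)" for h
    by (rule deriv2_symmetric[OF B r(1) r'(1)])
  note A = ampere_derivative[OF r less_imp_le[OF y], folded J_def, unfolded symB faraday_derivative[OF r(1) r'(2)]]
  have g: "N i = d2E (r, y) (0, axis i 1) (0, axis 1 1) $ 1 + d2E (r, y) (0, axis i 1) (0, axis 2 1) $ 2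
      + d2E (r, y) (0, axis i 1) (0, axis 3 1) $ 3 + grad \<rho> y $ i" for i
    using gauss_derivative[OF r(1) r'(2) y, of "axis i 1", folded N_def]
    by (simp add: symE[of "(0, axis i 1)"] inner_axis')
  show ?thesis
    unfolding S
    unfolding inner_vec_def[of v] sum_3 A g
    unfolding symE[of "(0, axis 2 1)" "(0, axis 1 1)"] symE[of "(0, axis 3 1)" "(0, axis 1 1)"]
      symE[of "(0, axis 3 1)" "(0, axis 2 1)"]
    by (simp add: algebra_simps)
qed

end

section \<open>Representation of the electric field\<close>

lemma set_integral_cong_interior:
  fixes F G :: "real \<Rightarrow> real"
  assumes "continuous_on {a..b} F" "continuous_on {a..b} G" "\<And>r. r \<in> {a<..<b} \<Longrightarrow> F r = G r"
  shows "(LINT r:{a..b}|lborel. F r) = (LINT r:{a..b}|lborel. G r)"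
proof -
  have "set_integrable lborel {a..b} F" "set_integrable lborel {a..b} G"
    using assms(1,2) by (auto intro: borel_integrable_atLeastAtMost')
  moreover have "AE r in lborel. indicator {a..b} r *\<^sub>R F r = indicator {a..b} r *\<^sub>R G r"
    using AE_lborel_singleton[of a] AE_lborel_singleton[of b]
    by eventually_elim (use assms(3) in \<open>auto simp: indicator_def\<close>)
  ultimately show ?thesis
    unfolding set_integrable_def set_lebesgue_integral_def
    by (intro integral_cong_AE borel_measurable_integrable)
qed

locale rvm_wave = rvm_region +
  fixes Eh :: "real \<Rightarrow> real^3 \<Rightarrow> real^3"
  assumes Eh: "homogeneous_wave T (E 0) (B 0) Eh" and t1_pos: "0 < t1"
begin

lemma Eh_C2: "Ck_on 2 (time_interval T \<times> UNIV) (\<lambda>(t, x). Eh t x)"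
  using Eh by (simp add: homogeneous_wave_def)

abbreviation "Eh_st \<equiv> (\<lambda>(t, x). Eh t x)"

lemma Eh_wave:
  assumes t: "t \<in> time_interval T"
  shows "deriv2 T Eh_st (t, x) (1, 0) (1, 0) = (\<Sum>i\<in>UNIV. deriv2 T Eh_st (t, x) (0, axis i 1) (0, axis i 1))"
  using Eh t wave_operator_slice[OF Eh_C2 t, of x] by (simp add: homogeneous_wave_def)

lemma zero_in_time_interval: "0 \<in> time_interval T"
  using t1_pos by (intro in_time_interval) auto

lemma Eh_initial:
  "deriv1 T Eh_st (0, x) (1, 0) = curl (B 0) x"
  "deriv1 T Eh_st (0, x) (0, axis i 1) = dE (0, x) (0, axis i 1)"
proof -
  note z = zero_in_time_interval
  show "deriv1 T Eh_st (0, x) (1, 0) = curl (B 0) x"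
    using time_deriv_slice[OF deriv2(4)[OF Eh_C2 z] z, of x] Eh by (simp add: homogeneous_wave_def)
  have "Eh 0 = E 0" using Eh by (auto simp: homogeneous_wave_def)
  then show "deriv1 T Eh_st (0, x) (0, axis i 1) = dE (0, x) (0, axis i 1)"
    using partial_slice[OF deriv2(4)[OF Eh_C2 z] z, of i x] partial_slice[OF deriv2(4)[OF E z] z, of i x] by simp
qed

text \<open>
  Kirchhoff's formula for \<open>u = v \<bullet> (E - Eh)\<close>. Only the time derivative of \<open>u\<close> contributes at \<open>r = 0\<close>: it is
  \<open>- v \<bullet> j\<close>, and it cancels the current that \<open>integral_source\<close> produces there, so that the full quotient
  \<open>ratio\<close> remains in front of the initial density.
\<close>

lemma electric_field:
  fixes v x :: "real^3"
  assumes s: "0 \<le> s" "s < t1" and x: "norm x + s < R"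
  shows "4 * pi * (v \<bullet> E s x) = 4 * pi * (v \<bullet> Eh s x)
    - s * (LINT \<omega>:sphere 0 1|sphere_measure. LINT \<xi>:cball 0 P|lborel.
            ratio v \<omega> (nu \<xi>) * f 0 (x + s *\<^sub>R \<omega>) \<xi>)
    - (LINT r:{0..s}|lborel. LINT \<omega>:sphere 0 1|sphere_measure. LINT \<xi>:cball 0 P|lborel.
            tangential_kernel v \<omega> (nu \<xi>) * f r (x + (s - r) *\<^sub>R \<omega>) \<xi>)
    - (LINT r:{0..s}|lborel. LINT \<omega>:sphere 0 1|sphere_measure. LINT \<xi>:cball 0 P|lborel.
            (s - r) * ratio_deriv v \<omega> (nu \<xi>) (nu_deriv \<xi> (lorentz_force E B r (x + (s - r) *\<^sub>R \<omega>) \<xi>))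
              * f r (x + (s - r) *\<^sub>R \<omega>) \<xi>)
    + (LINT r:{0..s}|lborel. LINT \<omega>:sphere 0 1|sphere_measure.
            (s - r) * (v \<bullet> grad \<rho> (x + (s - r) *\<^sub>R \<omega>)))"
proof -
  let ?S = "sphere 0 1 :: (real^3) set" and ?C = "cball 0 P :: (real^3) set"
  let ?I = "{0..s} \<times> (UNIV :: (real^3) set)"
  have sph: "compact ?S" "emeasure sphere_measure ?S < \<infinity>" by (auto simp: sphere_finite[simplified])
  have I: "?I \<subseteq> time_interval T \<times> UNIV" using s by (auto intro: in_time_interval)
  have I2: "{0..s} \<times> UNIV \<times> UNIV \<subseteq> time_interval T \<times> UNIV" using s by (auto intro: in_time_interval)
  have tI: "r \<in> time_interval T" if "0 \<le> r" "r \<le> s" for r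
    using that s by (intro in_time_interval) auto
  have near: "norm y < R" if "dist x y \<le> s" for y
    using norm_triangle_ineq[of x "y - x"] that x by (simp add: dist_norm norm_minus_commute)
  interpret L: vlasov_cone s P x f_st df E B
  proof (rule vlasov_cone.intro)
    show "continuous_on ({0..s} \<times> UNIV \<times> UNIV) f_st" by (rule continuous_on_subset[OF f_cont I2])
    show "continuous_on ({0..s} \<times> UNIV \<times> UNIV) (\<lambda>z. df z h)" for h
      by (rule continuous_on_subset[OF df_cont I2])
    show "linear (df z)" if "z \<in> {0..s} \<times> UNIV \<times> UNIV" for z
      using has_derivative_linear[OF df[of "fst z" "snd z"]] that I2 by auto
    show "(f_st has_derivative df z) (at z)" if "z \<in> {0<..<s} \<times> UNIV \<times> UNIV" for z
      using df_at[of "fst z" "snd z"] that s by (cases z) simp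
    show "continuous_on ?I E_st" "continuous_on ?I B_st"
      using deriv2(1)[OF E] deriv2(1)[OF B] I by (auto intro: continuous_on_subset)
    show "df (r, y, \<xi>) (1, nu \<xi>, lorentz_force E B r y \<xi>) = 0" if "r \<in> {0<..<s}" for r y \<xi>
      using that by (intro vlasov_eq tI) auto
    show "f_st (r, y, \<xi>) = 0" if "r \<in> {0..s}" "dist x y \<le> s" "norm \<xi> > P" for r y \<xi>
      using support[of r y \<xi>] near[of y] that s by simp
  qed (rule s)
  define u where "u z = v \<bullet> (E_st z - Eh_st z)" for z
  define du where "du z h = v \<bullet> (dE z h - deriv1 T Eh_st z h)" for z h
  define d2 where "d2 z h k = v \<bullet> (d2E z h k - deriv2 T Eh_st z h k)" for z h k
  have uc: "continuous_on ?I u" unfolding u_def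
    by (intro continuous_intros continuous_on_subset[OF deriv2(1)[OF E] I] continuous_on_subset[OF deriv2(1)[OF Eh_C2] I])
  have duc: "continuous_on ?I (\<lambda>z. du z h)" for h unfolding du_def
    by (intro continuous_intros continuous_on_subset[OF deriv2(2)[OF E] I] continuous_on_subset[OF deriv2(2)[OF Eh_C2] I])
  have d2c: "continuous_on ?I (\<lambda>z. d2 z h k)" for h k unfolding d2_def
    by (intro continuous_intros continuous_on_subset[OF deriv2(3)[OF E] I] continuous_on_subset[OF deriv2(3)[OF Eh_C2] I])
  have D: "(G has_derivative deriv1 T G z) (at z)" "((\<lambda>z. deriv1 T G z h) has_derivative deriv2 T G z h) (at z)"
    if G: "Ck_on 2 (time_interval T \<times> UNIV) G" and z: "z \<in> {0<..<s} \<times> UNIV" for G :: "real \<times> (real^3) \<Rightarrow> real^3" and z h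
    using deriv2_at(1)[OF G, where t="fst z" and x="snd z"] deriv2_at(2)[OF G, where t="fst z" and x="snd z" and h=h] tI[of "fst z"] z
    unfolding prod.collapse by (simp_all add: mem_Times_iff del: split_paired_All)
  have cone: "norm (x + (s - r) *\<^sub>R \<omega>) < R" if "r \<in> {0..s}" "\<omega> \<in> ?S" for r \<omega>
    using that by (intro near) (simp add: dist_norm)
  have uD: "(u has_derivative du z) (at z)" if "z \<in> {0<..<s} \<times> UNIV" for z
    unfolding u_def du_def using D(1)[OF E that] D(1)[OF Eh_C2 that]
    by (intro has_derivative_inner_right has_derivative_diff)
  have duD: "((\<lambda>z. du z h) has_derivative d2 z h) (at z)" if "z \<in> {0<..<s} \<times> UNIV" for z h
    unfolding du_def d2_def using D(2)[OF E that] D(2)[OF Eh_C2 that]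
    by (intro has_derivative_inner_right has_derivative_diff)
  have "4 * pi * u (s, x) =
      (LINT \<omega>:?S|sphere_measure. u (0, x + s *\<^sub>R \<omega>) +
          s * (du (0, x + s *\<^sub>R \<omega>) (1, 0) + (\<Sum>i\<in>UNIV. \<omega> $ i * du (0, x + s *\<^sub>R \<omega>) (0, axis i 1))))
    + (LINT r:{0..s}|lborel. LINT \<omega>:?S|sphere_measure. (s - r) *
          (d2 (r, x + (s - r) *\<^sub>R \<omega>) (1, 0) (1, 0)
            - (\<Sum>i\<in>UNIV. d2 (r, x + (s - r) *\<^sub>R \<omega>) (0, axis i 1) (0, axis i 1))))"
    by (rule kirchhoff[OF s(1) uc duc d2c uD duD])
  also have "(LINT \<omega>:?S|sphere_measure. u (0, x + s *\<^sub>R \<omega>) +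
          s * (du (0, x + s *\<^sub>R \<omega>) (1, 0) + (\<Sum>i\<in>UNIV. \<omega> $ i * du (0, x + s *\<^sub>R \<omega>) (0, axis i 1))))
      = (LINT \<omega>:?S|sphere_measure. - s * (LINT \<xi>:?C|lborel. (v \<bullet> nu \<xi>) * f 0 (x + s *\<^sub>R \<omega>) \<xi>))"
  proof (intro set_lebesgue_integral_cong allI impI)
    show "?S \<in> sets sphere_measure" by (simp add: borel_closed)
    fix \<omega> assume \<omega>: "\<omega> \<in> ?S"
    let ?y = "x + s *\<^sub>R \<omega>"
    have "Eh 0 ?y = E 0 ?y" using Eh by (simp add: homogeneous_wave_def)
    moreover have "norm ?y \<le> R" using cone[of 0 \<omega>] \<omega> s by simp
    ultimately show "u (0, ?y) + s * (du (0, ?y) (1, 0) + (\<Sum>i\<in>UNIV. \<omega> $ i * du (0, ?y) (0, axis i 1)))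
      = - s * (LINT \<xi>:?C|lborel. (v \<bullet> nu \<xi>) * f 0 ?y \<xi>)"
      using current_integral[of 0 ?y v] t1_pos
      by (simp add: u_def du_def Eh_initial maxwell(1)[OF zero_in_time_interval] inner_commute)
  qed
  also have "\<dots> = - s * L.dint (\<lambda>\<omega> \<xi>. (v \<bullet> nu \<xi>) * f 0 (x + s *\<^sub>R \<omega>) \<xi>)"
    unfolding L.dint_def by (rule set_integral_mult_right)
  also have "(LINT r:{0..s}|lborel. LINT \<omega>:?S|sphere_measure. (s - r) *
          (d2 (r, x + (s - r) *\<^sub>R \<omega>) (1, 0) (1, 0)
            - (\<Sum>i\<in>UNIV. d2 (r, x + (s - r) *\<^sub>R \<omega>) (0, axis i 1) (0, axis i 1)))) =
      (LINT r:{0..s}|lborel. LINT \<omega>:?S|sphere_measure. (s - r) * (v \<bullet> grad \<rho> (x + (s - r) *\<^sub>R \<omega>)))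
      - (LINT r:{0..s}|lborel. L.dint (\<lambda>\<omega> \<xi>. (s - r) * df (L.cone_point r \<omega> \<xi>) (v \<bullet> nu \<xi>, v, 0)))"
    (is "(LINT r:{0..s}|lborel. ?F r) = (LINT r:{0..s}|lborel. ?G r) - (LINT r:{0..s}|lborel. ?H r)")
  proof -
    note cc = continuous_on_cone[where x=x and K="?S", unfolded case_prod_beta]
    have Fc: "continuous_on {0..s} ?F"
      by (rule continuous_on_set_integral[OF _ sph compact_Icc])
         (simp, unfold case_prod_beta, intro continuous_intros cc d2c)
    have gr: "continuous_on ({0..s} \<times> ?S) (\<lambda>(r, \<omega>). (s - r) * (v \<bullet> grad \<rho> (x + (s - r) *\<^sub>R \<omega>)))"
      unfolding case_prod_beta
      by (intro continuous_intros continuous_on_compose2[OF continuous_on_grad_rho]) auto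
    have Gc: "continuous_on {0..s} ?G"
      by (rule continuous_on_set_integral[OF _ sph compact_Icc gr]) simp
    have Hc: "continuous_on {0..s} ?H"
      by (rule L.continuous_on_dint[OF compact_Icc L.continuous_on_source])
    have "(LINT r:{0..s}|lborel. ?F r) = (LINT r:{0..s}|lborel. ?G r - ?H r)"
    proof (rule set_integral_cong_interior[OF Fc continuous_on_diff[OF Gc Hc]])
      fix r assume r: "r \<in> {0<..<s}"
      then have r': "r \<in> {0..s}" by auto
      have "?F r = (LINT \<omega>:?S|sphere_measure. (s - r) * (v \<bullet> grad \<rho> (x + (s - r) *\<^sub>R \<omega>))
           - (LINT \<xi>:?C|lborel. (s - r) * df (L.cone_point r \<omega> \<xi>) (v \<bullet> nu \<xi>, v, 0)))"
      proof (intro set_lebesgue_integral_cong allI impI)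
        show "?S \<in> sets sphere_measure" by (simp add: borel_closed)
        fix \<omega> assume \<omega>: "\<omega> \<in> ?S"
        have rT: "r \<in> time_interval T" using r by (intro tI) auto
        show "(s - r) * (d2 (r, x + (s - r) *\<^sub>R \<omega>) (1, 0) (1, 0)
            - (\<Sum>i\<in>UNIV. d2 (r, x + (s - r) *\<^sub>R \<omega>) (0, axis i 1) (0, axis i 1))) =
          (s - r) * (v \<bullet> grad \<rho> (x + (s - r) *\<^sub>R \<omega>))
           - (LINT \<xi>:?C|lborel. (s - r) * df (L.cone_point r \<omega> \<xi>) (v \<bullet> nu \<xi>, v, 0))"
          unfolding set_integral_mult_right L.cone_point_def right_diff_distrib[of "s - r", symmetric]
          using wave_equation[OF _ _ cone[OF r' \<omega>], of r v] r s Eh_wave[OF rT, of "x + (s - r) *\<^sub>R \<omega>"]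
          by (simp add: d2_def inner_diff_right inner_sum_right sum_subtractf)
      qed
      also have "\<dots> = ?G r - ?H r"
        unfolding L.dint_def
      proof (rule set_integral_diff(2))
        show "set_integrable sphere_measure ?S (\<lambda>\<omega>. (s - r) * (v \<bullet> grad \<rho> (x + (s - r) *\<^sub>R \<omega>)))"
          by (rule set_integrable_continuous_compact[OF _ sph continuous_on_section[OF gr r']]) simp
        show "set_integrable sphere_measure ?S
            (\<lambda>\<omega>. LINT \<xi>:?C|lborel. (s - r) * df (L.cone_point r \<omega> \<xi>) (v \<bullet> nu \<xi>, v, 0))"
          by (rule set_integrable_continuous_compact[OF _ sph
                continuous_on_section[OF L.continuous_on_inner[OF compact_Icc L.continuous_on_source] r']]) simp
      qed
      finally show "?F r = ?G r - ?H r" .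
    qed
    also have "\<dots> = (LINT r:{0..s}|lborel. ?G r) - (LINT r:{0..s}|lborel. ?H r)"
      using Gc Hc by (intro set_integral_diff(2) borel_integrable_atLeastAtMost')
    finally show ?thesis .
  qed
  also note L.integral_source[of v]
  also have "(LINT r:{0..s}|lborel. L.dint (\<lambda>\<omega> \<xi>.
        (tangential_kernel v \<omega> (nu \<xi>) + L.force_kernel v r \<omega> \<xi>) * f_st (L.cone_point r \<omega> \<xi>)))
     = (LINT r:{0..s}|lborel. L.dint (\<lambda>\<omega> \<xi>. tangential_kernel v \<omega> (nu \<xi>) * f r (x + (s - r) *\<^sub>R \<omega>) \<xi>))
     + (LINT r:{0..s}|lborel. L.dint (\<lambda>\<omega> \<xi>. L.force_kernel v r \<omega> \<xi> * f r (x + (s - r) *\<^sub>R \<omega>) \<xi>))"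
    (is "_ = (LINT r:{0..s}|lborel. L.dint (?k1 r)) + (LINT r:{0..s}|lborel. L.dint (?k2 r))")
  proof -
    have fc: "continuous_on ({0..s} \<times> ?S \<times> ?C) (\<lambda>p. f_st (L.cone_point (fst p) (fst (snd p)) (snd (snd p))))"
      by (rule L.continuous_on_cone_point[OF L.f_cont]) auto
    have k1: "continuous_on ({0..s} \<times> ?S \<times> ?C) (\<lambda>(r, \<omega>, \<xi>). ?k1 r \<omega> \<xi>)"
      and k2: "continuous_on ({0..s} \<times> ?S \<times> ?C) (\<lambda>(r, \<omega>, \<xi>). ?k2 r \<omega> \<xi>)"
      using continuous_on_mult[OF L.continuous_on_tangential_kernel[unfolded case_prod_beta] fc]
        continuous_on_mult[OF L.continuous_on_force_kernel[unfolded case_prod_beta] fc]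
      by (simp_all add: case_prod_beta L.cone_point_def)
    have "(LINT r:{0..s}|lborel. L.dint (\<lambda>\<omega> \<xi>.
        (tangential_kernel v \<omega> (nu \<xi>) + L.force_kernel v r \<omega> \<xi>) * f_st (L.cone_point r \<omega> \<xi>)))
       = (LINT r:{0..s}|lborel. L.dint (?k1 r) + L.dint (?k2 r))"
      by (intro set_lebesgue_integral_cong)
         (auto simp: L.cone_point_def ring_distribs intro!: L.dint_linear(1) L.continuous_on_time_section[OF k1] L.continuous_on_time_section[OF k2])
    also have "\<dots> = (LINT r:{0..s}|lborel. L.dint (?k1 r)) + (LINT r:{0..s}|lborel. L.dint (?k2 r))"
      by (intro set_integral_add(2) borel_integrable_atLeastAtMost' L.continuous_on_dint compact_Icc k1 k2)
    finally show ?thesis .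
  qed
  finally have *: "4 * pi * u (s, x) = - s * L.dint (\<lambda>\<omega> \<xi>. (v \<bullet> nu \<xi>) * f 0 (x + s *\<^sub>R \<omega>) \<xi>)
    + ((LINT r:{0..s}|lborel. LINT \<omega>:?S|sphere_measure. (s - r) * (v \<bullet> grad \<rho> (x + (s - r) *\<^sub>R \<omega>)))
      - (s * L.dint (\<lambda>\<omega> \<xi>. (ratio v \<omega> (nu \<xi>) - v \<bullet> nu \<xi>) * f_st (0, x + s *\<^sub>R \<omega>, \<xi>))
       + ((LINT r:{0..s}|lborel. L.dint (\<lambda>\<omega> \<xi>. tangential_kernel v \<omega> (nu \<xi>) * f r (x + (s - r) *\<^sub>R \<omega>) \<xi>))
     + (LINT r:{0..s}|lborel. L.dint (\<lambda>\<omega> \<xi>. L.force_kernel v r \<omega> \<xi> * f r (x + (s - r) *\<^sub>R \<omega>) \<xi>)))))" .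
  have "L.dint (\<lambda>\<omega> \<xi>. (v \<bullet> nu \<xi>) * f 0 (x + s *\<^sub>R \<omega>) \<xi>)
     + L.dint (\<lambda>\<omega> \<xi>. (ratio v \<omega> (nu \<xi>) - v \<bullet> nu \<xi>) * f_st (0, x + s *\<^sub>R \<omega>, \<xi>))
     = L.dint (\<lambda>\<omega> \<xi>. ratio v \<omega> (nu \<xi>) * f 0 (x + s *\<^sub>R \<omega>) \<xi>)"
  proof -
    have "continuous_on (?S \<times> ?C) (\<lambda>p. f_st (0, x + s *\<^sub>R fst p, snd p))"
      by (rule continuous_on_compose2[OF L.f_cont]) (use s in \<open>auto intro!: continuous_intros\<close>)
    then have c: "continuous_on (?S \<times> ?C) (\<lambda>p. f 0 (x + s *\<^sub>R fst p) (snd p))"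
      by simp
    show ?thesis
      by (subst L.dint_linear(1)[symmetric])
         (auto simp: case_prod_beta algebra_simps intro!: continuous_intros continuous_on_ratio c dest: cone_denominator_nonzero)
  qed
  note ** = arg_cong[where f="\<lambda>a. s * a", OF this]
  have "4 * pi * (v \<bullet> E s x) = 4 * pi * (v \<bullet> Eh s x) + 4 * pi * u (s, x)"
    by (simp add: u_def inner_diff_right algebra_simps)
  then show ?thesis
    unfolding * using ** by (simp add: L.dint_def L.force_kernel_def algebra_simps)
qed

end

section \<open>Measurability of the force weight\<close>

text \<open>
  Where the denominator vanishes the quotient is 0, by the convention on division. It is not even
  continuous there: the velocities \<open>nu \<zeta>\<close> fill a neighbourhood of \<open>nu \<xi>\<close>, and along a line of velocities
  through \<open>nu \<xi>\<close> the quotient is either unbounded or a nonzero constant.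
\<close>

lemma ratio_nu_not_differentiable:
  assumes v: "v \<noteq> 0" and z: "1 + \<omega> \<bullet> nu \<xi> = 0"
  shows "\<not> (\<lambda>\<zeta>. ratio v \<omega> (nu \<zeta>)) differentiable at \<xi>"
proof
  assume "(\<lambda>\<zeta>. ratio v \<omega> (nu \<zeta>)) differentiable at \<xi>"
  then have c: "isCont (\<lambda>\<zeta>. ratio v \<omega> (nu \<zeta>)) \<xi>" by (rule differentiable_imp_continuous_within)
  \<comment> \<open>The momentum with the given velocity, i.e. the inverse of \<open>nu\<close> on the unit ball.\<close>
  define mom :: "real^3 \<Rightarrow> real^3" where "mom p = p /\<^sub>R sqrt (1 - p \<bullet> p)" for p
  let ?p = "nu \<xi>"
  have pos: "1 - p \<bullet> p > 0" if "norm p < 1" for p :: "real^3"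
    using that by (simp add: dot_square_norm power_less_one_iff)
  have nu_mom: "nu (mom p) = p" if "norm p < 1" for p
  proof -
    define \<beta> where "\<beta> = 1 - p \<bullet> p"
    have \<beta>: "\<beta> > 0" "p \<bullet> p = 1 - \<beta>" using pos[OF that] by (auto simp: \<beta>_def)
    have "(jbr (mom p))\<^sup>2 = 1 + (p \<bullet> p) / \<beta>"
      using \<beta>(1) by (simp add: jbr_power2 mom_def \<beta>_def[symmetric] divide_inverse flip: mult.assoc inverse_mult_distrib)
    also have "\<dots> = (1 / sqrt \<beta>)\<^sup>2" using \<beta> by (simp add: power_divide field_simps)
    finally have "jbr (mom p) = 1 / sqrt \<beta>"
      using \<beta>(1) jbr_pos[of "mom p"] by (simp add: power2_eq_iff_nonneg)
    then show ?thesis using \<beta>(1) by (simp add: nu_def mom_def \<beta>_def[symmetric])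
  qed
  have "1 - ?p \<bullet> ?p = (1 / jbr \<xi>)\<^sup>2"
    using norm_nu[of \<xi>] by (simp add: power2_norm_eq_inner power_divide)
  then have mom_nu: "mom ?p = \<xi>"
    using jbr_pos[of \<xi>] by (simp add: mom_def nu_def real_sqrt_divide)
  have "isCont mom ?p"
    unfolding mom_def using pos[OF norm_nu_less[of \<xi>]] by (intro continuous_intros) auto
  then have "isCont (\<lambda>p. ratio v \<omega> (nu (mom p))) ?p"
    using isCont_o2[of ?p mom "\<lambda>\<zeta>. ratio v \<omega> (nu \<zeta>)"] c by (simp add: mom_nu)
  then have lim: "((\<lambda>p. ratio v \<omega> (nu (mom p))) \<longlongrightarrow> 0) (at ?p)"
    unfolding isCont_def by (simp add: mom_nu ratio_def z)
  have "\<omega> \<noteq> 0" using z by auto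
  \<comment> \<open>A direction along which neither the numerator nor the denominator is constant.\<close>
  define w where "w = (if v \<bullet> \<omega> = 0 then v + \<omega> else v)"
  have w: "v \<bullet> w \<noteq> 0" "\<omega> \<bullet> w \<noteq> 0"
    using v \<open>\<omega> \<noteq> 0\<close> by (auto simp: w_def inner_add_right inner_commute)
  have "w \<noteq> 0" using w by auto
  have path: "filterlim (\<lambda>\<epsilon>. ?p + \<epsilon> *\<^sub>R w) (at ?p) (at 0)"
  proof (rule filterlim_atI)
    show "((\<lambda>\<epsilon>. ?p + \<epsilon> *\<^sub>R w) \<longlongrightarrow> ?p) (at 0)" by (auto intro!: tendsto_eq_intros)
    show "\<forall>\<^sub>F \<epsilon> in at 0. ?p + \<epsilon> *\<^sub>R w \<noteq> ?p"
      using \<open>w \<noteq> 0\<close> by (auto simp: eventually_at intro!: exI[of _ 1])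
  qed
  have "open {\<epsilon>. norm (?p + \<epsilon> *\<^sub>R w) < 1}" by (intro open_Collect_less continuous_intros)
  then have "\<forall>\<^sub>F \<epsilon> in at 0. \<epsilon> \<in> {\<epsilon>. norm (?p + \<epsilon> *\<^sub>R w) < 1}"
    by (rule eventually_at_in_open') (simp add: norm_nu_less)
  then have ev: "\<forall>\<^sub>F \<epsilon> in at 0. ratio v \<omega> (nu (mom (?p + \<epsilon> *\<^sub>R w))) =
      (v \<bullet> (?p + \<omega>) + \<epsilon> * (v \<bullet> w)) / (\<epsilon> * (\<omega> \<bullet> w))"
    by eventually_elim (use z in \<open>simp add: nu_mom ratio_def inner_add_right algebra_simps\<close>)
  have l: "((\<lambda>\<epsilon>. (v \<bullet> (?p + \<omega>) + \<epsilon> * (v \<bullet> w)) / (\<epsilon> * (\<omega> \<bullet> w))) \<longlongrightarrow> 0) (at 0)"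
    using filterlim_compose[OF lim path] by (rule Lim_transform_eventually[OF _ ev])
  have ne: "\<forall>\<^sub>F \<epsilon> in at 0. \<epsilon> \<noteq> (0::real)" by (simp add: eventually_at_filter)
  have "((\<lambda>\<epsilon>. (v \<bullet> (?p + \<omega>) + \<epsilon> * (v \<bullet> w)) / (\<epsilon> * (\<omega> \<bullet> w)) * (\<epsilon> * (\<omega> \<bullet> w))) \<longlongrightarrow> 0 * (0 * (\<omega> \<bullet> w))) (at 0)"
    by (intro tendsto_intros l)
  then have "((\<lambda>\<epsilon>. (v \<bullet> (?p + \<omega>) + \<epsilon> * (v \<bullet> w)) / (\<epsilon> * (\<omega> \<bullet> w)) * (\<epsilon> * (\<omega> \<bullet> w))) \<longlongrightarrow> 0) (at 0)"
    by (simp only: mult_zero_left)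
  moreover have "\<forall>\<^sub>F \<epsilon> in at 0. (v \<bullet> (?p + \<omega>) + \<epsilon> * (v \<bullet> w)) / (\<epsilon> * (\<omega> \<bullet> w)) * (\<epsilon> * (\<omega> \<bullet> w))
      = v \<bullet> (?p + \<omega>) + \<epsilon> * (v \<bullet> w)"
    using ne by eventually_elim (use w in simp)
  ultimately have "((\<lambda>\<epsilon>. v \<bullet> (?p + \<omega>) + \<epsilon> * (v \<bullet> w)) \<longlongrightarrow> 0) (at 0)"
    by (rule Lim_transform_eventually)
  moreover have "((\<lambda>\<epsilon>. v \<bullet> (?p + \<omega>) + \<epsilon> * (v \<bullet> w)) \<longlongrightarrow> v \<bullet> (?p + \<omega>)) (at 0)"
    by (auto intro!: tendsto_eq_intros)
  ultimately have a: "v \<bullet> (?p + \<omega>) = 0" by (metis LIM_unique)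
  have "\<forall>\<^sub>F \<epsilon> in at 0. (v \<bullet> (?p + \<omega>) + \<epsilon> * (v \<bullet> w)) / (\<epsilon> * (\<omega> \<bullet> w)) = (v \<bullet> w) / (\<omega> \<bullet> w)"
    using ne by eventually_elim (simp add: a)
  with l have "((\<lambda>\<epsilon>. (v \<bullet> w) / (\<omega> \<bullet> w)) \<longlongrightarrow> 0) (at (0::real))"
    by (rule Lim_transform_eventually)
  then show False using w by (simp add: tendsto_const_iff)
qed

text \<open>
  The value of \<open>frechet_derivative\<close> at a point where the derivative does not exist is an unspecified
  constant. By the previous lemma the gradient therefore is constant on the closed set where the
  denominator vanishes if \<open>v \<noteq> 0\<close>, and it is 0 there if \<open>v = 0\<close>. It is continuous on the complement.
\<close>

lemma borel_measurable_grad_ratio: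
  "(\<lambda>p. grad (\<lambda>\<zeta>. ratio v (fst p) (nu \<zeta>)) (snd p)) \<in> borel_measurable borel"
proof -
  define A :: "((real^3) \<times> (real^3)) set" where "A = {p. 1 + fst p \<bullet> nu (snd p) \<noteq> 0}"
  have "open A" unfolding A_def by (intro open_Collect_neq continuous_intros)
  define c :: "real^3" where "c = (if v = 0 then 0 else (\<chi> i. (SOME f'. False) (axis i 1 :: real^3)))"
  have eq: "grad (\<lambda>\<zeta>. ratio v (fst p) (nu \<zeta>)) (snd p) =
     (if p \<in> A then \<chi> i. ratio_deriv v (fst p) (nu (snd p)) (nu_deriv (snd p) (axis i 1)) else c)" for p
  proof (cases "p \<in> A")
    case True
    then show ?thesis
      by (simp add: A_def grad_def partial_eq[OF ratio_nu_has_derivative])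
  next
    case False
    show ?thesis
    proof (cases "v = 0")
      case True
      have D: "((\<lambda>\<zeta>. ratio v (fst p) (nu \<zeta>)) has_derivative (\<lambda>_. 0)) (at (snd p))"
        by (simp add: True ratio_def)
      have "c = 0" by (simp add: c_def True)
      then show ?thesis using \<open>p \<notin> A\<close> by (simp add: grad_def partial_eq[OF D] vec_eq_iff)
    next
      case v: False
      then have "\<not> (\<lambda>\<zeta>. ratio v (fst p) (nu \<zeta>)) differentiable at (snd p)"
        using \<open>p \<notin> A\<close> by (intro ratio_nu_not_differentiable) (auto simp: A_def)
      then show ?thesis using \<open>p \<notin> A\<close> v
        by (simp add: grad_def partial_def frechet_derivative_def differentiable_def c_def)
    qed
  qed
  show ?thesis unfolding eq
  proof (rule borel_measurable_continuous_on_if)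
    show "A \<in> sets borel" using \<open>open A\<close> by simp
    show "continuous_on A (\<lambda>p. \<chi> i. ratio_deriv v (fst p) (nu (snd p)) (nu_deriv (snd p) (axis i 1)))"
      by (intro continuous_on_vec_lambda continuous_on_ratio_deriv continuous_intros) (simp add: A_def)
  qed auto
qed

lemma borel_measurable_ratio:
  "(\<lambda>p. ratio v (fst p) (nu (snd p))) \<in> borel_measurable borel"
  "(\<lambda>p. tangential_kernel v (fst p) (nu (snd p))) \<in> borel_measurable borel"
proof -
  have "continuous_on UNIV (\<lambda>p :: (real^3) \<times> (real^3). nu (snd p))" by (intro continuous_intros)
  then have [measurable]: "(\<lambda>p :: (real^3) \<times> (real^3). nu (snd p)) \<in> borel_measurable borel"
    by (rule borel_measurable_continuous_onI)
  have [measurable]: "fst \<in> borel_measurable (borel :: ((real^3) \<times> (real^3)) measure)"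
    by (intro borel_measurable_continuous_onI continuous_intros)
  show "(\<lambda>p. ratio v (fst p) (nu (snd p))) \<in> borel_measurable borel"
    "(\<lambda>p. tangential_kernel v (fst p) (nu (snd p))) \<in> borel_measurable borel"
    unfolding ratio_def tangential_kernel_def by measurable
qed

text \<open>
  Reduction of the integrals in D0, Dl and Dn to compact sets. Measurability is required
  for all \<open>\<omega>\<close>, whereas the support of \<open>h\<close> is controlled for unit vectors only.
\<close>

lemma integral_sphere_momentum:
  fixes h :: "real^3 \<Rightarrow> real^3 \<Rightarrow> real"
  assumes h: "(\<lambda>p. h (fst p) (snd p)) \<in> borel_measurable borel"
    and supp: "\<And>\<omega> \<xi>. \<omega> \<in> sphere 0 1 \<Longrightarrow> norm \<xi> > P \<Longrightarrow> h \<omega> \<xi> = 0"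
  shows "(\<integral>\<omega>. (\<integral>\<xi>. h \<omega> \<xi> \<partial>lborel) \<partial>sphere_measure) =
     (LINT \<omega>:sphere 0 1|sphere_measure. LINT \<xi>:cball 0 P|lborel. h \<omega> \<xi>)"
proof -
  have "case_prod h \<in> borel_measurable (borel \<Otimes>\<^sub>M lborel)"
    using h unfolding measurable_cong_sets[OF sets_pair_measure_cong[OF refl sets_lborel] refl] borel_prod
    by (simp add: case_prod_beta')
  then have "(\<lambda>\<omega>. \<integral>\<xi>. h \<omega> \<xi> \<partial>lborel) \<in> borel_measurable borel"
    by (rule lborel.borel_measurable_lebesgue_integral)
  then have "(\<integral>\<omega>. (\<integral>\<xi>. h \<omega> \<xi> \<partial>lborel) \<partial>sphere_measure) =
     (LINT \<omega>:sphere 0 1|sphere_measure. (\<integral>\<xi>. h \<omega> \<xi> \<partial>lborel))"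
    by (rule integral_sphere_measure)
  also have "\<dots> = (LINT \<omega>:sphere 0 1|sphere_measure. LINT \<xi>:cball 0 P|lborel. h \<omega> \<xi>)"
  proof (intro set_lebesgue_integral_cong allI impI)
    fix \<omega> :: "real^3" assume \<omega>: "\<omega> \<in> sphere 0 1"
    have "h \<omega> \<xi> = indicator (cball 0 P) \<xi> *\<^sub>R h \<omega> \<xi>" for \<xi>
      using supp[OF \<omega>, of \<xi>] by (cases "norm \<xi> \<le> P") auto
    then show "(\<integral>\<xi>. h \<omega> \<xi> \<partial>lborel) = (LINT \<xi>:cball 0 P|lborel. h \<omega> \<xi>)"
      unfolding set_lebesgue_integral_def by presburger
  qed (simp add: borel_closed)
  finally show ?thesis .
qed

section \<open>Integrals over the triangle\<close>

definition time_triangle :: "real \<Rightarrow> (real \<times> real) set" where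
  "time_triangle t = {(r, s). 0 \<le> r \<and> r \<le> s \<and> s \<le> t}"

lemma compact_time_triangle: "compact (time_triangle t)"
proof -
  have "closed {p. 0 \<le> fst p \<and> fst p \<le> snd p \<and> snd p \<le> t}"
    by (intro closed_Collect_conj closed_Collect_le continuous_intros)
  then have "closed (time_triangle t)" by (simp add: time_triangle_def case_prod_beta')
  moreover have "bounded (time_triangle t)"
    by (rule bounded_subset[of "{0..t} \<times> {0..t}"]) (auto simp: time_triangle_def bounded_Times)
  ultimately show ?thesis by (simp add: compact_eq_bounded_closed)
qed

lemma triangle_swap:
  fixes H :: "real \<Rightarrow> real \<Rightarrow> real"
  assumes H: "continuous_on (time_triangle t) (\<lambda>(r, s). H r s)"
  shows "(LINT r:{0..t}|lborel. LINT s:{r..t}|lborel. H r s) = (LINT s:{0..t}|lborel. LINT r:{0..s}|lborel. H r s)"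
    and "set_integrable lborel {0..t} (\<lambda>s. LINT r:{0..s}|lborel. H r s)"
proof -
  let ?h = "\<lambda>r s. indicator (time_triangle t) (r, s) * H r s"
  have 1: "(\<integral>s. ?h r s \<partial>lborel) = indicator {0..t} r *\<^sub>R (LINT s:{r..t}|lborel. H r s)" for r
  proof -
    have "?h r s = indicator {0..t} r * (indicator {r..t} s *\<^sub>R H r s)" for s
      by (auto simp: time_triangle_def indicator_def)
    then show ?thesis
      by (simp only: set_lebesgue_integral_def integral_mult_right_zero real_scaleR_def)
  qed
  have 2: "(\<integral>r. ?h r s \<partial>lborel) = indicator {0..t} s *\<^sub>R (LINT r:{0..s}|lborel. H r s)" for s
  proof -
    have "?h r s = indicator {0..t} s * (indicator {0..s} r *\<^sub>R H r s)" for r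
      by (auto simp: time_triangle_def indicator_def)
    then show ?thesis
      by (simp only: set_lebesgue_integral_def integral_mult_right_zero real_scaleR_def)
  qed
  have "integrable lborel (\<lambda>p. indicator (time_triangle t) p *\<^sub>R (case p of (r, s) \<Rightarrow> H r s))"
    by (rule borel_integrable_compact[OF compact_time_triangle H])
  then have int: "integrable (lborel \<Otimes>\<^sub>M lborel) (\<lambda>(r, s). ?h r s)"
    by (simp add: lborel_prod case_prod_beta')
  show "(LINT r:{0..t}|lborel. LINT s:{r..t}|lborel. H r s) = (LINT s:{0..t}|lborel. LINT r:{0..s}|lborel. H r s)"
    using lborel_pair.Fubini_integral[OF int] by (simp add: 1 2 set_lebesgue_integral_def)
  show "set_integrable lborel {0..t} (\<lambda>s. LINT r:{0..s}|lborel. H r s)"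
    using lborel_pair.integrable_snd[OF int] by (simp add: 2 set_integrable_def)
qed

section \<open>The momentum increment\<close>

text \<open>
  A curve \<open>X\<close> with a weight \<open>V\<close>; for a characteristic, \<open>V s\<close> is the velocity \<open>nu (\<Xi> s)\<close>. The radius \<open>R\<close> is large
  enough for the light cones with vertex on the curve.
\<close>

locale rvm_curve = rvm_wave +
  fixes X V :: "real \<Rightarrow> real^3" and t :: real
  assumes t: "0 \<le> t" "t < t1" and X: "continuous_on {0..t} X" and V: "continuous_on {0..t} V"
    and X_bound: "\<And>s. s \<in> {0..t} \<Longrightarrow> norm (X s) + t < R"
begin

sublocale compact_pair sphere_measure lborel "sphere 0 1 :: (real^3) set" "cball 0 P :: (real^3) set"
  by (rule compact_pair_sphere_cball)

definition "initial_term s = dint (\<lambda>\<omega> \<xi>. ratio (V s) \<omega> (nu \<xi>) * f 0 (X s + s *\<^sub>R \<omega>) \<xi>)"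

definition "light_cone_term r s =
  dint (\<lambda>\<omega> \<xi>. tangential_kernel (V s) \<omega> (nu \<xi>) * f r (X s + (s - r) *\<^sub>R \<omega>) \<xi>)"

definition "force_term r s =
  dint (\<lambda>\<omega> \<xi>. (s - r) * ratio_deriv (V s) \<omega> (nu \<xi>) (nu_deriv \<xi> (lorentz_force E B r (X s + (s - r) *\<^sub>R \<omega>) \<xi>))
              * f r (X s + (s - r) *\<^sub>R \<omega>) \<xi>)"

definition "background_term r s =
  (LINT \<omega>:sphere 0 1|sphere_measure. (s - r) * (V s \<bullet> grad \<rho> (X s + (s - r) *\<^sub>R \<omega>)))"

lemma continuous_on_curve:
  assumes "continuous_on {0..t} Y" "K \<subseteq> time_triangle t \<times> UNIV"
  shows "continuous_on K (\<lambda>p. Y (snd (fst p)))"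
  by (rule continuous_on_compose2[OF assms(1)]) (use assms(2) in \<open>auto intro!: continuous_intros simp: time_triangle_def\<close>)

lemma continuous_on_terms:
  "continuous_on (time_triangle t) (\<lambda>(r, s). light_cone_term r s)"
  "continuous_on (time_triangle t) (\<lambda>(r, s). force_term r s)"
  "continuous_on (time_triangle t) (\<lambda>(r, s). background_term r s)"
  "continuous_on {0..t} initial_term"
proof -
  let ?S = "sphere 0 1 :: (real^3) set" and ?C = "cball 0 P :: (real^3) set"
  let ?K = "time_triangle t \<times> ?S \<times> ?C"
  have tri: "0 \<le> r \<and> r \<le> s \<and> s \<le> t" if "(r, s) \<in> time_triangle t" for r s
    using that by (simp add: time_triangle_def)
  have triT: "fst q \<in> time_interval T" if "q \<in> time_triangle t" for q
    using tri[of "fst q" "snd q"] that t by (intro in_time_interval) auto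
  have Xc: "continuous_on ?K (\<lambda>p. X (snd (fst p)))" and Vc: "continuous_on ?K (\<lambda>p. V (snd (fst p)))"
    by (auto intro!: continuous_on_curve X V)
  let ?y = "\<lambda>p. X (snd (fst p)) + (snd (fst p) - fst (fst p)) *\<^sub>R fst (snd p)"
  have yc: "continuous_on ?K ?y"
    by (intro continuous_intros Xc)
  have fc: "continuous_on ?K (\<lambda>p. f_st (fst (fst p), ?y p, snd (snd p)))"
    by (intro continuous_on_compose2[OF f_cont] continuous_intros yc) (auto intro: triT)
  have Ec: "continuous_on ?K (\<lambda>p. E_st (fst (fst p), ?y p))"
    by (intro continuous_on_compose2[OF deriv2(1)[OF E]] continuous_intros yc) (auto intro: triT)
  have Bc: "continuous_on ?K (\<lambda>p. B_st (fst (fst p), ?y p))"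
    by (intro continuous_on_compose2[OF deriv2(1)[OF B]] continuous_intros yc) (auto intro: triT)
  have Fc: "continuous_on ?K (\<lambda>p. lorentz_force E B (fst (fst p)) (?y p) (snd (snd p)))"
    unfolding lorentz_force_def using Ec Bc by (intro continuous_intros continuous_on_cross) simp_all
  have "continuous_on (time_triangle t) (\<lambda>q. light_cone_term (fst q) (snd q))"
    unfolding light_cone_term_def
  proof (rule continuous_on_dint[OF compact_time_triangle])
    show "continuous_on ?K (\<lambda>(q, \<omega>, \<xi>). tangential_kernel (V (snd q)) \<omega> (nu \<xi>) * f (fst q) (X (snd q) + (snd q - fst q) *\<^sub>R \<omega>) \<xi>)"
      unfolding case_prod_beta tangential_kernel_def
      using fc by (intro continuous_intros Vc) (auto dest: cone_denominator_nonzero simp: case_prod_beta)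
  qed
  then show "continuous_on (time_triangle t) (\<lambda>(r, s). light_cone_term r s)" by (simp add: case_prod_beta')
  have "continuous_on (time_triangle t) (\<lambda>q. force_term (fst q) (snd q))"
    unfolding force_term_def
  proof (rule continuous_on_dint[OF compact_time_triangle])
    show "continuous_on ?K (\<lambda>(q, \<omega>, \<xi>). (snd q - fst q) *
        ratio_deriv (V (snd q)) \<omega> (nu \<xi>) (nu_deriv \<xi> (lorentz_force E B (fst q) (X (snd q) + (snd q - fst q) *\<^sub>R \<omega>) \<xi>))
          * f (fst q) (X (snd q) + (snd q - fst q) *\<^sub>R \<omega>) \<xi>)"
      unfolding case_prod_beta
      using fc by (intro continuous_intros continuous_on_ratio_deriv Vc Fc) (auto dest: cone_denominator_nonzero simp: case_prod_beta)
  qed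
  then show "continuous_on (time_triangle t) (\<lambda>(r, s). force_term r s)" by (simp add: case_prod_beta')
  have "continuous_on (time_triangle t) (\<lambda>q. background_term (fst q) (snd q))"
    unfolding background_term_def
  proof (rule continuous_on_set_integral[OF _ S compact_time_triangle])
    have "continuous_on (time_triangle t \<times> ?S) (\<lambda>p. grad \<rho> (X (snd (fst p)) + (snd (fst p) - fst (fst p)) *\<^sub>R snd p))"
      by (intro continuous_on_compose2[OF continuous_on_grad_rho] continuous_intros continuous_on_curve X) auto
    then show "continuous_on (time_triangle t \<times> ?S) (\<lambda>(q, \<omega>). (snd q - fst q) * (V (snd q) \<bullet> grad \<rho> (X (snd q) + (snd q - fst q) *\<^sub>R \<omega>)))"
      unfolding case_prod_beta by (intro continuous_intros continuous_on_curve V) auto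
  qed simp
  then show "continuous_on (time_triangle t) (\<lambda>(r, s). background_term r s)" by (simp add: case_prod_beta')
  show "continuous_on {0..t} initial_term"
    unfolding initial_term_def
  proof (rule continuous_on_dint[OF compact_Icc])
    have c: "continuous_on ({0..t} \<times> ?S \<times> ?C) (\<lambda>p. Y (fst p))" if "continuous_on {0..t} Y" for Y :: "real \<Rightarrow> real^3"
      by (rule continuous_on_compose2[OF that]) (auto intro!: continuous_intros)
    have "continuous_on ({0..t} \<times> ?S \<times> ?C) (\<lambda>p. f_st (0, X (fst p) + fst p *\<^sub>R fst (snd p), snd (snd p)))"
      by (intro continuous_on_compose2[OF f_cont] continuous_intros c X) (auto intro: zero_in_time_interval)
    then show "continuous_on ({0..t} \<times> ?S \<times> ?C) (\<lambda>(s, \<omega>, \<xi>). ratio (V s) \<omega> (nu \<xi>) * f 0 (X s + s *\<^sub>R \<omega>) \<xi>)"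
      unfolding case_prod_beta
      by (intro continuous_intros continuous_on_ratio c V) (auto dest: cone_denominator_nonzero)
  qed
qed

lemma work_decomposition:
  "(LINT s:{0..t}|lborel. V s \<bullet> E s (X s)) =
     (LINT s:{0..t}|lborel. - (s / (4 * pi)) * initial_term s)
   + (LINT s:{0..t}|lborel. V s \<bullet> Eh s (X s))
   + (LINT r:{0..t}|lborel. LINT s:{r..t}|lborel. - (1 / (4 * pi)) * light_cone_term r s)
   + (LINT r:{0..t}|lborel. LINT s:{r..t}|lborel. - (1 / (4 * pi)) * force_term r s)
   + (LINT r:{0..t}|lborel. LINT s:{r..t}|lborel. 1 / (4 * pi) * background_term r s)"
proof -
  let ?c = "1 / (4 * pi)"
  have c: "continuous_on (time_triangle t) (\<lambda>(r, s). k * h r s)"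
    if "continuous_on (time_triangle t) (\<lambda>(r, s). h r s)" for k :: real and h :: "real \<Rightarrow> real \<Rightarrow> real"
    using continuous_on_mult_left[OF that, of k] by (simp add: case_prod_beta')
  note L = triangle_swap[OF c[OF continuous_on_terms(1), of "- ?c"]]
  note N = triangle_swap[OF c[OF continuous_on_terms(2), of "- ?c"]]
  note G = triangle_swap[OF c[OF continuous_on_terms(3), of "?c"]]
  have I: "set_integrable lborel {0..t} (\<lambda>s. - (s / (4 * pi)) * initial_term s)"
    by (intro borel_integrable_atLeastAtMost' continuous_intros continuous_on_terms) auto
  have H: "set_integrable lborel {0..t} (\<lambda>s. V s \<bullet> Eh s (X s))"
  proof -
    have "continuous_on {0..t} (\<lambda>s. Eh_st (s, X s))"
      by (rule continuous_on_compose2[OF deriv2(1)[OF Eh_C2]])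
         (use t in \<open>auto intro!: continuous_intros X in_time_interval\<close>)
    then show ?thesis by (intro borel_integrable_atLeastAtMost' continuous_intros V) simp
  qed
  have "(LINT s:{0..t}|lborel. V s \<bullet> E s (X s)) = (LINT s:{0..t}|lborel.
       - (s / (4 * pi)) * initial_term s + V s \<bullet> Eh s (X s)
       + (LINT r:{0..s}|lborel. - ?c * light_cone_term r s)
       + (LINT r:{0..s}|lborel. - ?c * force_term r s)
       + (LINT r:{0..s}|lborel. ?c * background_term r s))"
  proof (intro set_lebesgue_integral_cong allI impI)
    fix s assume s: "s \<in> {0..t}"
    have eq: "4 * pi * (V s \<bullet> E s (X s)) = 4 * pi * (V s \<bullet> Eh s (X s)) - s * initial_term s
        - (LINT r:{0..s}|lborel. light_cone_term r s) - (LINT r:{0..s}|lborel. force_term r s)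
        + (LINT r:{0..s}|lborel. background_term r s)"
      unfolding initial_term_def light_cone_term_def force_term_def background_term_def dint_def
      using s t X_bound[OF s] by (intro electric_field) auto
    have "V s \<bullet> E s (X s) = 4 * pi * (V s \<bullet> E s (X s)) / (4 * pi)" by simp
    then show "V s \<bullet> E s (X s) = - (s / (4 * pi)) * initial_term s + V s \<bullet> Eh s (X s)
       + (LINT r:{0..s}|lborel. - ?c * light_cone_term r s)
       + (LINT r:{0..s}|lborel. - ?c * force_term r s)
       + (LINT r:{0..s}|lborel. ?c * background_term r s)"
      unfolding set_integral_mult_right eq by (simp add: add_divide_distrib diff_divide_distrib)
  qed simp
  then show ?thesis
    unfolding L(1) N(1) G(1) using I H L(2) N(2) G(2) by (simp only: set_integral_add)
qed

end

context rvm_curve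
begin

lemma cone_in_region:
  assumes "s \<in> {0..t}" "r \<in> {0..s}" "\<omega> \<in> sphere 0 1"
  shows "norm (X s + (s - r) *\<^sub>R \<omega>) \<le> R"
  using norm_triangle_ineq[of "X s" "(s - r) *\<^sub>R \<omega>"] X_bound[OF assms(1)] assms by simp

lemma borel_measurable_f_slice:
  assumes "r \<in> time_interval T"
  shows "(\<lambda>p. f r (x + c *\<^sub>R fst p) (snd p)) \<in> borel_measurable borel"
proof -
  have "continuous_on UNIV (\<lambda>p. f_st (r, x + c *\<^sub>R fst p, snd p))"
    by (intro continuous_on_compose2[OF f_cont] continuous_intros) (use assms in auto)
  then show ?thesis by (intro borel_measurable_continuous_onI) simp
qed

lemma borel_measurable_force_slice:
  assumes "r \<in> time_interval T"
  shows "(\<lambda>p. lorentz_force E B r (x + c *\<^sub>R fst p) (snd p)) \<in> borel_measurable borel"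
proof -
  have "continuous_on (UNIV :: ((real^3) \<times> (real^3)) set) (\<lambda>p. E_st (r, x + c *\<^sub>R fst p))"
    "continuous_on (UNIV :: ((real^3) \<times> (real^3)) set) (\<lambda>p. B_st (r, x + c *\<^sub>R fst p))"
    by (intro continuous_on_compose2[OF deriv2(1)[OF E]] continuous_on_compose2[OF deriv2(1)[OF B]] continuous_intros;
        use assms in auto)+
  then show ?thesis unfolding lorentz_force_def
    by (intro borel_measurable_continuous_onI continuous_intros continuous_on_cross) simp_all
qed

lemma kernel_integral:
  assumes s: "s \<in> {0..t}" "r \<in> {0..s}" and k: "(\<lambda>p. k (fst p) (snd p)) \<in> borel_measurable borel"
  shows "(\<integral>\<omega>. (\<integral>\<xi>. c * k \<omega> \<xi> * f r (X s + (s - r) *\<^sub>R \<omega>) \<xi> \<partial>lborel) \<partial>sphere_measure)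
     = c * dint (\<lambda>\<omega> \<xi>. k \<omega> \<xi> * f r (X s + (s - r) *\<^sub>R \<omega>) \<xi>)"
proof -
  have r: "r \<in> time_interval T" using s t by (intro in_time_interval) auto
  have "(\<integral>\<omega>. (\<integral>\<xi>. c * k \<omega> \<xi> * f r (X s + (s - r) *\<^sub>R \<omega>) \<xi> \<partial>lborel) \<partial>sphere_measure)
     = dint (\<lambda>\<omega> \<xi>. c * k \<omega> \<xi> * f r (X s + (s - r) *\<^sub>R \<omega>) \<xi>)"
    unfolding dint_def
  proof (rule integral_sphere_momentum)
    show "(\<lambda>p. c * k (fst p) (snd p) * f r (X s + (s - r) *\<^sub>R fst p) (snd p)) \<in> borel_measurable borel"
      by (intro borel_measurable_times k borel_measurable_f_slice r) auto
    fix \<omega> \<xi> :: "real^3" assume "\<omega> \<in> sphere 0 1" "norm \<xi> > P"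
    then show "c * k \<omega> \<xi> * f r (X s + (s - r) *\<^sub>R \<omega>) \<xi> = 0"
      using support[of r "X s + (s - r) *\<^sub>R \<omega>" \<xi>] cone_in_region[of s r \<omega>] s t by simp
  qed
  then show ?thesis by (simp only: mult.assoc dint_mult)
qed

lemma W0_integral:
  assumes s: "s \<in> {0..t}" and V: "V s = nu (\<Xi> s)"
  shows "(\<integral>\<omega>. (\<integral>\<xi>. W0 \<Xi> s \<omega> \<xi> * f 0 (X s + s *\<^sub>R \<omega>) \<xi> \<partial>lborel) \<partial>sphere_measure) = - (s / (4 * pi)) * initial_term s"
proof -
  have W: "W0 \<Xi> s \<omega> \<xi> = - (s / (4 * pi)) * ratio (V s) \<omega> (nu \<xi>)" for \<omega> \<xi>
    by (simp add: W0_def ratio_def V)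
  show ?thesis unfolding W initial_term_def
    using kernel_integral[OF s _ borel_measurable_ratio(1), of 0] s by simp
qed

lemma Wl_integral:
  assumes s: "s \<in> {0..t}" "r \<in> {0..s}" and V: "V s = nu (\<Xi> s)"
  shows "(\<integral>\<omega>. (\<integral>\<xi>. Wl \<Xi> s \<omega> \<xi> * f r (X s + (s - r) *\<^sub>R \<omega>) \<xi> \<partial>lborel) \<partial>sphere_measure)
     = - (1 / (4 * pi)) * light_cone_term r s"
proof -
  have W: "Wl \<Xi> s \<omega> \<xi> = - (1 / (4 * pi)) * tangential_kernel (V s) \<omega> (nu \<xi>)" for \<omega> \<xi>
    using norm_nu[of \<xi>] by (simp add: Wl_def tangential_kernel_def V power2_norm_eq_inner add.commute)
  show ?thesis unfolding W light_cone_term_def by (rule kernel_integral[OF s borel_measurable_ratio(2)])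
qed

lemma Wn_integral:
  assumes s: "s \<in> {0..t}" "r \<in> {0..s}" and V: "V s = nu (\<Xi> s)"
  shows "(\<integral>\<omega>. (\<integral>\<xi>. (Wn \<Xi> r s \<omega> \<xi> \<bullet> lorentz_force E B r (X s + (s - r) *\<^sub>R \<omega>) \<xi>)
      * f r (X s + (s - r) *\<^sub>R \<omega>) \<xi> \<partial>lborel) \<partial>sphere_measure) = - (1 / (4 * pi)) * force_term r s"
proof -
  let ?F = "\<lambda>\<omega> \<xi>. lorentz_force E B r (X s + (s - r) *\<^sub>R \<omega>) \<xi>"
  let ?k = "\<lambda>\<omega> \<xi>. (s - r) * (grad (\<lambda>\<zeta>. ratio (V s) \<omega> (nu \<zeta>)) \<xi> \<bullet> ?F \<omega> \<xi>)"
  have W: "Wn \<Xi> r s \<omega> \<xi> \<bullet> ?F \<omega> \<xi> = - (1 / (4 * pi)) * ?k \<omega> \<xi>" for \<omega> \<xi>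
    by (simp add: Wn_def ratio_def V)
  have "r \<in> time_interval T" using s t by (intro in_time_interval) auto
  then have k: "(\<lambda>p. ?k (fst p) (snd p)) \<in> borel_measurable borel"
    by (intro borel_measurable_times borel_measurable_inner borel_measurable_const
        borel_measurable_grad_ratio borel_measurable_force_slice)
  have "?k \<omega> \<xi> = (s - r) * ratio_deriv (V s) \<omega> (nu \<xi>) (nu_deriv \<xi> (?F \<omega> \<xi>))"
    if "\<omega> \<in> sphere 0 1" for \<omega> \<xi>
    using grad_inner[OF ratio_nu_has_derivative[OF cone_denominator_nonzero[OF that]], of "?F \<omega> \<xi>" "V s" \<xi>]
    by (simp add: inner_commute[of "grad _ _"])
  then have "dint (\<lambda>\<omega> \<xi>. ?k \<omega> \<xi> * f r (X s + (s - r) *\<^sub>R \<omega>) \<xi>) = force_term r s"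
    unfolding force_term_def by (intro dint_cong) simp
  then show ?thesis unfolding W using kernel_integral[OF s k, of "- (1 / (4 * pi))"] by (simp only:)
qed

lemma rho_integral:
  shows "(\<integral>\<omega>. (s - r) / (4 * pi) * (V s \<bullet> grad \<rho> (X s + (s - r) *\<^sub>R \<omega>)) \<partial>sphere_measure)
    = 1 / (4 * pi) * background_term r s"
proof -
  have c: "continuous_on UNIV (\<lambda>\<omega>. grad \<rho> (X s + (s - r) *\<^sub>R \<omega>))"
    by (intro continuous_on_compose2[OF continuous_on_grad_rho] continuous_intros) auto
  have "(\<integral>\<omega>. (s - r) / (4 * pi) * (V s \<bullet> grad \<rho> (X s + (s - r) *\<^sub>R \<omega>)) \<partial>sphere_measure)
    = (LINT \<omega>:sphere 0 1|sphere_measure. (s - r) / (4 * pi) * (V s \<bullet> grad \<rho> (X s + (s - r) *\<^sub>R \<omega>)))"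
    by (intro integral_sphere_measure borel_measurable_continuous_onI continuous_intros c)
  also have "\<dots> = (LINT \<omega>:sphere 0 1|sphere_measure. 1 / (4 * pi) * ((s - r) * (V s \<bullet> grad \<rho> (X s + (s - r) *\<^sub>R \<omega>))))"
    by simp
  finally show ?thesis unfolding background_term_def set_integral_mult_right .
qed

lemma momentum_terms:
  assumes V: "V = (\<lambda>s. nu (\<Xi> s))"
  shows "(LINT s:{0..t}|lborel. V s \<bullet> E s (X s)) =
     D0 (f 0) X \<Xi> t + Dh Eh X \<Xi> t + Dl f X \<Xi> t + Dn f E B X \<Xi> t + D_rho \<rho> X \<Xi> t"
proof -
  have Vs: "V s = nu (\<Xi> s)" for s by (simp add: V)
  have 0: "D0 (f 0) X \<Xi> t = (LINT s:{0..t}|lborel. - (s / (4 * pi)) * initial_term s)"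
    unfolding D0_def by (intro set_lebesgue_integral_cong allI impI W0_integral Vs) auto
  have l: "Dl f X \<Xi> t = (LINT r:{0..t}|lborel. LINT s:{r..t}|lborel. - (1 / (4 * pi)) * light_cone_term r s)"
    unfolding Dl_def by (intro set_lebesgue_integral_cong allI impI Wl_integral Vs) auto
  have n: "Dn f E B X \<Xi> t = (LINT r:{0..t}|lborel. LINT s:{r..t}|lborel. - (1 / (4 * pi)) * force_term r s)"
    unfolding Dn_def by (intro set_lebesgue_integral_cong allI impI Wn_integral Vs) auto
  have \<rho>: "D_rho \<rho> X \<Xi> t = (LINT r:{0..t}|lborel. LINT s:{r..t}|lborel. 1 / (4 * pi) * background_term r s)"
    unfolding D_rho_def Vs[symmetric] rho_integral ..
  show ?thesis unfolding 0 l n \<rho> Dh_def Vs[symmetric] by (rule work_decomposition)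
qed

end

text \<open>
  The derivative of \<open>jbr\<close> at \<open>\<xi>\<close> is the inner product with \<open>nu \<xi>\<close>, which is orthogonal to the magnetic force.
\<close>

lemma energy_identity:
  assumes ch: "characteristics T E B X \<Xi>" and t: "t \<in> time_interval T"
    and Ec: "continuous_on {0..t} (\<lambda>s. E s (X s y \<eta>))"
  shows "jbr (\<Xi> t y \<eta>) - jbr \<eta> = (LINT s:{0..t}|lborel. nu (\<Xi> s y \<eta>) \<bullet> E s (X s y \<eta>))"
proof -
  have tT: "s \<in> time_interval T" if "s \<in> {0..t}" for s
    using that t by (auto simp: time_interval_def intro: le_less_trans[of "ereal s" "ereal t"])
  have D: "((\<lambda>s. \<Xi> s y \<eta>) has_vector_derivative lorentz_force E B s (X s y \<eta>) (\<Xi> s y \<eta>)) (at s within time_interval T)"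
    if "s \<in> {0..t}" for s using ch tT[OF that] by (simp add: characteristics_def)
  have c: "continuous_on {0..t} (\<lambda>s. \<Xi> s y \<eta>)"
  proof -
    have "continuous (at s within {0..t}) (\<lambda>s. \<Xi> s y \<eta>)" if "s \<in> {0..t}" for s
      using has_vector_derivative_continuous[OF D[OF that]] by (rule continuous_within_subset) (use tT in auto)
    then show ?thesis by (simp add: continuous_on_eq_continuous_within)
  qed
  have 0: "\<Xi> 0 y \<eta> = \<eta>" using ch by (simp add: characteristics_def)
  have "(LINT s:{0..t}|lborel. nu (\<Xi> s y \<eta>) \<bullet> E s (X s y \<eta>)) = jbr (\<Xi> t y \<eta>) - jbr (\<Xi> 0 y \<eta>)"
  proof (rule set_integral_FTC_interior)
    show "0 \<le> t" using t by (simp add: time_interval_def)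
    show "continuous_on {0..t} (\<lambda>s. jbr (\<Xi> s y \<eta>))" by (intro continuous_intros c)
    show "continuous_on {0..t} (\<lambda>s. nu (\<Xi> s y \<eta>) \<bullet> E s (X s y \<eta>))" by (intro continuous_intros c Ec)
    fix s assume s: "s \<in> {0<..<t}"
    let ?F = "lorentz_force E B s (X s y \<eta>) (\<Xi> s y \<eta>)"
    have at: "at s within {0<..<t} = at s" using s by (intro at_within_open) auto
    have "((\<lambda>s. \<Xi> s y \<eta>) has_vector_derivative ?F) (at s within {0<..<t})"
      by (rule has_vector_derivative_within_subset[OF D]) (use s tT in auto)
    then have "((\<lambda>s. \<Xi> s y \<eta>) has_derivative (\<lambda>h. h *\<^sub>R ?F)) (at s)"
      by (simp only: has_vector_derivative_def at)
    from has_derivative_compose[OF this jbr_has_derivative]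
    have "((\<lambda>s. jbr (\<Xi> s y \<eta>)) has_real_derivative (\<Xi> s y \<eta> \<bullet> ?F) / jbr (\<Xi> s y \<eta>)) (at s)"
      unfolding has_field_derivative_def by (rule has_derivative_eq_rhs) (simp add: fun_eq_iff)
    also have "(\<Xi> s y \<eta> \<bullet> ?F) / jbr (\<Xi> s y \<eta>) = nu (\<Xi> s y \<eta>) \<bullet> ?F"
      by (simp add: nu_def divide_inverse mult.commute)
    also have "\<dots> = nu (\<Xi> s y \<eta>) \<bullet> E s (X s y \<eta>)"
      by (simp add: lorentz_force_def inner_add_right dot_cross_self)
    finally show "((\<lambda>s. jbr (\<Xi> s y \<eta>)) has_real_derivative nu (\<Xi> s y \<eta>) \<bullet> E s (X s y \<eta>)) (at s)" .
  qed
  then show ?thesis by (simp add: 0)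
qed

theorem proposition7:
  fixes T :: ereal
    and \<rho> :: "real^3 \<Rightarrow> real"
    and f0 :: "real^3 \<Rightarrow> real^3 \<Rightarrow> real"
    and E0 B0 :: "real^3 \<Rightarrow> real^3"
    and f :: "real \<Rightarrow> real^3 \<Rightarrow> real^3 \<Rightarrow> real"
    and E B Eh :: "real \<Rightarrow> real^3 \<Rightarrow> real^3"
    and X \<Xi> :: "real \<Rightarrow> real^3 \<Rightarrow> real^3 \<Rightarrow> real^3"
    and t :: real
    and y \<eta> :: "real^3"
  assumes "0 < T"
    and "Ck_on 1 UNIV \<rho>" and "compact (closure {x. \<rho> x \<noteq> 0})" and "\<And>x. 0 \<le> \<rho> x"
    and "\<And>x. divergence E0 x = (\<integral>\<xi>. f0 x \<xi> \<partial>lborel) - \<rho> x" and "\<And>x. divergence B0 x = 0"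
    and "smooth_on (time_interval T \<times> UNIV \<times> UNIV) (\<lambda>(t, x, \<xi>). f t x \<xi>)"
    and "smooth_on (time_interval T \<times> UNIV) (\<lambda>(t, x). E t x)"
    and "smooth_on (time_interval T \<times> UNIV) (\<lambda>(t, x). B t x)"
    and "rvm_system T \<rho> f E B"
    and "f 0 = f0" and "E 0 = E0" and "B 0 = B0"
    and "momentum_compact_support T f"
    and "characteristics T E B X \<Xi>"
    and "homogeneous_wave T E0 B0 Eh"
    and "t \<in> time_interval T"
  shows "jbr (\<Xi> t y \<eta>) - jbr \<eta> =
           D0 f0 (\<lambda>s. X s y \<eta>) (\<lambda>s. \<Xi> s y \<eta>) t
         + Dh Eh (\<lambda>s. X s y \<eta>) (\<lambda>s. \<Xi> s y \<eta>) t
         + Dl f (\<lambda>s. X s y \<eta>) (\<lambda>s. \<Xi> s y \<eta>) t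
         + Dn f E B (\<lambda>s. X s y \<eta>) (\<lambda>s. \<Xi> s y \<eta>) t
         + D_rho \<rho> (\<lambda>s. X s y \<eta>) (\<lambda>s. \<Xi> s y \<eta>) t"
proof -
  note ch = assms(15) and t = assms(17)
  have t0: "0 \<le> t" using t by (simp add: time_interval_def)
  \<comment> \<open>A time after \<open>t\<close>: the equations are differentiated at all positive times up to \<open>t\<close>.\<close>
  obtain t1 where t1: "t < t1" "ereal t1 < T"
  proof -
    have "ereal t < T" using t by (simp add: time_interval_def)
    then obtain q where "ereal t < q" "q < T" using dense by blast
    then show thesis by (cases q) (auto intro: that)
  qed
  have tT: "s \<in> time_interval T" if "0 \<le> s" "s \<le> t1" for s
    using that t1 by (auto simp: time_interval_def intro: le_less_trans[of "ereal s" "ereal t1"])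
  have cont: "continuous_on {0..t} (\<lambda>s. X s y \<eta>)" "continuous_on {0..t} (\<lambda>s. \<Xi> s y \<eta>)"
  proof -
    have sub: "{0..t} \<subseteq> time_interval T" using tT t1 by auto
    have D: "((\<lambda>s. X s y \<eta>) has_vector_derivative nu (\<Xi> s y \<eta>)) (at s within time_interval T)"
      "((\<lambda>s. \<Xi> s y \<eta>) has_vector_derivative lorentz_force E B s (X s y \<eta>) (\<Xi> s y \<eta>)) (at s within time_interval T)"
      if "s \<in> {0..t}" for s using ch sub that by (auto simp: characteristics_def)
    have "continuous (at s within {0..t}) (\<lambda>s. X s y \<eta>)" "continuous (at s within {0..t}) (\<lambda>s. \<Xi> s y \<eta>)"
      if "s \<in> {0..t}" for s
      using D[OF that] by (auto intro: continuous_within_subset[OF has_vector_derivative_continuous sub])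
    then show "continuous_on {0..t} (\<lambda>s. X s y \<eta>)" "continuous_on {0..t} (\<lambda>s. \<Xi> s y \<eta>)"
      by (simp_all add: continuous_on_eq_continuous_within)
  qed
  obtain R0 where R0: "\<And>s. s \<in> {0..t} \<Longrightarrow> norm (X s y \<eta>) \<le> R0"
    using compact_imp_bounded[OF compact_continuous_image[OF cont(1) compact_Icc]]
    by (force simp: bounded_iff)
  \<comment> \<open>The cones with vertex on the curve stay within distance \<open>R0 + t\<close> of the origin; the margin 1 leaves
    room for space derivatives.\<close>
  define R where "R = R0 + t + 1"
  have "compact ({0..t1} \<times> cball (0 :: real^3) R)" "{0..t1} \<times> cball (0 :: real^3) R \<subseteq> time_interval T \<times> UNIV"
    using tT by (auto intro: compact_Times)
  then obtain P where P: "\<And>r z \<xi>. r \<in> {0..t1} \<Longrightarrow> z \<in> cball 0 R \<Longrightarrow> f r z \<xi> \<noteq> 0 \<Longrightarrow> norm \<xi> \<le> P"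
    using assms(14) unfolding momentum_compact_support_def by fast
  interpret sol: rvm_curve T \<rho> f E B t1 R P Eh "\<lambda>s. X s y \<eta>" "\<lambda>s. nu (\<Xi> s y \<eta>)" t
  proof
    show "Ck_on 1 (time_interval T \<times> UNIV) (\<lambda>(t, x, \<xi>). f t x \<xi>)"
      "Ck_on 2 (time_interval T \<times> UNIV) (\<lambda>(t, x). E t x)"
      "Ck_on 2 (time_interval T \<times> UNIV) (\<lambda>(t, x). B t x)"
      using assms(7-9) by (simp_all add: smooth_on_def del: One_nat_def)
    show "Ck_on 1 UNIV \<rho>" "rvm_system T \<rho> f E B" "ereal t1 < T" by fact+
    show "f r z \<xi> = 0" if "r \<in> {0..t1}" "norm z \<le> R" "norm \<xi> > P" for r z \<xi>
      using P[of r z \<xi>] that by force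
    show "homogeneous_wave T (E 0) (B 0) Eh" using assms(12,13,16) by simp
    show "0 < t1" "0 \<le> t" "t < t1" using t0 t1 by auto
    show "continuous_on {0..t} (\<lambda>s. X s y \<eta>)" by (rule cont)
    show "continuous_on {0..t} (\<lambda>s. nu (\<Xi> s y \<eta>))" by (intro continuous_intros cont)
    show "norm (X s y \<eta>) + t < R" if "s \<in> {0..t}" for s
      using R0[OF that] by (simp add: R_def)
  qed
  have "continuous_on {0..t} (\<lambda>s. (\<lambda>(t, x). E t x) (s, X s y \<eta>))"
    by (rule continuous_on_compose2[OF deriv2(1)[OF sol.E]])
       (use tT t1(1) in \<open>auto intro!: continuous_intros cont\<close>)
  then have "jbr (\<Xi> t y \<eta>) - jbr \<eta> = (LINT s:{0..t}|lborel. nu (\<Xi> s y \<eta>) \<bullet> E s (X s y \<eta>))"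
    by (intro energy_identity[OF ch t]) simp
  also have "\<dots> = D0 (f 0) (\<lambda>s. X s y \<eta>) (\<lambda>s. \<Xi> s y \<eta>) t
         + Dh Eh (\<lambda>s. X s y \<eta>) (\<lambda>s. \<Xi> s y \<eta>) t
         + Dl f (\<lambda>s. X s y \<eta>) (\<lambda>s. \<Xi> s y \<eta>) t
         + Dn f E B (\<lambda>s. X s y \<eta>) (\<lambda>s. \<Xi> s y \<eta>) t
         + D_rho \<rho> (\<lambda>s. X s y \<eta>) (\<lambda>s. \<Xi> s y \<eta>) t"
    by (rule sol.momentum_terms) (rule refl)
  finally show ?thesis using assms(11) by simp
qed

end
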